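(* Let $\mathcal{A}$ and $\mathcal{B}$ be exact categories and let $F:\mathcal{A}\to\mathcal{B}$ be an additive functor with a left adjoint $L:\mathcal{B}\to\mathcal{A}$ and a right adjoint $R:\mathcal{B}\to\mathcal{A}$. Suppose that for every object $X$ of $\mathcal{A}$ the counit $\epsilon_X:LFX\to X$ (of $L\dashv F$) is a deflation and the unit $\eta_X:X\to RFX$ (of $F\dashv R$) is an inflation. Suppose further that the full subcategory $\mathcal{P}$ of all direct summands of objects $LY$ ($Y\in\mathcal{B}$) coincides with the full subcategory $\mathcal{I}$ of all direct summands of objects $RY$ ($Y\in\mathcal{B}$). Then the quotient category $\underline{\mathcal{A}}_F:=\mathcal{A}/\mathcal{P}$ is a triangulated category, and its triangles correspond to the $F$-split exact pairs of $\mathcal{A}$.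
   Context: Exact categories are in the sense of Quillen (see Keller): an additive category with a class of distinguished kernel-cokernel pairs (exact pairs) $X\to Y\to Z$, where $X\to Y$ is called an inflation and $Y\to Z$ a deflation. An exact pair $X\to Y\to Z$ of $\mathcal{A}$ is $F$-split if $FX\to FY\to FZ$ is split exact. The quotient category $\mathcal{A}/\mathcal{P}$ has the same objects as $\mathcal{A}$, and its morphism sets are $\mathrm{Hom}_{\mathcal{A}}(X,Y)$ modulo the relation $f\sim g$ iff $f-g$ factors through an object of $\mathcal{P}$. The triangulated structure meant is the one given by Happel's theorem applied to the exact structure of $F$-split exact pairs: for each $X$ choose an $F$-split exact pair $X\to I\to X[1]$ with $I\in\mathcal{I}=\mathcal{P}$; this defines the shift functor $X\mapsto X[1]$ on the quotient. "Triangles correspond to $F$-split exact pairs" means: each $F$-split exact pair $X\to Y\to Z$ gives a triangle $X\to Y\to Z\to X[1]$, where $Z\to X[1]$ is induced by an extension $Y\to I$ of $X\to I$ along $X\to Y$, and the distinguished triangles are those isomorphic in $\mathcal{A}/\mathcal{P}$ to triangles of this form. *)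

theory Defs
  imports "HOL-Algebra.Group"
begin

record ('o, 'm) cat =
  Ob :: "'o set"
  Arr :: "'m set"
  Dom :: "'m \<Rightarrow> 'o"
  Cod :: "'m \<Rightarrow> 'o"
  Idt :: "'o \<Rightarrow> 'm"
  Comp :: "'m \<Rightarrow> 'm \<Rightarrow> 'm"  (infixr "\<cdot>\<index>" 70)

definition Hom :: "('o, 'm, 'x) cat_scheme \<Rightarrow> 'o \<Rightarrow> 'o \<Rightarrow> 'm set" where
  "Hom C X Y = {f \<in> Arr C. Dom C f = X \<and> Cod C f = Y}"

locale category =
  fixes C :: "('o, 'm, 'x) cat_scheme" (structure)
  assumes Dom_in_Ob: "f \<in> Arr C \<Longrightarrow> Dom C f \<in> Ob C"
    and Cod_in_Ob: "f \<in> Arr C \<Longrightarrow> Cod C f \<in> Ob C"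
    and Idt_in_Hom: "X \<in> Ob C \<Longrightarrow> Idt C X \<in> Hom C X X"
    and Comp_in_Hom: "\<lbrakk>f \<in> Hom C X Y; g \<in> Hom C Y Z\<rbrakk> \<Longrightarrow> g \<cdot> f \<in> Hom C X Z"
    and Comp_Idt: "f \<in> Hom C X Y \<Longrightarrow> f \<cdot> Idt C X = f"
    and Idt_Comp: "f \<in> Hom C X Y \<Longrightarrow> Idt C Y \<cdot> f = f"
    and Comp_assoc: "\<lbrakk>f \<in> Hom C W X; g \<in> Hom C X Y; h \<in> Hom C Y Z\<rbrakk>
      \<Longrightarrow> (h \<cdot> g) \<cdot> f = h \<cdot> (g \<cdot> f)"

definition is_iso :: "('o, 'm, 'x) cat_scheme \<Rightarrow> 'm \<Rightarrow> bool" where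
  "is_iso C f \<longleftrightarrow> f \<in> Arr C \<and> (\<exists>g \<in> Hom C (Cod C f) (Dom C f).
     g \<cdot>\<^bsub>C\<^esub> f = Idt C (Dom C f) \<and> f \<cdot>\<^bsub>C\<^esub> g = Idt C (Cod C f))"

record ('o, 'm, 'p, 'n) func =
  ob :: "'o \<Rightarrow> 'p"
  ar :: "'m \<Rightarrow> 'n"

locale cat_functor = C: category C + D: category D
  for C :: "('o, 'm, 'x) cat_scheme" and D :: "('p, 'n, 'y) cat_scheme"
    and F :: "('o, 'm, 'p, 'n) func" +
  assumes ob_in_Ob: "X \<in> Ob C \<Longrightarrow> ob F X \<in> Ob D"
    and ar_in_Hom: "f \<in> Hom C X Y \<Longrightarrow> ar F f \<in> Hom D (ob F X) (ob F Y)"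
    and ar_Idt: "X \<in> Ob C \<Longrightarrow> ar F (Idt C X) = Idt D (ob F X)"
    and ar_Comp: "\<lbrakk>f \<in> Hom C X Y; g \<in> Hom C Y Z\<rbrakk>
      \<Longrightarrow> ar F (g \<cdot>\<^bsub>C\<^esub> f) = ar F g \<cdot>\<^bsub>D\<^esub> ar F f"

definition id_func :: "('o, 'm, 'o, 'm) func" where
  "id_func = \<lparr>ob = (\<lambda>X. X), ar = (\<lambda>f. f)\<rparr>"

definition comp_func ::
  "('p, 'n, 'q, 'l) func \<Rightarrow> ('o, 'm, 'p, 'n) func \<Rightarrow> ('o, 'm, 'q, 'l) func" where
  "comp_func G F = \<lparr>ob = (\<lambda>X. ob G (ob F X)), ar = (\<lambda>f. ar G (ar F f))\<rparr>"

locale nat_transformation = F: cat_functor C D F + G: cat_functor C D G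
  for C :: "('o, 'm, 'x) cat_scheme" and D :: "('p, 'n, 'y) cat_scheme"
    and F G :: "('o, 'm, 'p, 'n) func" +
  fixes \<tau> :: "'o \<Rightarrow> 'n"
  assumes component_in_Hom: "X \<in> Ob C \<Longrightarrow> \<tau> X \<in> Hom D (ob F X) (ob G X)"
    and naturality: "f \<in> Hom C X Y \<Longrightarrow> \<tau> Y \<cdot>\<^bsub>D\<^esub> ar F f = ar G f \<cdot>\<^bsub>D\<^esub> \<tau> X"

locale nat_isomorphism = nat_transformation +
  assumes component_iso: "X \<in> Ob C \<Longrightarrow> is_iso D (\<tau> X)"

definition is_equivalence ::
  "('o, 'm, 'x) cat_scheme \<Rightarrow> ('p, 'n, 'y) cat_scheme \<Rightarrow> ('o, 'm, 'p, 'n) func \<Rightarrow> bool" where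
  "is_equivalence C D F \<longleftrightarrow> (\<exists>G \<alpha> \<beta>.
     nat_isomorphism C C id_func (comp_func G F) \<alpha> \<and>
     nat_isomorphism D D (comp_func F G) id_func \<beta>)"

text \<open>\<open>adjunction C D L R \<eta> \<epsilon>\<close>: the functor \<open>L : D \<rightarrow> C\<close> is left adjoint to
  \<open>R : C \<rightarrow> D\<close>, with unit \<open>\<eta>\<close> and counit \<open>\<epsilon>\<close>.\<close>

locale adjunction =
  L: cat_functor D C L + R: cat_functor C D R +
  unit: nat_transformation D D id_func "comp_func R L" \<eta> +
  counit: nat_transformation C C "comp_func L R" id_func \<epsilon>
  for C :: "('o, 'm, 'x) cat_scheme" and D :: "('p, 'n, 'y) cat_scheme"
    and L :: "('p, 'n, 'o, 'm) func" and R :: "('o, 'm, 'p, 'n) func"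
    and \<eta> :: "'p \<Rightarrow> 'n" and \<epsilon> :: "'o \<Rightarrow> 'm" +
  assumes counit_unit_L: "Y \<in> Ob D \<Longrightarrow> \<epsilon> (ob L Y) \<cdot>\<^bsub>C\<^esub> ar L (\<eta> Y) = Idt C (ob L Y)"
    and counit_unit_R: "X \<in> Ob C \<Longrightarrow> ar R (\<epsilon> X) \<cdot>\<^bsub>D\<^esub> \<eta> (ob R X) = Idt D (ob R X)"

record ('o, 'm) addcat = "('o, 'm) cat" +
  Add :: "'m \<Rightarrow> 'm \<Rightarrow> 'm"  (infixl "\<boxplus>\<index>" 65)
  Zero :: "'o \<Rightarrow> 'o \<Rightarrow> 'm"

definition hom_group :: "('o, 'm, 'x) addcat_scheme \<Rightarrow> 'o \<Rightarrow> 'o \<Rightarrow> 'm monoid" where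
  "hom_group C X Y = \<lparr>carrier = Hom C X Y, mult = Add C, one = Zero C X Y\<rparr>"

definition Neg :: "('o, 'm, 'x) addcat_scheme \<Rightarrow> 'm \<Rightarrow> 'm" where
  "Neg C f = inv\<^bsub>hom_group C (Dom C f) (Cod C f)\<^esub> f"

definition zero_object :: "('o, 'm, 'x) cat_scheme \<Rightarrow> 'o \<Rightarrow> bool" where
  "zero_object C Z \<longleftrightarrow> Z \<in> Ob C \<and>
     (\<forall>X \<in> Ob C. (\<exists>!f. f \<in> Hom C X Z) \<and> (\<exists>!f. f \<in> Hom C Z X))"

text \<open>\<open>biproduct C X Z Y i s r p\<close>: the object \<open>Y\<close> is the direct sum of \<open>X\<close> and \<open>Z\<close>, with
  injections \<open>i : X \<rightarrow> Y\<close>, \<open>s : Z \<rightarrow> Y\<close> and projections \<open>r : Y \<rightarrow> X\<close>, \<open>p : Y \<rightarrow> Z\<close>.\<close>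

definition biproduct :: "('o, 'm, 'x) addcat_scheme \<Rightarrow>
    'o \<Rightarrow> 'o \<Rightarrow> 'o \<Rightarrow> 'm \<Rightarrow> 'm \<Rightarrow> 'm \<Rightarrow> 'm \<Rightarrow> bool" where
  "biproduct C X Z Y i s r p \<longleftrightarrow>
     X \<in> Ob C \<and> Z \<in> Ob C \<and> Y \<in> Ob C \<and>
     i \<in> Hom C X Y \<and> s \<in> Hom C Z Y \<and> r \<in> Hom C Y X \<and> p \<in> Hom C Y Z \<and>
     r \<cdot>\<^bsub>C\<^esub> i = Idt C X \<and> p \<cdot>\<^bsub>C\<^esub> s = Idt C Z \<and>
     r \<cdot>\<^bsub>C\<^esub> s = Zero C Z X \<and> p \<cdot>\<^bsub>C\<^esub> i = Zero C X Z \<and>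
     (i \<cdot>\<^bsub>C\<^esub> r) \<boxplus>\<^bsub>C\<^esub> (s \<cdot>\<^bsub>C\<^esub> p) = Idt C Y"

locale additive_category = category C
  for C :: "('o, 'm, 'x) addcat_scheme" (structure) +
  assumes Hom_comm_group: "\<lbrakk>X \<in> Ob C; Y \<in> Ob C\<rbrakk> \<Longrightarrow> comm_group (hom_group C X Y)"
    and Comp_Add: "\<lbrakk>f \<in> Hom C X Y; f' \<in> Hom C X Y; g \<in> Hom C Y Z\<rbrakk>
      \<Longrightarrow> g \<cdot> (f \<boxplus> f') = (g \<cdot> f) \<boxplus> (g \<cdot> f')"
    and Add_Comp: "\<lbrakk>f \<in> Hom C X Y; g \<in> Hom C Y Z; g' \<in> Hom C Y Z\<rbrakk>
      \<Longrightarrow> (g \<boxplus> g') \<cdot> f = (g \<cdot> f) \<boxplus> (g' \<cdot> f)"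
    and ex_zero_object: "\<exists>Z. zero_object C Z"
    and ex_biproduct: "\<lbrakk>X \<in> Ob C; Z \<in> Ob C\<rbrakk> \<Longrightarrow> \<exists>Y i s r p. biproduct C X Z Y i s r p"

locale additive_functor = cat_functor C D F + C: additive_category C + D: additive_category D
  for C :: "('o, 'm, 'x) addcat_scheme" and D :: "('p, 'n, 'y) addcat_scheme"
    and F :: "('o, 'm, 'p, 'n) func" +
  assumes ar_Add: "\<lbrakk>f \<in> Hom C X Y; g \<in> Hom C X Y\<rbrakk>
    \<Longrightarrow> ar F (f \<boxplus>\<^bsub>C\<^esub> g) = ar F f \<boxplus>\<^bsub>D\<^esub> ar F g"

definition direct_summand :: "('o, 'm, 'x) addcat_scheme \<Rightarrow> 'o \<Rightarrow> 'o \<Rightarrow> bool" where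
  "direct_summand C X Y \<longleftrightarrow> (\<exists>X' i s r p. biproduct C X X' Y i s r p)"

definition direct_summands :: "('o, 'm, 'x) addcat_scheme \<Rightarrow> 'o set \<Rightarrow> 'o set" where
  "direct_summands C S = {X. \<exists>Y \<in> S. direct_summand C X Y}"

definition split_exact :: "('o, 'm, 'x) addcat_scheme \<Rightarrow> 'm \<Rightarrow> 'm \<Rightarrow> bool" where
  "split_exact C i p \<longleftrightarrow> (\<exists>X Y Z s r. biproduct C X Z Y i s r p)"

definition is_kernel :: "('o, 'm, 'x) addcat_scheme \<Rightarrow> 'm \<Rightarrow> 'm \<Rightarrow> bool" where
  "is_kernel C i p \<longleftrightarrow> (\<exists>X Y Z. i \<in> Hom C X Y \<and> p \<in> Hom C Y Z \<and>
     p \<cdot>\<^bsub>C\<^esub> i = Zero C X Z \<and>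
     (\<forall>W. \<forall>f \<in> Hom C W Y. p \<cdot>\<^bsub>C\<^esub> f = Zero C W Z
        \<longrightarrow> (\<exists>!g. g \<in> Hom C W X \<and> i \<cdot>\<^bsub>C\<^esub> g = f)))"

definition is_cokernel :: "('o, 'm, 'x) addcat_scheme \<Rightarrow> 'm \<Rightarrow> 'm \<Rightarrow> bool" where
  "is_cokernel C i p \<longleftrightarrow> (\<exists>X Y Z. i \<in> Hom C X Y \<and> p \<in> Hom C Y Z \<and>
     p \<cdot>\<^bsub>C\<^esub> i = Zero C X Z \<and>
     (\<forall>W. \<forall>f \<in> Hom C Y W. f \<cdot>\<^bsub>C\<^esub> i = Zero C X W
        \<longrightarrow> (\<exists>!g. g \<in> Hom C Z W \<and> g \<cdot>\<^bsub>C\<^esub> p = f)))"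

text \<open>\<open>is_pullback C q h p f\<close>: the square \<open>p h = f q\<close>, with \<open>p : Y \<rightarrow> Z\<close>, \<open>f : Z' \<rightarrow> Z\<close>,
  \<open>q : Y' \<rightarrow> Z'\<close> and \<open>h : Y' \<rightarrow> Y\<close>, is cartesian; \<open>is_pushout C j h i f\<close>: the square
  \<open>h i = j f\<close>, with \<open>i : X \<rightarrow> Y\<close>, \<open>f : X \<rightarrow> X'\<close>, \<open>j : X' \<rightarrow> Y'\<close> and \<open>h : Y \<rightarrow> Y'\<close>, is
  cocartesian.\<close>

definition is_pullback :: "('o, 'm, 'x) cat_scheme \<Rightarrow> 'm \<Rightarrow> 'm \<Rightarrow> 'm \<Rightarrow> 'm \<Rightarrow> bool" where
  "is_pullback C q h p f \<longleftrightarrow> (\<exists>Y' Y Z' Z.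
     q \<in> Hom C Y' Z' \<and> h \<in> Hom C Y' Y \<and> p \<in> Hom C Y Z \<and> f \<in> Hom C Z' Z \<and>
     p \<cdot>\<^bsub>C\<^esub> h = f \<cdot>\<^bsub>C\<^esub> q \<and>
     (\<forall>W. \<forall>a \<in> Hom C W Y. \<forall>b \<in> Hom C W Z'. p \<cdot>\<^bsub>C\<^esub> a = f \<cdot>\<^bsub>C\<^esub> b
        \<longrightarrow> (\<exists>!c. c \<in> Hom C W Y' \<and> h \<cdot>\<^bsub>C\<^esub> c = a \<and> q \<cdot>\<^bsub>C\<^esub> c = b)))"

definition is_pushout :: "('o, 'm, 'x) cat_scheme \<Rightarrow> 'm \<Rightarrow> 'm \<Rightarrow> 'm \<Rightarrow> 'm \<Rightarrow> bool" where
  "is_pushout C j h i f \<longleftrightarrow> (\<exists>X Y X' Y'.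
     j \<in> Hom C X' Y' \<and> h \<in> Hom C Y Y' \<and> i \<in> Hom C X Y \<and> f \<in> Hom C X X' \<and>
     h \<cdot>\<^bsub>C\<^esub> i = j \<cdot>\<^bsub>C\<^esub> f \<and>
     (\<forall>W. \<forall>a \<in> Hom C Y W. \<forall>b \<in> Hom C X' W. a \<cdot>\<^bsub>C\<^esub> i = b \<cdot>\<^bsub>C\<^esub> f
        \<longrightarrow> (\<exists>!c. c \<in> Hom C Y' W \<and> c \<cdot>\<^bsub>C\<^esub> h = a \<and> c \<cdot>\<^bsub>C\<^esub> j = b)))"

definition inflation :: "('m \<times> 'm) set \<Rightarrow> 'm \<Rightarrow> bool" where
  "inflation E i \<longleftrightarrow> (\<exists>p. (i, p) \<in> E)"

definition deflation :: "('m \<times> 'm) set \<Rightarrow> 'm \<Rightarrow> bool" where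
  "deflation E p \<longleftrightarrow> (\<exists>i. (i, p) \<in> E)"

locale exact_category = additive_category C
  for C :: "('o, 'm, 'x) addcat_scheme" (structure) +
  fixes E :: "('m \<times> 'm) set"
  assumes kernel_cokernel_pair: "(i, p) \<in> E \<Longrightarrow> is_kernel C i p \<and> is_cokernel C i p"
    and iso_closed: "\<lbrakk>(i, p) \<in> E; i' \<in> Hom C X' Y'; p' \<in> Hom C Y' Z';
        is_iso C a; a \<in> Hom C (Dom C i) X';
        is_iso C b; b \<in> Hom C (Cod C i) Y';
        is_iso C c; c \<in> Hom C (Cod C p) Z';
        b \<cdot> i = i' \<cdot> a; c \<cdot> p = p' \<cdot> b\<rbrakk> \<Longrightarrow> (i', p') \<in> E"
    and Idt_zero_deflation: "zero_object C Z \<Longrightarrow> deflation E (Idt C Z)"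
    and deflation_Comp: "\<lbrakk>deflation E p; deflation E q; Cod C p = Dom C q\<rbrakk>
        \<Longrightarrow> deflation E (q \<cdot> p)"
    and inflation_Comp: "\<lbrakk>inflation E i; inflation E j; Cod C i = Dom C j\<rbrakk>
        \<Longrightarrow> inflation E (j \<cdot> i)"
    and deflation_pullback: "\<lbrakk>deflation E p; f \<in> Hom C Z' (Cod C p)\<rbrakk>
        \<Longrightarrow> \<exists>q h. is_pullback C q h p f \<and> deflation E q"
    and inflation_pushout: "\<lbrakk>inflation E i; f \<in> Hom C (Dom C i) X'\<rbrakk>
        \<Longrightarrow> \<exists>j h. is_pushout C j h i f \<and> inflation E j"

definition is_triangle ::
  "('o, 'm, 'x) cat_scheme \<Rightarrow> ('o, 'm, 'o, 'm) func \<Rightarrow> 'm \<times> 'm \<times> 'm \<Rightarrow> bool" where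
  "is_triangle C S = (\<lambda>(u, v, w). \<exists>X Y Z.
     u \<in> Hom C X Y \<and> v \<in> Hom C Y Z \<and> w \<in> Hom C Z (ob S X))"

definition triangle_iso :: "('o, 'm, 'x) cat_scheme \<Rightarrow> ('o, 'm, 'o, 'm) func \<Rightarrow>
    'm \<times> 'm \<times> 'm \<Rightarrow> 'm \<times> 'm \<times> 'm \<Rightarrow> bool" where
  "triangle_iso C S = (\<lambda>(u, v, w) (u', v', w').
     is_triangle C S (u, v, w) \<and> is_triangle C S (u', v', w') \<and>
     (\<exists>a b c. is_iso C a \<and> a \<in> Hom C (Dom C u) (Dom C u') \<and>
              is_iso C b \<and> b \<in> Hom C (Dom C v) (Dom C v') \<and>
              is_iso C c \<and> c \<in> Hom C (Dom C w) (Dom C w') \<and>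
              b \<cdot>\<^bsub>C\<^esub> u = u' \<cdot>\<^bsub>C\<^esub> a \<and>
              c \<cdot>\<^bsub>C\<^esub> v = v' \<cdot>\<^bsub>C\<^esub> b \<and>
              ar S a \<cdot>\<^bsub>C\<^esub> w = w' \<cdot>\<^bsub>C\<^esub> c))"

text \<open>The shift is only required to be an autoequivalence; accordingly (TR2) is stated as an
  equivalence, so that no inverse of the shift is needed.\<close>

locale triangulated_category = additive_category C + shift: additive_functor C C S
  for C :: "('o, 'm, 'x) addcat_scheme" (structure) and S :: "('o, 'm, 'o, 'm) func" +
  fixes T :: "('m \<times> 'm \<times> 'm) set"
  assumes shift_equivalence: "is_equivalence C C S"
    and distinguished_is_triangle: "t \<in> T \<Longrightarrow> is_triangle C S t"
    and distinguished_iso_closed: "\<lbrakk>t \<in> T; triangle_iso C S t t'\<rbrakk> \<Longrightarrow> t' \<in> T"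
    and TR1_Idt: "\<lbrakk>X \<in> Ob C; zero_object C Z\<rbrakk>
      \<Longrightarrow> (Idt C X, Zero C X Z, Zero C Z (ob S X)) \<in> T"
    and TR1_cone: "u \<in> Arr C \<Longrightarrow> \<exists>v w. (u, v, w) \<in> T"
    and TR2: "is_triangle C S (u, v, w)
      \<Longrightarrow> (u, v, w) \<in> T \<longleftrightarrow> (v, w, Neg C (ar S u)) \<in> T"
    and TR3: "\<lbrakk>(u, v, w) \<in> T; (u', v', w') \<in> T;
        f \<in> Hom C (Dom C u) (Dom C u'); g \<in> Hom C (Cod C u) (Cod C u');
        g \<cdot> u = u' \<cdot> f\<rbrakk>
      \<Longrightarrow> \<exists>h \<in> Hom C (Cod C v) (Cod C v'). h \<cdot> v = v' \<cdot> g \<and> w' \<cdot> h = ar S f \<cdot> w"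
    and TR4: "\<lbrakk>u \<in> Hom C X Y; v \<in> Hom C Y Z;
        (u, j, k) \<in> T; (v, l, i) \<in> T; (v \<cdot> u, m, n) \<in> T\<rbrakk>
      \<Longrightarrow> \<exists>f \<in> Hom C (Cod C j) (Cod C m). \<exists>g \<in> Hom C (Cod C m) (Cod C l).
            (f, g, ar S j \<cdot> i) \<in> T \<and>
            f \<cdot> j = m \<cdot> v \<and> n \<cdot> f = k \<and> g \<cdot> m = l \<and> i \<cdot> g = ar S u \<cdot> n"

definition factors_through :: "('o, 'm, 'x) cat_scheme \<Rightarrow> 'o set \<Rightarrow> 'm \<Rightarrow> bool" where
  "factors_through C P f \<longleftrightarrow> (\<exists>W \<in> P. \<exists>a \<in> Hom C (Dom C f) W. \<exists>b \<in> Hom C W (Cod C f).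
     f = b \<cdot>\<^bsub>C\<^esub> a)"

definition cls :: "('o, 'm, 'x) addcat_scheme \<Rightarrow> 'o set \<Rightarrow> 'm \<Rightarrow> 'm set" where
  "cls C P f = {g \<in> Hom C (Dom C f) (Cod C f). factors_through C P (f \<boxplus>\<^bsub>C\<^esub> Neg C g)}"

text \<open>As usual for operations on equivalence classes, composition and addition are unions over all
  representatives; these are single classes because the operations respect the relation.\<close>

definition quotient_cat :: "('o, 'm, 'x) addcat_scheme \<Rightarrow> 'o set \<Rightarrow> ('o, 'm set) addcat" where
  "quotient_cat C P =
    \<lparr>Ob = Ob C,
     Arr = cls C P ` Arr C,
     Dom = (\<lambda>\<phi>. the_elem (Dom C ` \<phi>)),
     Cod = (\<lambda>\<phi>. the_elem (Cod C ` \<phi>)),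
     Idt = (\<lambda>X. cls C P (Idt C X)),
     Comp = (\<lambda>\<psi> \<phi>. \<Union>g \<in> \<psi>. \<Union>f \<in> \<phi>. cls C P (g \<cdot>\<^bsub>C\<^esub> f)),
     Add = (\<lambda>\<phi> \<psi>. \<Union>f \<in> \<phi>. \<Union>g \<in> \<psi>. cls C P (f \<boxplus>\<^bsub>C\<^esub> g)),
     Zero = (\<lambda>X Y. cls C P (Zero C X Y))\<rparr>"

definition F_split_pairs :: "('p, 'n, 'y) addcat_scheme \<Rightarrow> ('o, 'm, 'p, 'n) func \<Rightarrow>
    ('m \<times> 'm) set \<Rightarrow> ('m \<times> 'm) set" where
  "F_split_pairs B F E = {(i, p) \<in> E. split_exact B (ar F i) (ar F p)}"

text \<open>In the following, \<open>E\<close> is a class of exact pairs and \<open>X \<rightarrow> I X \<rightarrow> X[1]\<close>, with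
  \<open>I X \<in> P\<close>, is the pair \<open>(\<iota> X, \<pi> X) \<in> E\<close> chosen for \<open>X\<close>.\<close>

definition shift_choice :: "('o, 'm, 'x) cat_scheme \<Rightarrow> ('m \<times> 'm) set \<Rightarrow> 'o set \<Rightarrow>
    ('o \<Rightarrow> 'm) \<Rightarrow> ('o \<Rightarrow> 'm) \<Rightarrow> bool" where
  "shift_choice C E P \<iota> \<pi> \<longleftrightarrow>
     (\<forall>X \<in> Ob C. (\<iota> X, \<pi> X) \<in> E \<and> Dom C (\<iota> X) = X \<and> Cod C (\<iota> X) \<in> P)"

text \<open>A class \<open>\<phi>\<close> with representative \<open>f : X \<rightarrow> Y\<close> is shifted to the class of any \<open>h\<close> that fits
  into a map \<open>(f, g, h)\<close> from the pair chosen for \<open>X\<close> to the pair chosen for \<open>Y\<close>. The definite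
  description carries the independence of \<open>f\<close>, \<open>g\<close> and \<open>h\<close>.\<close>

definition shift_func :: "('o, 'm, 'x) addcat_scheme \<Rightarrow> 'o set \<Rightarrow> ('o \<Rightarrow> 'm) \<Rightarrow> ('o \<Rightarrow> 'm) \<Rightarrow>
    ('o, 'm set, 'o, 'm set) func" where
  "shift_func C P \<iota> \<pi> =
    \<lparr>ob = (\<lambda>X. Cod C (\<pi> X)),
     ar = (\<lambda>\<phi>. THE \<psi>. \<exists>X Y. \<exists>f \<in> \<phi> \<inter> Hom C X Y.
       \<exists>g \<in> Hom C (Cod C (\<iota> X)) (Cod C (\<iota> Y)). \<exists>h \<in> Hom C (Cod C (\<pi> X)) (Cod C (\<pi> Y)).
         g \<cdot>\<^bsub>C\<^esub> \<iota> X = \<iota> Y \<cdot>\<^bsub>C\<^esub> f \<and> h \<cdot>\<^bsub>C\<^esub> \<pi> X = \<pi> Y \<cdot>\<^bsub>C\<^esub> g \<and> \<psi> = cls C P h)\<rparr>"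

text \<open>For \<open>X \<rightarrow> Y \<rightarrow> Z\<close> given by \<open>i\<close> and \<open>p\<close>, the map \<open>w : Z \<rightarrow> X[1]\<close> is induced by an extension
  \<open>e : Y \<rightarrow> I X\<close> of \<open>\<iota> X\<close> along \<open>i\<close>.\<close>

definition connecting :: "('o, 'm, 'x) cat_scheme \<Rightarrow> ('o \<Rightarrow> 'm) \<Rightarrow> ('o \<Rightarrow> 'm) \<Rightarrow>
    'm \<Rightarrow> 'm \<Rightarrow> 'm \<Rightarrow> bool" where
  "connecting C \<iota> \<pi> i p w \<longleftrightarrow>
     w \<in> Hom C (Cod C p) (Cod C (\<pi> (Dom C i))) \<and>
     (\<exists>e \<in> Hom C (Cod C i) (Cod C (\<iota> (Dom C i))).
        e \<cdot>\<^bsub>C\<^esub> i = \<iota> (Dom C i) \<and> w \<cdot>\<^bsub>C\<^esub> p = \<pi> (Dom C i) \<cdot>\<^bsub>C\<^esub> e)"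

definition standard_triangles :: "('o, 'm, 'x) addcat_scheme \<Rightarrow> 'o set \<Rightarrow> ('m \<times> 'm) set \<Rightarrow>
    ('o \<Rightarrow> 'm) \<Rightarrow> ('o \<Rightarrow> 'm) \<Rightarrow> ('m set \<times> 'm set \<times> 'm set) set" where
  "standard_triangles C P E \<iota> \<pi> =
     {(cls C P i, cls C P p, cls C P w) | i p w. (i, p) \<in> E \<and> connecting C \<iota> \<pi> i p w}"

definition distinguished_triangles :: "('o, 'm, 'x) addcat_scheme \<Rightarrow> 'o set \<Rightarrow> ('m \<times> 'm) set \<Rightarrow>
    ('o \<Rightarrow> 'm) \<Rightarrow> ('o \<Rightarrow> 'm) \<Rightarrow> ('m set \<times> 'm set \<times> 'm set) set" where
  "distinguished_triangles C P E \<iota> \<pi> =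
     {t. \<exists>t' \<in> standard_triangles C P E \<iota> \<pi>.
        triangle_iso (quotient_cat C P) (shift_func C P \<iota> \<pi>) t t'}"

end

theory Submission
  imports Defs
begin

text \<open>The theorem is Happel's theorem on stable categories of Frobenius categories, applied to the
  \<open>F\<close>-split pairs.

  Having adjoints on both sides, \<open>F\<close> preserves kernels and cokernels. Hence an exact pair \<open>(i, p)\<close>
  is \<open>F\<close>-split as soon as \<open>F p\<close> has a section or \<open>F i\<close> has a retraction
  (\<open>right_adjoint_split_if_section\<close>, \<open>left_adjoint_split_if_retraction\<close>). From this it follows that
  \<open>F\<close>-split inflations are closed under composition and pushout, and that the units \<open>X \<rightarrow> R (F X)\<close>
  and counits \<open>L (F X) \<rightarrow> X\<close> belong to \<open>F\<close>-split pairs, since the triangle identities split their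
  images under \<open>F\<close>. By adjunction the objects \<open>L Y\<close> are projective and the objects \<open>R Y\<close> are
  injective relative to \<open>F\<close>-split pairs. As their summands form the same class \<open>P\<close>, the \<open>F\<close>-split
  pairs are a Frobenius structure with \<open>P\<close> as its class of projective-injective objects
  (\<open>frobenius\<close>).

  For any such structure, a map of pairs into a pair with middle object in \<open>P\<close> is determined on
  third objects, modulo \<open>P\<close>, by its class on first objects (\<open>pair_map_unique\<close>). This gives
  the shift functor, the uniqueness of the class of the connecting map of a pair, and its
  naturality. Lifting and extending maps shows that the shift is fully faithful, and essential
  surjectivity comes from the existence of enough projectives.

  The triangles of pairs satisfy the remaining axioms up to isomorphism: a map becomes an inflation
  after its codomain is enlarged within its stable isomorphism class (\<open>standard_cone\<close>), rotation
  is given by a pushout (\<open>standard_rotate\<close>), and the octahedron is Noether's isomorphism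
  (\<open>standard_octahedron\<close>). That these weak forms of the axioms suffice is a formal argument, carried
  out in the locale \<open>pretriangulation\<close>: a comparison of triangles between isomorphic first maps is
  an isomorphism, because an endomorphism of a triangle that is the identity on the first two
  objects is unipotent.

  Elements of hom-sets are mostly compared in the form \<open>f = g + b a\<close>, which keeps inverses out of
  the calculations.\<close>

section \<open>Categories and additive categories\<close>

context category
begin

lemma HomD:
  assumes "f \<in> Hom C X Y"
  shows "f \<in> Arr C" "Dom C f = X" "Cod C f = Y" "X \<in> Ob C" "Y \<in> Ob C"
  using assms Dom_in_Ob Cod_in_Ob by (auto simp: Hom_def)

lemma Hom_simps:
  "f \<in> Hom C X Y \<Longrightarrow> f \<in> Arr C \<and> Dom C f = X \<and> Cod C f = Y \<and> X \<in> Ob C \<and> Y \<in> Ob C"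
  using HomD by blast

lemma HomI: "\<lbrakk>f \<in> Arr C; Dom C f = X; Cod C f = Y\<rbrakk> \<Longrightarrow> f \<in> Hom C X Y"
  by (simp add: Hom_def)

lemma Arr_iff_Hom: "f \<in> Arr C \<longleftrightarrow> f \<in> Hom C (Dom C f) (Cod C f)"
  by (simp add: Hom_def)

text \<open>The laws of a category, restated with conditions on \<open>Arr\<close>, \<open>Dom\<close> and \<open>Cod\<close> instead of
  \<open>Hom\<close>: in this form they are conditional rewrite rules without extra variables, and composites
  are brought into a normal form that is associated to the right.\<close>

lemma Idt_simps [simp]:
  assumes "X \<in> Ob C"
  shows "Idt C X \<in> Arr C" "Dom C (Idt C X) = X" "Cod C (Idt C X) = X"
  using Idt_in_Hom[OF assms] by (auto simp: Hom_def)

lemma Comp_simps [simp]: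
  assumes "f \<in> Arr C" "g \<in> Arr C" "Cod C f = Dom C g"
  shows "g \<cdot> f \<in> Arr C" "Dom C (g \<cdot> f) = Dom C f" "Cod C (g \<cdot> f) = Cod C g"
  using Comp_in_Hom[of f "Dom C f" "Cod C f" g "Cod C g"] assms by (auto simp: Hom_def)

lemma Comp_Idt_simp [simp]: "\<lbrakk>f \<in> Arr C; Dom C f = X\<rbrakk> \<Longrightarrow> f \<cdot> Idt C X = f"
  using Comp_Idt[of f X "Cod C f"] by (auto simp: Hom_def)

lemma Idt_Comp_simp [simp]: "\<lbrakk>f \<in> Arr C; Cod C f = Y\<rbrakk> \<Longrightarrow> Idt C Y \<cdot> f = f"
  using Idt_Comp[of f "Dom C f" Y] by (auto simp: Hom_def)

lemma Comp_assoc_simp [simp]: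
  "\<lbrakk>f \<in> Arr C; g \<in> Arr C; h \<in> Arr C; Cod C f = Dom C g; Cod C g = Dom C h\<rbrakk>
    \<Longrightarrow> (h \<cdot> g) \<cdot> f = h \<cdot> (g \<cdot> f)"
  using Comp_assoc[of f "Dom C f" "Cod C f" g "Cod C g" h "Cod C h"] by (auto simp: Hom_def)

text \<open>The form in which an equation \<open>g f = k\<close> is applied inside a composite associated to the
  right.\<close>

lemma Comp_eq:
  assumes "g \<cdot> f = k" "x \<in> Arr C" "f \<in> Arr C" "g \<in> Arr C" "Cod C x = Dom C f" "Cod C f = Dom C g"
  shows "g \<cdot> (f \<cdot> x) = k \<cdot> x"
  using Comp_assoc_simp[of x f g] assms by simp

lemma is_isoI:
  assumes "f \<in> Hom C X Y" "g \<in> Hom C Y X" "g \<cdot> f = Idt C X" "f \<cdot> g = Idt C Y"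
  shows "is_iso C f"
  using assms by (auto simp: is_iso_def Hom_def)

lemma is_isoE:
  assumes "is_iso C f" "f \<in> Hom C X Y"
  obtains g where "g \<in> Hom C Y X" "g \<cdot> f = Idt C X" "f \<cdot> g = Idt C Y" "is_iso C g"
  using assms by (auto simp: is_iso_def Hom_def)

lemma is_iso_Idt: "X \<in> Ob C \<Longrightarrow> is_iso C (Idt C X)"
  by (rule is_isoI[of _ X X "Idt C X"]) (auto simp: Hom_def)

lemma is_iso_Comp:
  assumes "is_iso C f" "f \<in> Hom C X Y" "is_iso C g" "g \<in> Hom C Y Z"
  shows "is_iso C (g \<cdot> f)"
proof -
  obtain f' where f': "f' \<in> Hom C Y X" "f' \<cdot> f = Idt C X" "f \<cdot> f' = Idt C Y"
    using is_isoE[OF assms(1,2)] .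
  obtain g' where g': "g' \<in> Hom C Z Y" "g' \<cdot> g = Idt C Y" "g \<cdot> g' = Idt C Z"
    using is_isoE[OF assms(3,4)] .
  note [THEN Hom_simps, simp] = assms(2,4) f'(1) g'(1)
  note [simp] = f'(2,3) g'(2,3) Comp_eq[OF f'(3)] Comp_eq[OF g'(2)]
  show ?thesis
    by (rule is_isoI[of _ X Z "f' \<cdot> g'"]) (simp_all add: Hom_def)
qed

lemma iso_cancel_left:
  assumes "is_iso C f" "f \<in> Hom C Y Z" "a \<in> Hom C X Y" "b \<in> Hom C X Y" "f \<cdot> a = f \<cdot> b"
  shows "a = b"
proof -
  obtain f' where f': "f' \<in> Hom C Z Y" "f' \<cdot> f = Idt C Y" "f \<cdot> f' = Idt C Z"
    using is_isoE[OF assms(1,2)] .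
  note [THEN Hom_simps, simp] = assms(2-4) f'(1)
  show ?thesis
    using arg_cong[OF assms(5), of "\<lambda>x. f' \<cdot> x"]
    by (simp add: Comp_eq[OF f'(2)])
qed

text \<open>The objects in the definition of a pushout square are determined by its maps; existence and
  uniqueness of the induced map are given separately.\<close>

lemma is_pushoutE:
  assumes po: "is_pushout C j h i f" and i: "i \<in> Hom C X Y" and f: "f \<in> Hom C X X'"
  obtains W where "j \<in> Hom C X' W" "h \<in> Hom C Y W" "h \<cdot> i = j \<cdot> f"
    "\<And>V a b. \<lbrakk>a \<in> Hom C Y V; b \<in> Hom C X' V; a \<cdot> i = b \<cdot> f\<rbrakk>
      \<Longrightarrow> \<exists>c \<in> Hom C W V. c \<cdot> h = a \<and> c \<cdot> j = b"
    "\<And>V c c'. \<lbrakk>c \<in> Hom C W V; c' \<in> Hom C W V; c \<cdot> h = c' \<cdot> h; c \<cdot> j = c' \<cdot> j\<rbrakk> \<Longrightarrow> c = c'"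
proof -
  note [THEN Hom_simps, simp] = i f
  from po obtain X1 Y1 X1' W where H: "j \<in> Hom C X1' W" "h \<in> Hom C Y1 W" "i \<in> Hom C X1 Y1"
      "f \<in> Hom C X1 X1'" and sq: "h \<cdot> i = j \<cdot> f"
    and univ: "\<And>V a b. \<lbrakk>a \<in> Hom C Y1 V; b \<in> Hom C X1' V; a \<cdot> i = b \<cdot> f\<rbrakk>
      \<Longrightarrow> \<exists>!c. c \<in> Hom C W V \<and> c \<cdot> h = a \<and> c \<cdot> j = b"
    unfolding is_pushout_def by blast
  have XY: "Y1 = Y" "X1' = X'" using HomD(3)[OF H(3)] HomD(3)[OF H(4)] by simp_all
  note j = H(1)[unfolded XY] and h = H(2)[unfolded XY] and univ = univ[unfolded XY]
  note [THEN Hom_simps, simp] = j h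
  have ex: "\<exists>c \<in> Hom C W V. c \<cdot> h = a \<and> c \<cdot> j = b"
    if "a \<in> Hom C Y V" "b \<in> Hom C X' V" "a \<cdot> i = b \<cdot> f" for V a b
    using univ[OF that] by blast
  have uni: "c = c'"
    if c: "c \<in> Hom C W V" and c': "c' \<in> Hom C W V" and eq: "c \<cdot> h = c' \<cdot> h" "c \<cdot> j = c' \<cdot> j"
    for V c c'
  proof -
    note [THEN Hom_simps, simp] = c c'
    have "c' \<cdot> h \<in> Hom C Y V" "c' \<cdot> j \<in> Hom C X' V" "(c' \<cdot> h) \<cdot> i = (c' \<cdot> j) \<cdot> f"
      by (simp_all add: Hom_def sq)
    from univ[OF this] show ?thesis using c c' eq by blast
  qed
  show thesis by (rule that[OF j h sq]) (use ex uni in blast)+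
qed

end

lemma zero_objectD:
  assumes "zero_object C Z"
  shows "Z \<in> Ob C"
    "\<lbrakk>f \<in> Hom C X Z; g \<in> Hom C X Z; X \<in> Ob C\<rbrakk> \<Longrightarrow> f = g"
    "\<lbrakk>f \<in> Hom C Z X; g \<in> Hom C Z X; X \<in> Ob C\<rbrakk> \<Longrightarrow> f = g"
  using assms unfolding zero_object_def by blast+

context additive_category
begin

lemma Zero_in_Hom: "\<lbrakk>X \<in> Ob C; Y \<in> Ob C\<rbrakk> \<Longrightarrow> Zero C X Y \<in> Hom C X Y"
  using monoid.one_closed[of "hom_group C X Y"] Hom_comm_group[of X Y]
  by (simp add: hom_group_def comm_group_def comm_monoid_def)

lemma Add_in_Hom:
  assumes "f \<in> Hom C X Y" "g \<in> Hom C X Y"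
  shows "f \<boxplus> g \<in> Hom C X Y"
proof -
  interpret G: comm_group "hom_group C X Y"
    using Hom_comm_group HomD[OF assms(1)] by blast
  show ?thesis using G.m_closed[of f g] assms by (simp add: hom_group_def)
qed

lemma Neg_in_Hom:
  assumes "f \<in> Hom C X Y"
  shows "Neg C f \<in> Hom C X Y"
proof -
  interpret G: comm_group "hom_group C X Y"
    using Hom_comm_group HomD[OF assms(1)] by blast
  show ?thesis using G.inv_closed[of f] assms by (simp add: hom_group_def Neg_def Hom_def)
qed

lemma Zero_simps [simp]:
  assumes "X \<in> Ob C" "Y \<in> Ob C"
  shows "Zero C X Y \<in> Arr C" "Dom C (Zero C X Y) = X" "Cod C (Zero C X Y) = Y"
  using Zero_in_Hom[OF assms] by (auto simp: Hom_def)

lemma Add_simps [simp]: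
  assumes "f \<in> Arr C" "g \<in> Arr C" "Dom C f = Dom C g" "Cod C f = Cod C g"
  shows "f \<boxplus> g \<in> Arr C" "Dom C (f \<boxplus> g) = Dom C f" "Cod C (f \<boxplus> g) = Cod C f"
  using Add_in_Hom[of f "Dom C f" "Cod C f" g] assms by (auto simp: Hom_def)

lemma Neg_simps [simp]:
  assumes "f \<in> Arr C"
  shows "Neg C f \<in> Arr C" "Dom C (Neg C f) = Dom C f" "Cod C (Neg C f) = Cod C f"
  using Neg_in_Hom[of f "Dom C f" "Cod C f"] assms by (auto simp: Hom_def)

lemma Add_group:
  assumes "f \<in> Hom C X Y" "g \<in> Hom C X Y" "h \<in> Hom C X Y"
  shows "f \<boxplus> g = g \<boxplus> f" "(f \<boxplus> g) \<boxplus> h = f \<boxplus> (g \<boxplus> h)" "Zero C X Y \<boxplus> f = f" "f \<boxplus> Zero C X Y = f"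
    "Neg C f \<boxplus> f = Zero C X Y" "f \<boxplus> Neg C f = Zero C X Y" "f \<boxplus> h = g \<boxplus> h \<longleftrightarrow> f = g"
proof -
  interpret G: comm_group "hom_group C X Y"
    using Hom_comm_group HomD[OF assms(1)] by blast
  have N: "Neg C f = inv\<^bsub>hom_group C X Y\<^esub> f" using assms by (simp add: Neg_def Hom_def)
  show "f \<boxplus> g = g \<boxplus> f" using G.m_comm[of f g] assms by (simp add: hom_group_def)
  show "(f \<boxplus> g) \<boxplus> h = f \<boxplus> (g \<boxplus> h)" using G.m_assoc[of f g h] assms by (simp add: hom_group_def)
  show "Zero C X Y \<boxplus> f = f" using G.l_one[of f] assms by (simp add: hom_group_def)
  show "f \<boxplus> Zero C X Y = f" using G.r_one[of f] assms by (simp add: hom_group_def)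
  show "Neg C f \<boxplus> f = Zero C X Y" using G.l_inv[of f] assms N by (simp add: hom_group_def)
  show "f \<boxplus> Neg C f = Zero C X Y" using G.r_inv[of f] assms N by (simp add: hom_group_def)
  show "f \<boxplus> h = g \<boxplus> h \<longleftrightarrow> f = g" using G.right_cancel[of h f g] assms by (simp add: hom_group_def)
qed

lemma Add_commute:
  "\<lbrakk>f \<in> Arr C; g \<in> Arr C; Dom C f = Dom C g; Cod C f = Cod C g\<rbrakk> \<Longrightarrow> f \<boxplus> g = g \<boxplus> f"
  by (rule Add_group(1)[of f "Dom C f" "Cod C f" g f]) (auto simp: Hom_def)

lemma Add_assoc:
  "\<lbrakk>f \<in> Arr C; g \<in> Arr C; h \<in> Arr C; Dom C f = Dom C g; Cod C f = Cod C g;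
    Dom C g = Dom C h; Cod C g = Cod C h\<rbrakk> \<Longrightarrow> (f \<boxplus> g) \<boxplus> h = f \<boxplus> (g \<boxplus> h)"
  by (rule Add_group(2)[of f "Dom C f" "Cod C f" g h]) (auto simp: Hom_def)

lemma Add_left_commute:
  "\<lbrakk>f \<in> Arr C; g \<in> Arr C; h \<in> Arr C; Dom C f = Dom C g; Cod C f = Cod C g;
    Dom C g = Dom C h; Cod C g = Cod C h\<rbrakk> \<Longrightarrow> f \<boxplus> (g \<boxplus> h) = g \<boxplus> (f \<boxplus> h)"
  by (simp add: Add_assoc[symmetric] Add_commute[of f g])

lemma Zero_Add [simp]: "\<lbrakk>f \<in> Arr C; Dom C f = X; Cod C f = Y\<rbrakk> \<Longrightarrow> Zero C X Y \<boxplus> f = f"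
  by (rule Add_group(3)[of f X Y f f]) (auto simp: Hom_def)

lemma Add_Zero [simp]: "\<lbrakk>f \<in> Arr C; Dom C f = X; Cod C f = Y\<rbrakk> \<Longrightarrow> f \<boxplus> Zero C X Y = f"
  by (rule Add_group(4)[of f X Y f f]) (auto simp: Hom_def)

lemma Add_Neg [simp]: "f \<in> Arr C \<Longrightarrow> f \<boxplus> Neg C f = Zero C (Dom C f) (Cod C f)"
  by (rule Add_group(6)[of f "Dom C f" "Cod C f" f f]) (auto simp: Hom_def)

lemma Neg_Add [simp]: "f \<in> Arr C \<Longrightarrow> Neg C f \<boxplus> f = Zero C (Dom C f) (Cod C f)"
  by (rule Add_group(5)[of f "Dom C f" "Cod C f" f f]) (auto simp: Hom_def)

lemma Add_right_cancel:
  "\<lbrakk>f \<in> Arr C; g \<in> Arr C; h \<in> Arr C; Dom C f = Dom C g; Cod C f = Cod C g;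
    Dom C g = Dom C h; Cod C g = Cod C h\<rbrakk> \<Longrightarrow> f \<boxplus> h = g \<boxplus> h \<longleftrightarrow> f = g"
  by (rule Add_group(7)[of f "Dom C f" "Cod C f" g h]) (auto simp: Hom_def)

lemma Comp_Add_simp [simp]:
  "\<lbrakk>f \<in> Arr C; f' \<in> Arr C; g \<in> Arr C; Dom C f = Dom C f'; Cod C f = Cod C f'; Cod C f = Dom C g\<rbrakk>
    \<Longrightarrow> g \<cdot> (f \<boxplus> f') = (g \<cdot> f) \<boxplus> (g \<cdot> f')"
  by (rule Comp_Add[of _ "Dom C f" "Cod C f" _ _ "Cod C g"]) (auto simp: Hom_def)

lemma Add_Comp_simp [simp]:
  "\<lbrakk>f \<in> Arr C; g \<in> Arr C; g' \<in> Arr C; Dom C g = Dom C g'; Cod C g = Cod C g'; Cod C f = Dom C g\<rbrakk>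
    \<Longrightarrow> (g \<boxplus> g') \<cdot> f = (g \<cdot> f) \<boxplus> (g' \<cdot> f)"
  by (rule Add_Comp[of _ "Dom C f" "Cod C f" _ "Cod C g"]) (auto simp: Hom_def)

lemma Add_self_eq_Zero:
  assumes "f \<in> Hom C X Y" "f \<boxplus> f = f"
  shows "f = Zero C X Y"
proof -
  note [THEN Hom_simps, simp] = assms(1)
  have "f \<boxplus> f = Zero C X Y \<boxplus> f" using assms(2) by simp
  then show ?thesis by (subst (asm) Add_right_cancel) simp_all
qed

lemma Add_eq_self:
  assumes "g \<in> Hom C X Y" "f \<in> Hom C X Y" "g \<boxplus> f = g"
  shows "f = Zero C X Y"
proof -
  note [THEN Hom_simps, simp] = assms(1,2)
  have "f \<boxplus> g = Zero C X Y \<boxplus> g"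
    using assms(3) Add_commute[of f g] by simp
  then show ?thesis by (subst (asm) Add_right_cancel) simp_all
qed

lemma Comp_Zero [simp]:
  assumes "g \<in> Arr C" "X \<in> Ob C" "Dom C g = Y"
  shows "g \<cdot> Zero C X Y = Zero C X (Cod C g)"
proof -
  have [simp]: "Y \<in> Ob C" using assms Dom_in_Ob by auto
  show ?thesis
    using Comp_Add_simp[of "Zero C X Y" "Zero C X Y" g] assms
    by (intro Add_self_eq_Zero) (simp_all add: Hom_def)
qed

lemma Zero_Comp [simp]:
  assumes "f \<in> Arr C" "Z \<in> Ob C" "Cod C f = Y"
  shows "Zero C Y Z \<cdot> f = Zero C (Dom C f) Z"
proof -
  have [simp]: "Y \<in> Ob C" using assms Cod_in_Ob by auto
  show ?thesis
    using Add_Comp_simp[of f "Zero C Y Z" "Zero C Y Z"] assms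
    by (intro Add_self_eq_Zero) (simp_all add: Hom_def)
qed

lemma Neg_unique:
  assumes "f \<in> Hom C X Y" "g \<in> Hom C X Y" "f \<boxplus> g = Zero C X Y"
  shows "f = Neg C g"
proof -
  note [THEN Hom_simps, simp] = assms(1,2)
  have "f \<boxplus> g = Neg C g \<boxplus> g" using assms(3) by simp
  then show ?thesis by (subst (asm) Add_right_cancel) simp_all
qed

lemma Comp_Neg [simp]:
  assumes "f \<in> Arr C" "g \<in> Arr C" "Cod C f = Dom C g"
  shows "g \<cdot> Neg C f = Neg C (g \<cdot> f)"
proof (rule Neg_unique)
  have [simp]: "Dom C f \<in> Ob C" using assms(1) by (rule Dom_in_Ob)
  have "(g \<cdot> Neg C f) \<boxplus> (g \<cdot> f) = g \<cdot> (Neg C f \<boxplus> f)"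
    using assms by (subst Comp_Add_simp) simp_all
  then show "(g \<cdot> Neg C f) \<boxplus> (g \<cdot> f) = Zero C (Dom C f) (Cod C g)" using assms by simp
qed (use assms in \<open>simp_all add: Hom_def\<close>)

lemma Neg_Comp [simp]:
  assumes "f \<in> Arr C" "g \<in> Arr C" "Cod C f = Dom C g"
  shows "Neg C g \<cdot> f = Neg C (g \<cdot> f)"
proof (rule Neg_unique)
  have [simp]: "Cod C g \<in> Ob C" using assms(2) by (rule Cod_in_Ob)
  have "(Neg C g \<cdot> f) \<boxplus> (g \<cdot> f) = (Neg C g \<boxplus> g) \<cdot> f"
    using assms by (subst Add_Comp_simp) simp_all
  then show "(Neg C g \<cdot> f) \<boxplus> (g \<cdot> f) = Zero C (Dom C f) (Cod C g)" using assms by simp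
qed (use assms in \<open>simp_all add: Hom_def\<close>)

lemma Neg_Neg [simp]: "f \<in> Arr C \<Longrightarrow> Neg C (Neg C f) = f"
  using Neg_unique[of f "Dom C f" "Cod C f" "Neg C f"] by (simp add: Hom_def)

lemma Neg_Zero [simp]: "\<lbrakk>X \<in> Ob C; Y \<in> Ob C\<rbrakk> \<Longrightarrow> Neg C (Zero C X Y) = Zero C X Y"
  using Neg_unique[of "Zero C X Y" X Y "Zero C X Y"] by (simp add: Hom_def)

lemma is_iso_Neg:
  assumes "is_iso C f" "f \<in> Hom C X Y"
  shows "is_iso C (Neg C f)"
proof -
  obtain g where g: "g \<in> Hom C Y X" "g \<cdot> f = Idt C X" "f \<cdot> g = Idt C Y"
    using is_isoE[OF assms] .
  note [THEN Hom_simps, simp] = assms(2) g(1)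
  note [simp] = g(2,3)
  show ?thesis by (rule is_isoI[of _ X Y "Neg C g"]) (simp_all add: Hom_def)
qed

lemma difference:
  assumes "f \<in> Hom C X Y" "g \<in> Hom C X Y"
  obtains d where "d \<in> Hom C X Y" "f = g \<boxplus> d"
proof -
  note [THEN Hom_simps, simp] = assms(1,2)
  have "f = g \<boxplus> (f \<boxplus> Neg C g)" by (subst Add_left_commute) simp_all
  then show thesis using that[of "f \<boxplus> Neg C g"] by (simp add: Hom_def)
qed

end

lemma (in additive_category) zero_object_iff:
  "zero_object C Z \<longleftrightarrow> Z \<in> Ob C \<and> Idt C Z = Zero C Z Z"
proof
  assume Z: "zero_object C Z"
  then show "Z \<in> Ob C \<and> Idt C Z = Zero C Z Z"
    using zero_objectD(1)[OF Z] zero_objectD(2)[OF Z Idt_in_Hom Zero_in_Hom] by blast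
next
  assume Z: "Z \<in> Ob C \<and> Idt C Z = Zero C Z Z"
  then have [simp]: "Z \<in> Ob C" by simp
  have "f = Zero C X Z" if "f \<in> Hom C X Z" for f X
    using HomD[OF that] Z Idt_Comp[OF that] by auto
  moreover have "f = Zero C Z X" if "f \<in> Hom C Z X" for f X
    using HomD[OF that] Z Comp_Idt[OF that] by auto
  ultimately show "zero_object C Z"
    unfolding zero_object_def using Zero_in_Hom by (metis \<open>Z \<in> Ob C\<close>)
qed

lemma (in additive_category) biproduct_zero:
  assumes X: "X \<in> Ob C" and Z: "zero_object C Z"
  shows "biproduct C X Z X (Idt C X) (Zero C Z X) (Idt C X) (Zero C X Z)"
proof -
  have "Z \<in> Ob C" "Zero C Z Z = Idt C Z" using Z zero_object_iff by auto
  then show ?thesis using X by (simp add: biproduct_def Hom_def)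
qed

lemma (in additive_category) direct_summand_refl:
  assumes X: "X \<in> Ob C"
  shows "direct_summand C X X"
  using ex_zero_object biproduct_zero[OF X] unfolding direct_summand_def by blast

context cat_functor
begin

lemma ob_simp [simp]: "X \<in> Ob C \<Longrightarrow> ob F X \<in> Ob D"
  by (rule ob_in_Ob)

lemma ar_simps [simp]:
  assumes "f \<in> Arr C"
  shows "ar F f \<in> Arr D" "Dom D (ar F f) = ob F (Dom C f)" "Cod D (ar F f) = ob F (Cod C f)"
  using ar_in_Hom[of f "Dom C f" "Cod C f"] assms by (auto simp: Hom_def)

lemma ar_Comp_simp:
  "\<lbrakk>f \<in> Arr C; g \<in> Arr C; Cod C f = Dom C g\<rbrakk> \<Longrightarrow> ar F (g \<cdot>\<^bsub>C\<^esub> f) = ar F g \<cdot>\<^bsub>D\<^esub> ar F f"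
  by (rule ar_Comp[of _ "Dom C f" "Cod C f" _ "Cod C g"]) (auto simp: Hom_def)

lemma ar_Comp_eq:
  assumes "g \<cdot>\<^bsub>C\<^esub> f = k" "f \<in> Arr C" "g \<in> Arr C" "Cod C f = Dom C g"
  shows "ar F g \<cdot>\<^bsub>D\<^esub> ar F f = ar F k"
  using assms ar_Comp_simp[of f g] by simp

lemma ar_is_iso:
  assumes "is_iso C f"
  shows "is_iso D (ar F f)"
proof -
  have f: "f \<in> Hom C (Dom C f) (Cod C f)" using assms by (simp add: is_iso_def Hom_def)
  obtain g where g: "g \<in> Hom C (Cod C f) (Dom C f)" "g \<cdot>\<^bsub>C\<^esub> f = Idt C (Dom C f)"
      "f \<cdot>\<^bsub>C\<^esub> g = Idt C (Cod C f)"
    using C.is_isoE[OF assms f] .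
  note [THEN C.Hom_simps, simp] = g(1)
  show ?thesis
    using ar_Comp[OF f g(1)] ar_Comp[OF g(1) f] g(2,3) ar_Idt
    by (intro D.is_isoI[OF ar_in_Hom[OF f] ar_in_Hom[OF g(1)]]) simp_all
qed

end

lemma (in additive_functor) ar_Zero:
  assumes "X \<in> Ob C" "Y \<in> Ob C"
  shows "ar F (Zero C X Y) = Zero D (ob F X) (ob F Y)"
  using ar_Add[of "Zero C X Y" X Y "Zero C X Y"] assms C.Zero_in_Hom[OF assms]
  by (intro D.Add_self_eq_Zero ar_in_Hom) simp_all

section \<open>Equivalences of categories\<close>

lemma (in category) is_iso_if_both_composites:
  assumes f: "f \<in> Hom C X Y" and g: "g \<in> Hom C Y X"
    and gf: "is_iso C (g \<cdot> f)" and fg: "is_iso C (f \<cdot> g)"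
  shows "is_iso C f"
proof -
  note [THEN Hom_simps, simp] = f g
  obtain a where a: "a \<in> Hom C X X" "a \<cdot> (g \<cdot> f) = Idt C X"
    using is_isoE[OF gf] by (metis Comp_in_Hom f g)
  obtain b where b: "b \<in> Hom C Y Y" "(f \<cdot> g) \<cdot> b = Idt C Y"
    using is_isoE[OF fg] by (metis Comp_in_Hom f g)
  note [THEN Hom_simps, simp] = a(1) b(1)
  have "a \<cdot> g = (a \<cdot> g) \<cdot> ((f \<cdot> g) \<cdot> b)" using b(2) by simp
  also have "\<dots> = (a \<cdot> (g \<cdot> f)) \<cdot> (g \<cdot> b)" by (simp del: a(2))
  also have "\<dots> = g \<cdot> b" using a(2) by simp
  finally have "f \<cdot> (a \<cdot> g) = Idt C Y" using b(2) by simp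
  then show ?thesis
    using a by (intro is_isoI[OF f, of "a \<cdot> g"]) (simp_all add: Hom_def)
qed

lemma (in category) cat_functor_id_func: "cat_functor C C id_func"
  by unfold_locales (auto simp: id_func_def)

lemma cat_functor_comp_func:
  assumes "cat_functor C D F" "cat_functor D E G"
  shows "cat_functor C E (comp_func G F)"
proof -
  interpret F: cat_functor C D F by fact
  interpret G: cat_functor D E G by fact
  show ?thesis
    by unfold_locales
      (auto simp: comp_func_def F.ob_in_Ob G.ob_in_Ob F.ar_Idt G.ar_Idt
        intro: F.ar_in_Hom G.ar_in_Hom F.ar_Comp G.ar_Comp
        dest: F.ar_in_Hom simp: F.ar_Comp G.ar_Comp)
qed

text \<open>A functor that is bijective on hom-sets.\<close>

locale fully_faithful_functor = cat_functor C D F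
  for C :: "('o, 'm, 'x) cat_scheme" and D :: "('p, 'n, 'y) cat_scheme"
    and F :: "('o, 'm, 'p, 'n) func" +
  assumes full: "\<lbrakk>X \<in> Ob C; Y \<in> Ob C; \<phi> \<in> Hom D (ob F X) (ob F Y)\<rbrakk>
      \<Longrightarrow> \<exists>f \<in> Hom C X Y. ar F f = \<phi>"
    and faithful: "\<lbrakk>f \<in> Hom C X Y; g \<in> Hom C X Y; ar F f = ar F g\<rbrakk> \<Longrightarrow> f = g"
begin

lemma reflects_iso:
  assumes f: "f \<in> Hom C X Y" and iso: "is_iso D (ar F f)"
  shows "is_iso C f"
proof -
  note [THEN C.Hom_simps, simp] = f
  obtain \<psi> where psi: "\<psi> \<in> Hom D (ob F Y) (ob F X)" "\<psi> \<cdot>\<^bsub>D\<^esub> ar F f = Idt D (ob F X)"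
      "ar F f \<cdot>\<^bsub>D\<^esub> \<psi> = Idt D (ob F Y)"
    using D.is_isoE[OF iso ar_in_Hom[OF f]] .
  obtain g where g: "g \<in> Hom C Y X" "ar F g = \<psi>"
    using full[OF _ _ psi(1)] by auto
  note [THEN C.Hom_simps, simp] = g(1)
  show ?thesis
    using psi g(2)
    by (intro C.is_isoI[OF f g(1)] faithful[OF C.Comp_in_Hom[OF f g(1)]]
        faithful[OF C.Comp_in_Hom[OF g(1) f]])
      (simp_all add: Hom_def ar_Comp_simp ar_Idt)
qed

theorem is_equivalence_if_essentially_surjective:
  assumes "\<And>Z. Z \<in> Ob D \<Longrightarrow> \<exists>X \<in> Ob C. \<exists>b \<in> Hom D (ob F X) Z. is_iso D b"
  shows "is_equivalence C D F"
proof -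
  \<comment> \<open>The quasi-inverse sends \<open>Z\<close> to a chosen \<open>G0 Z\<close> with an isomorphism \<open>b Z : F (G0 Z) \<rightarrow> Z\<close>.\<close>
  have "\<forall>Z. \<exists>X b b'. Z \<in> Ob D \<longrightarrow> X \<in> Ob C \<and> b \<in> Hom D (ob F X) Z \<and> b' \<in> Hom D Z (ob F X) \<and>
      b' \<cdot>\<^bsub>D\<^esub> b = Idt D (ob F X) \<and> b \<cdot>\<^bsub>D\<^esub> b' = Idt D Z"
    using assms D.is_isoE by metis
  then obtain G0 b b' where GB: "\<And>Z. Z \<in> Ob D \<Longrightarrow> G0 Z \<in> Ob C \<and> b Z \<in> Hom D (ob F (G0 Z)) Z \<and>
      b' Z \<in> Hom D Z (ob F (G0 Z)) \<and>
      b' Z \<cdot>\<^bsub>D\<^esub> b Z = Idt D (ob F (G0 Z)) \<and> b Z \<cdot>\<^bsub>D\<^esub> b' Z = Idt D Z"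
    by metis
  have bs [simp]: "b Z \<in> Arr D" "Dom D (b Z) = ob F (G0 Z)" "Cod D (b Z) = Z"
      "b' Z \<in> Arr D" "Dom D (b' Z) = Z" "Cod D (b' Z) = ob F (G0 Z)" "G0 Z \<in> Ob C"
      "b' Z \<cdot>\<^bsub>D\<^esub> b Z = Idt D (ob F (G0 Z))" "b Z \<cdot>\<^bsub>D\<^esub> b' Z = Idt D Z"
    if "Z \<in> Ob D" for Z
    using GB[OF that] by (auto simp: Hom_def)
  have bb [simp]: "b Z \<cdot>\<^bsub>D\<^esub> (b' Z \<cdot>\<^bsub>D\<^esub> x) = x"
    if "Z \<in> Ob D" "x \<in> Arr D" "Cod D x = Z" for x Z
    using that bs[OF that(1)] by (simp add: D.Comp_eq)
  define lift where "lift X Y \<phi> = (SOME f. f \<in> Hom C X Y \<and> ar F f = \<phi>)" for X Y \<phi>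
  have lift: "lift X Y \<phi> \<in> Hom C X Y" "ar F (lift X Y \<phi>) = \<phi>"
    if "X \<in> Ob C" "Y \<in> Ob C" "\<phi> \<in> Arr D" "Dom D \<phi> = ob F X" "Cod D \<phi> = ob F Y" for X Y \<phi>
  proof -
    have "\<exists>f. f \<in> Hom C X Y \<and> ar F f = \<phi>"
      using full[OF that(1,2)] that by (auto simp: Hom_def)
    from someI_ex[OF this] show "lift X Y \<phi> \<in> Hom C X Y" "ar F (lift X Y \<phi>) = \<phi>"
      by (simp_all add: lift_def)
  qed
  have lift_simps [simp]: "lift X Y \<phi> \<in> Arr C" "Dom C (lift X Y \<phi>) = X" "Cod C (lift X Y \<phi>) = Y"
      "ar F (lift X Y \<phi>) = \<phi>"
    if "X \<in> Ob C" "Y \<in> Ob C" "\<phi> \<in> Arr D" "Dom D \<phi> = ob F X" "Cod D \<phi> = ob F Y" for X Y \<phi>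
    using lift[OF that] by (auto simp: Hom_def)
  have eqI: "f = g" if "f \<in> Arr C" "g \<in> Arr C" "Dom C f = Dom C g" "Cod C f = Cod C g"
      "ar F f = ar F g" for f g
    using faithful[of f "Dom C f" "Cod C f" g] that by (simp add: Hom_def)
  define G where "G = \<lparr>ob = G0, ar = (\<lambda>\<phi>. lift (G0 (Dom D \<phi>)) (G0 (Cod D \<phi>))
    (b' (Cod D \<phi>) \<cdot>\<^bsub>D\<^esub> (\<phi> \<cdot>\<^bsub>D\<^esub> b (Dom D \<phi>))))\<rparr>"
  have obG [simp]: "ob G = G0" by (simp add: G_def)
  have arG [simp]: "ar G \<phi> \<in> Arr C" "Dom C (ar G \<phi>) = G0 (Dom D \<phi>)"
      "Cod C (ar G \<phi>) = G0 (Cod D \<phi>)"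
      "ar F (ar G \<phi>) = b' (Cod D \<phi>) \<cdot>\<^bsub>D\<^esub> (\<phi> \<cdot>\<^bsub>D\<^esub> b (Dom D \<phi>))" if "\<phi> \<in> Arr D" for \<phi>
    using that by (simp_all add: G_def D.Dom_in_Ob D.Cod_in_Ob)
  have G: "cat_functor D C G"
  proof unfold_locales
    fix f X Y
    assume f: "f \<in> Hom D X Y"
    then show "ar G f \<in> Hom C (ob G X) (ob G Y)" by (simp add: Hom_def)
  next
    fix X assume "X \<in> Ob D"
    then show "ar G (Idt D X) = Idt C (ob G X)" by (intro eqI) (simp_all add: ar_Idt)
  next
    fix f g X Y Z
    assume f: "f \<in> Hom D X Y" and g: "g \<in> Hom D Y Z"
    note [THEN D.Hom_simps, simp] = f g
    show "ar G (g \<cdot>\<^bsub>D\<^esub> f) = ar G g \<cdot>\<^bsub>C\<^esub> ar G f"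
      by (intro eqI) (simp_all add: ar_Comp_simp)
  qed simp
  define \<alpha> where "\<alpha> X = lift X (G0 (ob F X)) (b' (ob F X))" for X
  have \<alpha> [simp]: "\<alpha> X \<in> Arr C" "Dom C (\<alpha> X) = X" "Cod C (\<alpha> X) = G0 (ob F X)"
      "ar F (\<alpha> X) = b' (ob F X)" if "X \<in> Ob C" for X
    using that by (simp_all add: \<alpha>_def)
  have "nat_isomorphism C C id_func (comp_func G F) \<alpha>"
  proof (intro nat_isomorphism.intro nat_isomorphism_axioms.intro nat_transformation.intro
      nat_transformation_axioms.intro C.cat_functor_id_func
      cat_functor_comp_func[OF cat_functor_axioms G])
    fix X assume X: "X \<in> Ob C"
    then show "\<alpha> X \<in> Hom C (ob id_func X) (ob (comp_func G F) X)"
      by (simp add: id_func_def comp_func_def Hom_def)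
    have "is_iso D (ar F (\<alpha> X))"
      using X by (intro D.is_isoI[of _ "ob F X" "ob F (G0 (ob F X))" "b (ob F X)"])
        (simp_all add: Hom_def)
    then show "is_iso C (\<alpha> X)"
      using X by (intro reflects_iso[of _ X "G0 (ob F X)"]) (simp_all add: Hom_def)
  next
    fix f X Y assume f: "f \<in> Hom C X Y"
    note [THEN C.Hom_simps, simp] = f
    show "\<alpha> Y \<cdot>\<^bsub>C\<^esub> ar id_func f = ar (comp_func G F) f \<cdot>\<^bsub>C\<^esub> \<alpha> X"
      by (intro eqI) (simp_all add: id_func_def comp_func_def ar_Comp_simp)
  qed
  moreover have "nat_isomorphism D D (comp_func F G) id_func b"
  proof (intro nat_isomorphism.intro nat_isomorphism_axioms.intro nat_transformation.intro
      nat_transformation_axioms.intro D.cat_functor_id_func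
      cat_functor_comp_func[OF G cat_functor_axioms])
    fix X assume X: "X \<in> Ob D"
    then show "b X \<in> Hom D (ob (comp_func F G) X) (ob id_func X)"
      by (simp add: id_func_def comp_func_def Hom_def)
    show "is_iso D (b X)"
      using X by (intro D.is_isoI[of _ "ob F (G0 X)" X "b' X"]) (simp_all add: Hom_def)
  next
    fix f X Y assume f: "f \<in> Hom D X Y"
    note [THEN D.Hom_simps, simp] = f
    show "b Y \<cdot>\<^bsub>D\<^esub> ar (comp_func F G) f = ar id_func f \<cdot>\<^bsub>D\<^esub> b X"
      by (simp add: id_func_def comp_func_def)
  qed
  ultimately show ?thesis unfolding is_equivalence_def by blast
qed

end

section \<open>Triangulations generated by standard triangles\<close>

text \<open>An additive category with an additive autoequivalence \<open>S\<close> and a class \<open>T0\<close> of standard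
  triangles \<open>X \<rightarrow> Y \<rightarrow> Z \<rightarrow> S X\<close> that satisfies weak forms of the axioms: a map need only be the
  first map of a standard triangle after its codomain is replaced by an isomorphic object, rotation
  is required in one direction and up to isomorphism, and the octahedral axiom is required only when
  both given maps are first maps of standard triangles, for one choice of the remaining data. In
  addition, a map on \<open>Z\<close> that vanishes on \<open>Y\<close> is required to factor through \<open>Z \<rightarrow> S X\<close>.\<close>

locale pretriangulation = additive_category C + shift: additive_functor C C S +
    shift: fully_faithful_functor C C S
  for C :: "('o, 'm, 'x) addcat_scheme" (structure) and S :: "('o, 'm, 'o, 'm) func" +
  fixes T0 :: "('m \<times> 'm \<times> 'm) set"
  assumes shift_ess_surj: "Z \<in> Ob C \<Longrightarrow> \<exists>X \<in> Ob C. \<exists>b \<in> Hom C (ob S X) Z. is_iso C b"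
    and std_triangle: "t \<in> T0 \<Longrightarrow> is_triangle C S t"
    and std_Idt: "X \<in> Ob C \<Longrightarrow> \<exists>Z w. zero_object C Z \<and> (Idt C X, Zero C X Z, w) \<in> T0"
    and std_cone: "u \<in> Hom C X Y
      \<Longrightarrow> \<exists>Y' s v w. s \<in> Hom C Y Y' \<and> is_iso C s \<and> (s \<cdot> u, v, w) \<in> T0"
    and std_rotate: "(u, v, w) \<in> T0 \<Longrightarrow> \<exists>t \<in> T0. triangle_iso C S (v, w, Neg C (ar S u)) t"
    and std_fill: "\<lbrakk>(u, v, w) \<in> T0; (u', v', w') \<in> T0;
        f \<in> Hom C (Dom C u) (Dom C u'); g \<in> Hom C (Cod C u) (Cod C u'); g \<cdot> u = u' \<cdot> f\<rbrakk>
      \<Longrightarrow> \<exists>h \<in> Hom C (Cod C v) (Cod C v'). h \<cdot> v = v' \<cdot> g \<and> w' \<cdot> h = ar S f \<cdot> w"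
    and std_exact: "\<lbrakk>(u, v, w) \<in> T0; k \<in> Hom C (Cod C v) W; k \<cdot> v = Zero C (Dom C v) W\<rbrakk>
      \<Longrightarrow> \<exists>a \<in> Hom C (Cod C w) W. k = a \<cdot> w"
    and std_octahedron: "\<lbrakk>(u, p, w1) \<in> T0; (v, q, w2) \<in> T0; Cod C u = Dom C v\<rbrakk>
      \<Longrightarrow> \<exists>h w3 f g. (v \<cdot> u, h, w3) \<in> T0 \<and> (f, g, ar S p \<cdot> w2) \<in> T0 \<and>
            f \<in> Hom C (Cod C p) (Cod C h) \<and> g \<in> Hom C (Cod C h) (Cod C q) \<and>
            f \<cdot> p = h \<cdot> v \<and> w3 \<cdot> f = w1 \<and> g \<cdot> h = q \<and> w2 \<cdot> g = ar S u \<cdot> w3"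
begin

text \<open>The distinguished triangles: those isomorphic to a standard one.\<close>

definition "T = {t. \<exists>t' \<in> T0. triangle_iso C S t t'}"

lemma triangle_isoI:
  assumes "u \<in> Hom C X Y" "v \<in> Hom C Y Z" "w \<in> Hom C Z (ob S X)"
    and "u' \<in> Hom C X' Y'" "v' \<in> Hom C Y' Z'" "w' \<in> Hom C Z' (ob S X')"
    and "is_iso C a" "is_iso C b" "is_iso C c"
    and "a \<in> Hom C X X'" "b \<in> Hom C Y Y'" "c \<in> Hom C Z Z'"
    and "b \<cdot> u = u' \<cdot> a" "c \<cdot> v = v' \<cdot> b" "ar S a \<cdot> w = w' \<cdot> c"
  shows "triangle_iso C S (u, v, w) (u', v', w')"
proof -
  have "is_triangle C S (u, v, w)" "is_triangle C S (u', v', w')"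
    using assms(1-6) unfolding is_triangle_def by blast+
  moreover have "Dom C u = X" "Dom C v = Y" "Dom C w = Z" "Dom C u' = X'" "Dom C v' = Y'"
      "Dom C w' = Z'"
    using assms(1-6) by (simp_all add: Hom_def)
  ultimately show ?thesis using assms(7-15) by (auto simp: triangle_iso_def)
qed

text \<open>An isomorphism of triangles together with its inverse, and all equations between the two.\<close>

lemma triangle_isoE:
  assumes "triangle_iso C S (u, v, w) (u', v', w')"
  obtains X Y Z X' Y' Z' a b c a' b' c'
  where "u \<in> Hom C X Y" "v \<in> Hom C Y Z" "w \<in> Hom C Z (ob S X)"
    "u' \<in> Hom C X' Y'" "v' \<in> Hom C Y' Z'" "w' \<in> Hom C Z' (ob S X')"
    "is_iso C a" "is_iso C b" "is_iso C c" "is_iso C a'" "is_iso C b'" "is_iso C c'"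
    "a \<in> Hom C X X'" "b \<in> Hom C Y Y'" "c \<in> Hom C Z Z'"
    "a' \<in> Hom C X' X" "b' \<in> Hom C Y' Y" "c' \<in> Hom C Z' Z"
    "a' \<cdot> a = Idt C X" "b' \<cdot> b = Idt C Y" "c' \<cdot> c = Idt C Z"
    "a \<cdot> a' = Idt C X'" "b \<cdot> b' = Idt C Y'" "c \<cdot> c' = Idt C Z'"
    "b \<cdot> u = u' \<cdot> a" "c \<cdot> v = v' \<cdot> b" "ar S a \<cdot> w = w' \<cdot> c"
    "b' \<cdot> u' = u \<cdot> a'" "c' \<cdot> v' = v \<cdot> b'" "ar S a' \<cdot> w' = w \<cdot> c'"
    "ar S a' \<cdot> ar S a = Idt C (ob S X)" "ar S a \<cdot> ar S a' = Idt C (ob S X')"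
proof -
  obtain X Y Z where t: "u \<in> Hom C X Y" "v \<in> Hom C Y Z" "w \<in> Hom C Z (ob S X)"
    using assms by (auto simp: triangle_iso_def is_triangle_def)
  obtain X' Y' Z' where t': "u' \<in> Hom C X' Y'" "v' \<in> Hom C Y' Z'" "w' \<in> Hom C Z' (ob S X')"
    using assms by (auto simp: triangle_iso_def is_triangle_def)
  note [THEN Hom_simps, simp] = t t'
  obtain a b c where iso: "is_iso C a" "is_iso C b" "is_iso C c" and abc:
      "a \<in> Hom C X X'" "b \<in> Hom C Y Y'" "c \<in> Hom C Z Z'" and eq:
      "b \<cdot> u = u' \<cdot> a" "c \<cdot> v = v' \<cdot> b" "ar S a \<cdot> w = w' \<cdot> c"
    using assms by (auto simp: triangle_iso_def)
  obtain a' where a': "a' \<in> Hom C X' X" "a' \<cdot> a = Idt C X" "a \<cdot> a' = Idt C X'" "is_iso C a'"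
    using is_isoE[OF iso(1) abc(1)] .
  obtain b' where b': "b' \<in> Hom C Y' Y" "b' \<cdot> b = Idt C Y" "b \<cdot> b' = Idt C Y'" "is_iso C b'"
    using is_isoE[OF iso(2) abc(2)] .
  obtain c' where c': "c' \<in> Hom C Z' Z" "c' \<cdot> c = Idt C Z" "c \<cdot> c' = Idt C Z'" "is_iso C c'"
    using is_isoE[OF iso(3) abc(3)] .
  note [THEN Hom_simps, simp] = abc(1-3) a'(1) b'(1) c'(1)
  note [simp] = a'(2,3) b'(2,3) c'(2,3)
  have S: "ar S a' \<cdot> ar S a = Idt C (ob S X)" "ar S a \<cdot> ar S a' = Idt C (ob S X')"
    by (simp_all add: shift.ar_Comp_eq[of a' a] shift.ar_Comp_eq[of a a'] shift.ar_Idt)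
  have 1: "b' \<cdot> u' = u \<cdot> a'"
  proof (rule iso_cancel_left[OF iso(2) abc(2), of _ X'])
    show "b \<cdot> (b' \<cdot> u') = b \<cdot> (u \<cdot> a')"
      by (simp add: Comp_eq[OF b'(3)] Comp_eq[OF eq(1)])
  qed (simp_all add: Hom_def)
  have 2: "c' \<cdot> v' = v \<cdot> b'"
  proof (rule iso_cancel_left[OF iso(3) abc(3), of _ Y'])
    show "c \<cdot> (c' \<cdot> v') = c \<cdot> (v \<cdot> b')"
      by (simp add: Comp_eq[OF c'(3)] Comp_eq[OF eq(2)])
  qed (simp_all add: Hom_def)
  have 3: "ar S a' \<cdot> w' = w \<cdot> c'"
  proof (rule iso_cancel_left[OF shift.ar_is_iso[OF iso(1)] shift.ar_in_Hom[OF abc(1)], of _ Z'])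
    show "ar S a \<cdot> (ar S a' \<cdot> w') = ar S a \<cdot> (w \<cdot> c')"
      by (simp add: Comp_eq[OF S(2)] Comp_eq[OF eq(3)])
  qed (simp_all add: Hom_def)
  show thesis
    by (rule that[OF t t' iso a'(4) b'(4) c'(4) abc a'(1) b'(1) c'(1) a'(2) b'(2) c'(2)
      a'(3) b'(3) c'(3) eq 1 2 3 S])
qed

lemma triangle_iso_sym:
  assumes "triangle_iso C S t t'"
  shows "triangle_iso C S t' t"
proof -
  obtain u v w where 1: "t = (u, v, w)" by (cases t)
  obtain u' v' w' where 2: "t' = (u', v', w')" by (cases t')
  note t = 1 2
  show ?thesis
  proof (rule triangle_isoE[OF assms[unfolded t]])
    fix X Y Z X' Y' Z' a b c a' b' c'
    assume t1: "u \<in> Hom C X Y" "v \<in> Hom C Y Z" "w \<in> Hom C Z (ob S X)"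
        "u' \<in> Hom C X' Y'" "v' \<in> Hom C Y' Z'" "w' \<in> Hom C Z' (ob S X')"
      and inv: "is_iso C a'" "is_iso C b'" "is_iso C c'"
        "a' \<in> Hom C X' X" "b' \<in> Hom C Y' Y" "c' \<in> Hom C Z' Z"
        "b' \<cdot> u' = u \<cdot> a'" "c' \<cdot> v' = v \<cdot> b'" "ar S a' \<cdot> w' = w \<cdot> c'"
    show ?thesis unfolding t by (rule triangle_isoI[OF t1(4-6,1-3) inv])
  qed
qed

lemma triangle_iso_trans:
  assumes "triangle_iso C S t t'" "triangle_iso C S t' t''"
  shows "triangle_iso C S t t''"
proof -
  obtain u v w where 1: "t = (u, v, w)" by (cases t)
  obtain u' v' w' where 2: "t' = (u', v', w')" by (cases t')
  obtain u'' v'' w'' where 3: "t'' = (u'', v'', w'')" by (cases t'')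
  note t = 1 2 3
  show ?thesis
  proof (rule triangle_isoE[OF assms(1)[unfolded t]])
    fix X Y Z X' Y' Z' a b c
    assume t1: "u \<in> Hom C X Y" "v \<in> Hom C Y Z" "w \<in> Hom C Z (ob S X)"
      "u' \<in> Hom C X' Y'" "v' \<in> Hom C Y' Z'" "w' \<in> Hom C Z' (ob S X')"
      and iso: "is_iso C a" "is_iso C b" "is_iso C c"
      and abc: "a \<in> Hom C X X'" "b \<in> Hom C Y Y'" "c \<in> Hom C Z Z'"
      and eq: "b \<cdot> u = u' \<cdot> a" "c \<cdot> v = v' \<cdot> b" "ar S a \<cdot> w = w' \<cdot> c"
    show ?thesis
    proof (rule triangle_isoE[OF assms(2)[unfolded t]])
      fix X1 Y1 Z1 X'' Y'' Z'' d e f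
      assume t2: "u' \<in> Hom C X1 Y1" "v' \<in> Hom C Y1 Z1" "w' \<in> Hom C Z1 (ob S X1)"
        and t3: "u'' \<in> Hom C X'' Y''" "v'' \<in> Hom C Y'' Z''" "w'' \<in> Hom C Z'' (ob S X'')"
        and iso': "is_iso C d" "is_iso C e" "is_iso C f"
        and dek: "d \<in> Hom C X1 X''" "e \<in> Hom C Y1 Y''" "f \<in> Hom C Z1 Z''"
        and eq': "e \<cdot> u' = u'' \<cdot> d" "f \<cdot> v' = v'' \<cdot> e" "ar S d \<cdot> w' = w'' \<cdot> f"
      have [simp]: "X1 = X'" "Y1 = Y'" "Z1 = Z'" using t1 t2 by (auto simp: Hom_def)
      note dek = dek[simplified]
      note [THEN Hom_simps, simp] = t1(1-6) t3(1-3) abc(1-3) dek(1-3)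
      note [simp] = eq eq' Comp_eq[OF eq'(1)] Comp_eq[OF eq'(2)]
        Comp_eq[OF eq'(3)]
      show ?thesis unfolding t
        by (rule triangle_isoI[OF t1(1-3) t3
            is_iso_Comp[OF iso(1) abc(1) iso'(1) dek(1)] is_iso_Comp[OF iso(2) abc(2) iso'(2) dek(2)]
            is_iso_Comp[OF iso(3) abc(3) iso'(3) dek(3)]])
          (simp_all add: Hom_def shift.ar_Comp_simp)
    qed
  qed
qed

lemma triangle_iso_refl:
  assumes "is_triangle C S t"
  shows "triangle_iso C S t t"
proof -
  obtain u v w X Y Z where t: "t = (u, v, w)"
      and uvw: "u \<in> Hom C X Y" "v \<in> Hom C Y Z" "w \<in> Hom C Z (ob S X)"
    using assms by (auto simp: is_triangle_def)
  note [THEN Hom_simps, simp] = uvw(1-3)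
  show ?thesis unfolding t
    by (rule triangle_isoI[OF uvw uvw, of "Idt C X" "Idt C Y" "Idt C Z"])
      (simp_all add: is_iso_Idt Hom_def shift.ar_Idt)
qed

lemma T0_subset_T: "t \<in> T0 \<Longrightarrow> t \<in> T"
  using triangle_iso_refl[of t] std_triangle[of t] unfolding T_def by blast

lemma T_iso: "\<lbrakk>t \<in> T; triangle_iso C S t t'\<rbrakk> \<Longrightarrow> t' \<in> T"
  using triangle_iso_sym triangle_iso_trans unfolding T_def by blast

lemma T_Homs:
  assumes "(u, v, w) \<in> T"
  obtains X Y Z where "u \<in> Hom C X Y" "v \<in> Hom C Y Z" "w \<in> Hom C Z (ob S X)"
  using assms by (auto simp: T_def triangle_iso_def is_triangle_def)

lemma T_rotate:
  assumes "(u, v, w) \<in> T"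
  shows "(v, w, Neg C (ar S u)) \<in> T"
proof -
  obtain u1 v1 w1 where T1: "(u1, v1, w1) \<in> T0" "triangle_iso C S (u, v, w) (u1, v1, w1)"
    using assms by (auto simp: T_def)
  have "triangle_iso C S (v, w, Neg C (ar S u)) (v1, w1, Neg C (ar S u1))"
  proof (rule triangle_isoE[OF T1(2)])
    fix X Y Z X' Y' Z' a b c
    assume t: "u \<in> Hom C X Y" "v \<in> Hom C Y Z" "w \<in> Hom C Z (ob S X)"
      and t1: "u1 \<in> Hom C X' Y'" "v1 \<in> Hom C Y' Z'" "w1 \<in> Hom C Z' (ob S X')"
      and iso: "is_iso C a" "is_iso C b" "is_iso C c"
      and abc: "a \<in> Hom C X X'" "b \<in> Hom C Y Y'" "c \<in> Hom C Z Z'"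
      and eq: "b \<cdot> u = u1 \<cdot> a" "c \<cdot> v = v1 \<cdot> b" "ar S a \<cdot> w = w1 \<cdot> c"
    note [THEN Hom_simps, simp] = t(1-3) t1(1-3) abc(1-3)
    have "ar S b \<cdot> ar S u = ar S u1 \<cdot> ar S a"
      using eq(1) by (simp add: shift.ar_Comp_simp[symmetric])
    then show ?thesis
      by (intro triangle_isoI[of _ Y Z _ "ob S X" _ _ Y' Z' _ "ob S X'" _ b c "ar S a"])
        (use t t1 iso abc eq in \<open>simp_all add: shift.ar_is_iso Hom_def\<close>)
  qed
  moreover obtain t where "t \<in> T0" "triangle_iso C S (v1, w1, Neg C (ar S u1)) t"
    using std_rotate[OF T1(1)] by blast
  ultimately show ?thesis using triangle_iso_trans unfolding T_def by blast
qed

lemma T_fill: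
  assumes "(u, v, w) \<in> T" "(u', v', w') \<in> T"
    and f: "f \<in> Hom C (Dom C u) (Dom C u')" and g: "g \<in> Hom C (Cod C u) (Cod C u')"
    and gu: "g \<cdot> u = u' \<cdot> f"
  shows "\<exists>h \<in> Hom C (Cod C v) (Cod C v'). h \<cdot> v = v' \<cdot> g \<and> w' \<cdot> h = ar S f \<cdot> w"
proof -
  obtain u1 v1 w1 where T1: "(u1, v1, w1) \<in> T0" "triangle_iso C S (u, v, w) (u1, v1, w1)"
    using assms(1) by (auto simp: T_def)
  obtain u2 v2 w2 where T2: "(u2, v2, w2) \<in> T0" "triangle_iso C S (u', v', w') (u2, v2, w2)"
    using assms(2) by (auto simp: T_def)
  show ?thesis
  proof (rule triangle_isoE[OF T1(2)])
    fix X Y Z X1 Y1 Z1 a b c a' b' c'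
    assume t: "u \<in> Hom C X Y" "v \<in> Hom C Y Z" "w \<in> Hom C Z (ob S X)"
      and t1: "u1 \<in> Hom C X1 Y1" "v1 \<in> Hom C Y1 Z1" "w1 \<in> Hom C Z1 (ob S X1)"
      and abc: "a \<in> Hom C X X1" "b \<in> Hom C Y Y1" "c \<in> Hom C Z Z1"
        "a' \<in> Hom C X1 X" "b' \<in> Hom C Y1 Y" "c' \<in> Hom C Z1 Z"
      and inv1: "a' \<cdot> a = Idt C X" "b' \<cdot> b = Idt C Y" "c' \<cdot> c = Idt C Z"
        "ar S a' \<cdot> ar S a = Idt C (ob S X)"
      and eq1: "c \<cdot> v = v1 \<cdot> b" "b' \<cdot> u1 = u \<cdot> a'" "ar S a' \<cdot> w1 = w \<cdot> c'"
    show ?thesis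
    proof (rule triangle_isoE[OF T2(2)])
      fix X' Y' Z' X2 Y2 Z2 d e k d' e' k'
      assume t': "u' \<in> Hom C X' Y'" "v' \<in> Hom C Y' Z'" "w' \<in> Hom C Z' (ob S X')"
        and t2: "u2 \<in> Hom C X2 Y2" "v2 \<in> Hom C Y2 Z2" "w2 \<in> Hom C Z2 (ob S X2)"
        and dek: "d \<in> Hom C X' X2" "e \<in> Hom C Y' Y2" "k \<in> Hom C Z' Z2"
          "d' \<in> Hom C X2 X'" "e' \<in> Hom C Y2 Y'" "k' \<in> Hom C Z2 Z'"
        and inv2: "d' \<cdot> d = Idt C X'" "e' \<cdot> e = Idt C Y'" "k' \<cdot> k = Idt C Z'"
          "ar S d' \<cdot> ar S d = Idt C (ob S X')"
        and eq2: "e \<cdot> u' = u2 \<cdot> d" "k' \<cdot> v2 = v' \<cdot> e'" "ar S d' \<cdot> w2 = w' \<cdot> k'"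
      note [THEN Hom_simps, simp] = t(1-3) t1(1-3) t'(1-3) t2(1-3) abc(1-6) dek(1-6)
      note f = f[simplified] and g = g[simplified]
      note [THEN Hom_simps, simp] = f g
      define f1 where "f1 = d \<cdot> (f \<cdot> a')"
      define g1 where "g1 = e \<cdot> (g \<cdot> b')"
      have "g1 \<cdot> u1 = u2 \<cdot> f1"
        by (simp add: f1_def g1_def eq1(2) Comp_eq[OF gu] Comp_eq[OF eq2(1)])
      then obtain h where h: "h \<in> Hom C Z1 Z2" "h \<cdot> v1 = v2 \<cdot> g1" "w2 \<cdot> h = ar S f1 \<cdot> w1"
        using std_fill[OF T1(1) T2(1), of f1 g1] by (auto simp: f1_def g1_def Hom_def)
      note [THEN Hom_simps, simp] = h(1)
      have 1: "(k' \<cdot> (h \<cdot> c)) \<cdot> v = v' \<cdot> g"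
        by (simp add: eq1(1) Comp_eq[OF h(2)] g1_def inv1 Comp_eq[OF eq2(2)]
            Comp_eq[OF inv2(2)])
      have "w' \<cdot> (k' \<cdot> (h \<cdot> c)) = (ar S d' \<cdot> w2) \<cdot> (h \<cdot> c)" by (simp add: eq2(3))
      also have "\<dots> = ar S d' \<cdot> ((w2 \<cdot> h) \<cdot> c)" by simp
      also have "\<dots> = ar S f \<cdot> w"
        by (simp add: h(3) f1_def shift.ar_Comp_simp Comp_eq[OF inv2(4)]
            Comp_eq[OF eq1(3)] inv1)
      finally have "w' \<cdot> (k' \<cdot> (h \<cdot> c)) = ar S f \<cdot> w" .
      with 1 show ?thesis by (intro bexI[of _ "k' \<cdot> (h \<cdot> c)"] conjI) (simp_all add: Hom_def)
    qed
  qed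
qed

lemma T_exact:
  assumes "(u, v, w) \<in> T" and k: "k \<in> Hom C (Cod C v) W" and kv: "k \<cdot> v = Zero C (Dom C v) W"
  shows "\<exists>a \<in> Hom C (Cod C w) W. k = a \<cdot> w"
proof -
  obtain u1 v1 w1 where T1: "(u1, v1, w1) \<in> T0" "triangle_iso C S (u, v, w) (u1, v1, w1)"
    using assms(1) by (auto simp: T_def)
  show ?thesis
  proof (rule triangle_isoE[OF T1(2)])
    fix X Y Z X1 Y1 Z1 a b c a' b' c'
    assume t: "u \<in> Hom C X Y" "v \<in> Hom C Y Z" "w \<in> Hom C Z (ob S X)"
      and t1: "u1 \<in> Hom C X1 Y1" "v1 \<in> Hom C Y1 Z1" "w1 \<in> Hom C Z1 (ob S X1)"
      and abc: "a \<in> Hom C X X1" "b \<in> Hom C Y Y1" "c \<in> Hom C Z Z1"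
        "a' \<in> Hom C X1 X" "b' \<in> Hom C Y1 Y" "c' \<in> Hom C Z1 Z"
      and inv1: "a' \<cdot> a = Idt C X" "b' \<cdot> b = Idt C Y" "c' \<cdot> c = Idt C Z"
      and eq1: "ar S a \<cdot> w = w1 \<cdot> c" "c' \<cdot> v1 = v \<cdot> b'"
    note [THEN Hom_simps, simp] = t(1-3) t1(1-3) abc(1-6)
    note k = k[simplified] and kv = kv[simplified]
    note [THEN Hom_simps, simp] = k
    have "(k \<cdot> c') \<cdot> v1 = Zero C Y1 W" by (simp add: eq1 Comp_eq[OF kv])
    then obtain m where m: "m \<in> Hom C (ob S X1) W" "k \<cdot> c' = m \<cdot> w1"
      using std_exact[OF T1(1), of "k \<cdot> c'" W] by (auto simp: Hom_def)
    note [THEN Hom_simps, simp] = m(1)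
    have "k = (k \<cdot> c') \<cdot> c" by (simp add: inv1)
    also have "\<dots> = (m \<cdot> ar S a) \<cdot> w" unfolding m(2) by (simp add: eq1)
    finally show ?thesis by (intro bexI[of _ "m \<cdot> ar S a"]) (simp_all add: Hom_def)
  qed
qed

text \<open>An endomorphism of a triangle \<open>(u, v, w)\<close> that is the identity on the first two objects is
  \<open>1 + d\<close> on the third, with \<open>d d = 0\<close>: as \<open>d v = 0\<close>, it factors as \<open>a w\<close>, and \<open>w d = 0\<close>.\<close>

lemma T_endo_iso:
  assumes "(u, v, w) \<in> T" and k: "k \<in> Hom C (Cod C v) (Cod C v)"
    and kv: "k \<cdot> v = v" and wk: "w \<cdot> k = w"
  shows "is_iso C k"
proof -
  obtain X Y Z where t: "u \<in> Hom C X Y" "v \<in> Hom C Y Z" "w \<in> Hom C Z (ob S X)"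
    using T_Homs[OF assms(1)] .
  note [THEN Hom_simps, simp] = t(1-3)
  note k = k[simplified]
  obtain d where d: "d \<in> Hom C Z Z" "k = Idt C Z \<boxplus> d"
    by (rule difference[OF k Idt_in_Hom]) simp_all
  note [THEN Hom_simps, simp] = k d(1)
  have dv: "d \<cdot> v = Zero C Y Z"
    using kv by (intro Add_eq_self[of v]) (simp_all add: d(2) Hom_def)
  have wd: "w \<cdot> d = Zero C Z (ob S X)"
    using wk by (intro Add_eq_self[of w]) (simp_all add: d(2) Hom_def)
  obtain a where a: "a \<in> Hom C (ob S X) Z" "d = a \<cdot> w"
    using T_exact[OF assms(1), of d Z] d(1) dv by auto
  note [THEN Hom_simps, simp] = a(1)
  have dd [simp]: "d \<cdot> d = Zero C Z Z"
    using Comp_eq[OF a(2)[symmetric], of d] by (simp add: wd)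
  have e: "Idt C Z \<boxplus> Neg C d \<in> Hom C Z Z" by (simp add: Hom_def)
  show ?thesis
  proof (rule is_isoI[OF k e])
    show "(Idt C Z \<boxplus> Neg C d) \<cdot> k = Idt C Z" by (simp add: d(2) Add_assoc)
    show "k \<cdot> (Idt C Z \<boxplus> Neg C d) = Idt C Z" by (simp add: d(2) Add_assoc)
  qed
qed

lemma five_lemma:
  assumes T1: "(u, v, w) \<in> T" and T2: "(u', v', w') \<in> T"
    and f: "f \<in> Hom C (Dom C u) (Dom C u')" and g: "g \<in> Hom C (Cod C u) (Cod C u')"
    and h: "h \<in> Hom C (Cod C v) (Cod C v')"
    and gu: "g \<cdot> u = u' \<cdot> f" and hv: "h \<cdot> v = v' \<cdot> g" and wh: "w' \<cdot> h = ar S f \<cdot> w"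
    and iso: "is_iso C f" "is_iso C g"
  shows "is_iso C h"
proof -
  obtain X Y Z where t: "u \<in> Hom C X Y" "v \<in> Hom C Y Z" "w \<in> Hom C Z (ob S X)"
    using T_Homs[OF assms(1)] .
  obtain X' Y' Z' where t': "u' \<in> Hom C X' Y'" "v' \<in> Hom C Y' Z'" "w' \<in> Hom C Z' (ob S X')"
    using T_Homs[OF assms(2)] .
  note [THEN Hom_simps, simp] = t(1-3) t'(1-3)
  note f = f[simplified] and g = g[simplified] and h = h[simplified]
  obtain f' where f': "f' \<in> Hom C X' X" "f' \<cdot> f = Idt C X" "f \<cdot> f' = Idt C X'"
    using is_isoE[OF iso(1) f] .
  obtain g' where g': "g' \<in> Hom C Y' Y" "g' \<cdot> g = Idt C Y" "g \<cdot> g' = Idt C Y'"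
    using is_isoE[OF iso(2) g] .
  note [THEN Hom_simps, simp] = f g h f'(1) g'(1)
  have "g' \<cdot> u' = g' \<cdot> ((u' \<cdot> f) \<cdot> f')" using f'(3) by simp
  also have "\<dots> = u \<cdot> f'" by (simp add: gu[symmetric] Comp_eq[OF g'(2)])
  finally have "g' \<cdot> u' = u \<cdot> f'" .
  then obtain h' where h': "h' \<in> Hom C Z' Z" "h' \<cdot> v' = v \<cdot> g'" "w \<cdot> h' = ar S f' \<cdot> w'"
    using T_fill[OF T2 T1, of f' g'] f' g' by auto
  note [THEN Hom_simps, simp] = h'(1)
  have S: "ar S f' \<cdot> ar S f = Idt C (ob S X)" "ar S f \<cdot> ar S f' = Idt C (ob S X')"
    using shift.ar_Comp_eq[OF f'(2)] shift.ar_Comp_eq[OF f'(3)] by (simp_all add: shift.ar_Idt)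
  have "is_iso C (h' \<cdot> h)"
    by (rule T_endo_iso[OF T1])
      (simp_all add: Hom_def hv Comp_eq[OF h'(2)] g' Comp_eq[OF h'(3)] wh
        Comp_eq[OF S(1)])
  moreover have "is_iso C (h \<cdot> h')"
    by (rule T_endo_iso[OF T2])
      (simp_all add: Hom_def h' Comp_eq[OF hv] g' Comp_eq[OF wh]
        Comp_eq[OF S(2)])
  ultimately show ?thesis using is_iso_if_both_composites h h'(1) by blast
qed

lemma T_fill_iso:
  assumes T1: "(u, v, w) \<in> T" and T2: "(u', v', w') \<in> T"
    and f: "f \<in> Hom C (Dom C u) (Dom C u')" and g: "g \<in> Hom C (Cod C u) (Cod C u')"
    and gu: "g \<cdot> u = u' \<cdot> f"
    and iso: "is_iso C f" "is_iso C g"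
  obtains h where "h \<in> Hom C (Cod C v) (Cod C v')" "is_iso C h" "h \<cdot> v = v' \<cdot> g"
    "w' \<cdot> h = ar S f \<cdot> w"
  using T_fill[OF T1 T2 f g gu] five_lemma[OF T1 T2 f g _ gu _ _ iso] by blast

lemma T_Idt:
  assumes X: "X \<in> Ob C" and Z: "zero_object C Z"
  shows "(Idt C X, Zero C X Z, Zero C Z (ob S X)) \<in> T"
proof -
  obtain Z' w where Z': "zero_object C Z'" and T': "(Idt C X, Zero C X Z', w) \<in> T0"
    using std_Idt[OF X] by blast
  note [simp] = X zero_objectD(1)[OF Z] zero_objectD(1)[OF Z']
  have w: "w \<in> Hom C Z' (ob S X)"
    using std_triangle[OF T'] by (auto simp: is_triangle_def Hom_def)
  note [THEN Hom_simps, simp] = w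
  have iso: "is_iso C (Zero C Z Z')"
    by (rule is_isoI[of _ Z Z' "Zero C Z' Z"])
      (auto simp: Hom_def intro: zero_objectD(2)[OF Z, where X = Z]
        zero_objectD(2)[OF Z', where X = Z'])
  have "triangle_iso C S (Idt C X, Zero C X Z, Zero C Z (ob S X)) (Idt C X, Zero C X Z', w)"
    by (rule triangle_isoI[of _ X X _ Z _ _ X X _ Z' _ "Idt C X" "Idt C X" "Zero C Z Z'"])
      (auto simp: iso is_iso_Idt Hom_def shift.ar_Idt intro: zero_objectD(3)[OF Z])
  then show ?thesis using T' by (auto simp: T_def)
qed

lemma T_cone:
  assumes "u \<in> Arr C"
  shows "\<exists>v w. (u, v, w) \<in> T"
proof -
  obtain X Y where u: "u \<in> Hom C X Y" using assms Arr_iff_Hom by blast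
  obtain Y' s v w where s: "s \<in> Hom C Y Y'" "is_iso C s" and T': "(s \<cdot> u, v, w) \<in> T0"
    using std_cone[OF u] by blast
  note [THEN Hom_simps, simp] = u s(1)
  obtain Z where v: "v \<in> Hom C Y' Z" and w: "w \<in> Hom C Z (ob S X)"
    using std_triangle[OF T'] by (auto simp: is_triangle_def Hom_def)
  note [THEN Hom_simps, simp] = v w
  have "triangle_iso C S (u, v \<cdot> s, w) (s \<cdot> u, v, w)"
    by (rule triangle_isoI[of _ X Y _ Z _ _ X Y' _ Z _ "Idt C X" s "Idt C Z"])
      (auto simp: s is_iso_Idt Hom_def shift.ar_Idt)
  then show ?thesis using T' by (auto simp: T_def)
qed

text \<open>Three forward rotations of a triangle on \<open>u\<close> and two of the given one begin with the same map
  \<open>- S u\<close>, so their third objects \<open>S Z'\<close> and \<open>S Z\<close> are isomorphic; the isomorphism descends along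
  the fully faithful \<open>S\<close>.\<close>

lemma T_rotate_back:
  assumes t: "u \<in> Hom C X Y" "v \<in> Hom C Y Z" "w \<in> Hom C Z (ob S X)"
    and rot: "(v, w, Neg C (ar S u)) \<in> T"
  shows "(u, v, w) \<in> T"
proof -
  obtain v' w' where T': "(u, v', w') \<in> T" using T_cone HomD(1)[OF t(1)] by blast
  note [THEN Hom_simps, simp] = t(1-3)
  obtain Z' where t': "v' \<in> Hom C Y Z'" "w' \<in> Hom C Z' (ob S X)"
    using T_Homs[OF T'] by (auto simp: Hom_def)
  note [THEN Hom_simps, simp] = t'(1,2)
  obtain h where h: "h \<in> Hom C (ob S Z) (ob S Z')" "is_iso C h"
      "h \<cdot> Neg C (ar S v) = Neg C (ar S v')" "Neg C (ar S w') \<cdot> h = Neg C (ar S w)"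
    by (rule T_fill_iso[OF T_rotate[OF T_rotate[OF rot]] T_rotate[OF T_rotate[OF T_rotate[OF T']]],
          of "Idt C (ob S X)" "Idt C (ob S Y)"])
      (simp_all add: Hom_def is_iso_Idt shift.ar_Idt)
  obtain k where k: "k \<in> Hom C Z Z'" "ar S k = h"
    using shift.full[OF _ _ h(1)] by auto
  note [THEN Hom_simps, simp] = k(1)
  have 1: "k \<cdot> v = v'"
  proof (rule shift.faithful[of _ Y Z'])
    have "Neg C (Neg C (ar S k \<cdot> ar S v)) = Neg C (Neg C (ar S v'))"
      using h(3) by (simp add: k(2)[symmetric])
    then show "ar S (k \<cdot> v) = ar S v'" by (simp add: shift.ar_Comp_simp)
  qed (simp_all add: Hom_def)
  have 2: "w' \<cdot> k = w"
  proof (rule shift.faithful[of _ Z "ob S X"])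
    have "Neg C (Neg C (ar S w' \<cdot> ar S k)) = Neg C (Neg C (ar S w))"
      using h(4) by (simp add: k(2)[symmetric])
    then show "ar S (w' \<cdot> k) = ar S w" by (simp add: shift.ar_Comp_simp)
  qed (simp_all add: Hom_def)
  have "is_iso C k" using shift.reflects_iso[OF k(1)] k(2) h(2) by simp
  then have "triangle_iso C S (u, v, w) (u, v', w')"
    using t t' k(1) 1 2
    by (intro triangle_isoI[of _ X Y _ Z _ _ X Y _ Z' _ "Idt C X" "Idt C Y" k])
      (simp_all add: Hom_def is_iso_Idt shift.ar_Idt)
  then show ?thesis using T_iso[OF T' triangle_iso_sym] by blast
qed

text \<open>The given triangles are compared with standard ones: \<open>Y\<close> and \<open>Z\<close> are replaced by isomorphic
  objects \<open>Y\<^sub>1\<close> and \<open>Z\<^sub>1\<close> over which the maps become \<open>u1\<close> and \<open>v1\<close>, and the octahedron on those is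
  transported along the isomorphisms \<open>a\<close>, \<open>b\<close>, \<open>c\<close> between the third objects.\<close>

lemma T_octahedron:
  assumes u: "u \<in> Hom C X Y" and v: "v \<in> Hom C Y Z"
    and Tu: "(u, j, k) \<in> T" and Tv: "(v, l, i) \<in> T" and Tvu: "(v \<cdot> u, m, n) \<in> T"
  shows "\<exists>f \<in> Hom C (Cod C j) (Cod C m). \<exists>g \<in> Hom C (Cod C m) (Cod C l).
            (f, g, ar S j \<cdot> i) \<in> T \<and>
            f \<cdot> j = m \<cdot> v \<and> n \<cdot> f = k \<and> g \<cdot> m = l \<and> i \<cdot> g = ar S u \<cdot> n"
proof -
  note [THEN Hom_simps, simp] = u v
  obtain Zu where j: "j \<in> Hom C Y Zu" and k: "k \<in> Hom C Zu (ob S X)"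
    using T_Homs[OF Tu] by (auto simp: Hom_def)
  obtain Zv where l: "l \<in> Hom C Z Zv" and i: "i \<in> Hom C Zv (ob S Y)"
    using T_Homs[OF Tv] by (auto simp: Hom_def)
  obtain Zm where m: "m \<in> Hom C Z Zm" and n: "n \<in> Hom C Zm (ob S X)"
    using T_Homs[OF Tvu] by (auto simp: Hom_def)
  note [THEN Hom_simps, simp] = j k l i m n
  obtain Y\<^sub>1 s p w1 where s: "s \<in> Hom C Y Y\<^sub>1" "is_iso C s" and Tu0: "(s \<cdot> u, p, w1) \<in> T0"
    using std_cone[OF u] by blast
  obtain s' where s': "s' \<in> Hom C Y\<^sub>1 Y" "s' \<cdot> s = Idt C Y" "s \<cdot> s' = Idt C Y\<^sub>1"
    using is_isoE[OF s(2,1)] by blast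
  note [THEN Hom_simps, simp] = s(1) s'(1)
  note [simp] = s'(2,3)
  have "v \<cdot> s' \<in> Hom C Y\<^sub>1 Z" by (simp add: Hom_def)
  from std_cone[OF this] obtain Z\<^sub>1 r q w2 where r: "r \<in> Hom C Z Z\<^sub>1" "is_iso C r"
      and Tv0: "(r \<cdot> (v \<cdot> s'), q, w2) \<in> T0"
    by blast
  note [THEN Hom_simps, simp] = r(1)
  define u1 where "u1 = s \<cdot> u"
  define v1 where "v1 = r \<cdot> (v \<cdot> s')"
  have u1 [simp]: "u1 \<in> Arr C" "Dom C u1 = X" "Cod C u1 = Y\<^sub>1"
    and v1 [simp]: "v1 \<in> Arr C" "Dom C v1 = Y\<^sub>1" "Cod C v1 = Z\<^sub>1"
    by (simp_all add: u1_def v1_def)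
  have v1s: "v1 \<cdot> s = r \<cdot> v" by (simp add: v1_def)
  note Tu0 = Tu0[folded u1_def] and Tv0 = Tv0[folded v1_def]
  obtain h w3 f1 g1 where Tvu0: "(v1 \<cdot> u1, h, w3) \<in> T0" and Tfg0: "(f1, g1, ar S p \<cdot> w2) \<in> T0"
      and fg: "f1 \<in> Hom C (Cod C p) (Cod C h)" "g1 \<in> Hom C (Cod C h) (Cod C q)"
      and oct: "f1 \<cdot> p = h \<cdot> v1" "w3 \<cdot> f1 = w1" "g1 \<cdot> h = q" "w2 \<cdot> g1 = ar S u1 \<cdot> w3"
    using std_octahedron[OF Tu0 Tv0] by auto
  obtain Zp where p: "p \<in> Hom C Y\<^sub>1 Zp" and w1: "w1 \<in> Hom C Zp (ob S X)"
    using T_Homs[OF T0_subset_T[OF Tu0]] by (auto simp: Hom_def)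
  obtain Zq where q: "q \<in> Hom C Z\<^sub>1 Zq" and w2: "w2 \<in> Hom C Zq (ob S Y\<^sub>1)"
    using T_Homs[OF T0_subset_T[OF Tv0]] by (auto simp: Hom_def)
  obtain Zh where h: "h \<in> Hom C Z\<^sub>1 Zh" and w3: "w3 \<in> Hom C Zh (ob S X)"
    using T_Homs[OF T0_subset_T[OF Tvu0]] by (auto simp: Hom_def)
  note [THEN Hom_simps, simp] = p w1 q w2 h w3
  note fg = fg[simplified]
  note [THEN Hom_simps, simp] = fg(1,2)
  obtain a where a: "a \<in> Hom C Zu Zp" "is_iso C a" "a \<cdot> j = p \<cdot> s" "w1 \<cdot> a = k"
    by (rule T_fill_iso[OF Tu T0_subset_T[OF Tu0], of "Idt C X" s])
      (simp_all add: Hom_def is_iso_Idt shift.ar_Idt s(2) u1_def)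
  obtain b where b: "b \<in> Hom C Zv Zq" "is_iso C b" "b \<cdot> l = q \<cdot> r" "w2 \<cdot> b = ar S s \<cdot> i"
    by (rule T_fill_iso[OF Tv T0_subset_T[OF Tv0], of s r])
      (simp_all add: Hom_def s(2) r(2) v1s)
  obtain c where c: "c \<in> Hom C Zm Zh" "is_iso C c" "c \<cdot> m = h \<cdot> r" "w3 \<cdot> c = n"
    by (rule T_fill_iso[OF Tvu T0_subset_T[OF Tvu0], of "Idt C X" r])
      (simp_all add: Hom_def is_iso_Idt shift.ar_Idt r(2) u1_def Comp_eq[OF v1s])
  obtain b' where b': "b' \<in> Hom C Zq Zv" "b' \<cdot> b = Idt C Zv" "b \<cdot> b' = Idt C Zq"
    using is_isoE[OF b(2,1)] by blast
  obtain c' where c': "c' \<in> Hom C Zh Zm" "c' \<cdot> c = Idt C Zm" "c \<cdot> c' = Idt C Zh"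
    using is_isoE[OF c(2,1)] by blast
  note [THEN Hom_simps, simp] = a(1) b(1) c(1) b'(1) c'(1)
  have Ss: "ar S s' \<cdot> ar S s = Idt C (ob S Y)"
    using shift.ar_Comp_eq[OF s'(2)] by (simp add: shift.ar_Idt)
  have ib: "i \<cdot> b' = ar S s' \<cdot> w2"
  proof -
    have "i \<cdot> b' = ar S s' \<cdot> ((ar S s \<cdot> i) \<cdot> b')" by (simp add: Comp_eq[OF Ss])
    also have "\<dots> = ar S s' \<cdot> ((w2 \<cdot> b) \<cdot> b')" unfolding b(4) ..
    also have "\<dots> = ar S s' \<cdot> w2" by (simp add: b'(3))
    finally show ?thesis .
  qed
  have nc: "n \<cdot> c' = w3" by (simp add: c(4)[symmetric] c'(3))
  have cc: "c' \<cdot> (h \<cdot> r) = m" using c(3) by (simp add: c(3)[symmetric] Comp_eq[OF c'(2)])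
  have bb: "b' \<cdot> (q \<cdot> r) = l" by (simp add: b(3)[symmetric] Comp_eq[OF b'(2)])
  define f where "f = c' \<cdot> (f1 \<cdot> a)"
  define g where "g = b' \<cdot> (g1 \<cdot> c)"
  have f: "f \<in> Hom C Zu Zm" and g: "g \<in> Hom C Zm Zv" by (simp_all add: f_def g_def Hom_def)
  have "triangle_iso C S (f, g, ar S j \<cdot> i) (f1, g1, ar S p \<cdot> w2)"
  proof (rule triangle_isoI[OF f g _ fg _ a(2) c(2) b(2) a(1) c(1) b(1)])
    show "c \<cdot> f = f1 \<cdot> a" by (simp add: f_def Comp_eq[OF c'(3)])
    show "b \<cdot> g = g1 \<cdot> c" by (simp add: g_def Comp_eq[OF b'(3)])
    have "ar S a \<cdot> ar S j = ar S p \<cdot> ar S s"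
      using shift.ar_Comp_eq[OF a(3)] by (simp add: shift.ar_Comp_simp)
    from Comp_eq[OF this, of i] show "ar S a \<cdot> (ar S j \<cdot> i) = (ar S p \<cdot> w2) \<cdot> b"
      by (simp add: b(4))
  qed (simp_all add: Hom_def)
  then have "(f, g, ar S j \<cdot> i) \<in> T" using Tfg0 unfolding T_def by blast
  moreover have "f \<cdot> j = m \<cdot> v"
    by (simp add: f_def a(3) Comp_eq[OF oct(1)] v1s Comp_eq[OF cc, simplified]
        cc[symmetric])
  moreover have "n \<cdot> f = k"
    by (simp add: f_def Comp_eq[OF nc] Comp_eq[OF oct(2)] a(4))
  moreover have "g \<cdot> m = l"
    by (simp add: g_def c(3) Comp_eq[OF oct(3)] bb)
  moreover have "i \<cdot> g = ar S u \<cdot> n"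
    by (simp add: g_def Comp_eq[OF ib] Comp_eq[OF oct(4)] u1_def
        shift.ar_Comp_simp c(4) Comp_eq[OF Ss])
  ultimately show ?thesis using f g by auto
qed

theorem triangulated_category_T: "triangulated_category C S T"
proof unfold_locales
  show "is_equivalence C C S"
    using shift.is_equivalence_if_essentially_surjective shift_ess_surj by blast
  show "is_triangle C S t" if "t \<in> T" for t
    using that by (auto simp: T_def triangle_iso_def)
  show "(u, v, w) \<in> T \<longleftrightarrow> (v, w, Neg C (ar S u)) \<in> T" if "is_triangle C S (u, v, w)" for u v w
    using that T_rotate T_rotate_back by (auto simp: is_triangle_def)
qed (blast intro: T_iso T_Idt T_cone T_fill T_octahedron)+

end

section \<open>The quotient of an additive category by a class of objects\<close>

text \<open>A class \<open>P\<close> of objects such that the maps that factor through objects of \<open>P\<close> are closed under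
  addition, and hence form an ideal. In the following, \<open>null f\<close> means that \<open>f\<close> is such a map, \<open>Q\<close> is
  the quotient category and \<open>cl f\<close> the class of \<open>f\<close> in \<open>Q\<close>.\<close>

locale object_ideal = additive_category A
  for A :: "('o, 'm, 'x) addcat_scheme" (structure) +
  fixes P :: "'o set"
  assumes P_subset_Ob: "P \<subseteq> Ob A"
    and P_nonempty: "P \<noteq> {}"
    and factors_through_Add: "\<lbrakk>f \<in> Hom A X Y; g \<in> Hom A X Y; factors_through A P f;
        factors_through A P g\<rbrakk> \<Longrightarrow> factors_through A P (f \<boxplus> g)"
begin

abbreviation "null \<equiv> factors_through A P"
abbreviation "Q \<equiv> quotient_cat A P"
abbreviation "cl \<equiv> cls A P"

lemma nullI: "\<lbrakk>W \<in> P; a \<in> Hom A X W; b \<in> Hom A W Y\<rbrakk> \<Longrightarrow> null (b \<cdot> a)"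
  unfolding factors_through_def using HomD[of a] HomD[of b] by fastforce

lemma nullE:
  assumes "null f" "f \<in> Hom A X Y"
  obtains W a b where "W \<in> P" "a \<in> Hom A X W" "b \<in> Hom A W Y" "f = b \<cdot> a"
  using assms unfolding factors_through_def by (auto simp: HomD[OF assms(2)])

lemma null_Comp_left:
  assumes "null f" "f \<in> Hom A X Y" "g \<in> Hom A Y Z"
  shows "null (g \<cdot> f)"
proof -
  obtain W a b where ab: "W \<in> P" "a \<in> Hom A X W" "b \<in> Hom A W Y" "f = b \<cdot> a"
    using nullE[OF assms(1,2)] .
  then show ?thesis
    using nullI[OF ab(1,2) Comp_in_Hom[OF ab(3) assms(3)]] assms(3) by (simp add: Hom_def)
qed

lemma null_Comp_right:
  assumes "null f" "f \<in> Hom A Y Z" "g \<in> Hom A X Y"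
  shows "null (f \<cdot> g)"
proof -
  obtain W a b where ab: "W \<in> P" "a \<in> Hom A Y W" "b \<in> Hom A W Z" "f = b \<cdot> a"
    using nullE[OF assms(1,2)] .
  then show ?thesis
    using nullI[OF ab(1) Comp_in_Hom[OF assms(3) ab(2)] ab(3)] assms(3) by (simp add: Hom_def)
qed

lemma null_Neg:
  assumes "null f" "f \<in> Arr A"
  shows "null (Neg A f)"
proof -
  obtain W a b where ab: "W \<in> P" "a \<in> Hom A (Dom A f) W" "b \<in> Hom A W (Cod A f)" "f = b \<cdot> a"
    using nullE[OF assms(1) HomI[OF assms(2) refl refl]] .
  then show ?thesis
    using nullI[OF ab(1,2) Neg_in_Hom[OF ab(3)]] by (simp add: Hom_def)
qed

lemma null_Zero: "\<lbrakk>X \<in> Ob A; Y \<in> Ob A\<rbrakk> \<Longrightarrow> null (Zero A X Y)"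
proof -
  assume XY: "X \<in> Ob A" "Y \<in> Ob A"
  obtain W where W: "W \<in> P" using P_nonempty by blast
  then have [simp]: "W \<in> Ob A" using P_subset_Ob by blast
  show ?thesis
    using nullI[OF W Zero_in_Hom[of X W] Zero_in_Hom[of W Y]] XY by simp
qed

lemma null_diff_iff:
  assumes "f \<in> Hom A X Y" "g \<in> Hom A X Y"
  shows "null (f \<boxplus> Neg A g) \<longleftrightarrow> (\<exists>n \<in> Hom A X Y. null n \<and> f = g \<boxplus> n)"
proof
  note [THEN Hom_simps, simp] = assms(1,2)
  assume "null (f \<boxplus> Neg A g)"
  moreover have "f = g \<boxplus> (f \<boxplus> Neg A g)" by (subst Add_left_commute) simp_all
  ultimately show "\<exists>n \<in> Hom A X Y. null n \<and> f = g \<boxplus> n"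
    by (intro bexI[of _ "f \<boxplus> Neg A g"]) (simp_all add: Hom_def)
next
  note [THEN Hom_simps, simp] = assms(1,2)
  assume "\<exists>n \<in> Hom A X Y. null n \<and> f = g \<boxplus> n"
  then obtain n where n: "n \<in> Hom A X Y" "null n" "f = g \<boxplus> n" by blast
  note [THEN Hom_simps, simp] = n(1)
  have "f \<boxplus> Neg A g = n" unfolding n(3) by (simp add: Add_commute[of g n] Add_assoc)
  then show "null (f \<boxplus> Neg A g)" using n(2) by simp
qed

lemma mem_cls_iff:
  assumes "f \<in> Hom A X Y"
  shows "g \<in> cl f \<longleftrightarrow> g \<in> Hom A X Y \<and> (\<exists>n \<in> Hom A X Y. null n \<and> f = g \<boxplus> n)"
  using null_diff_iff[OF assms] HomD(2,3)[OF assms] by (auto simp: cls_def)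

lemma cls_refl: "f \<in> Hom A X Y \<Longrightarrow> f \<in> cl f"
  using HomD[of f X Y] null_Zero Zero_in_Hom
  by (auto simp: mem_cls_iff intro!: bexI[of _ "Zero A X Y"])

text \<open>Congruence modulo maps that factor through \<open>P\<close>, in a form without subtraction.\<close>

lemma cls_eq_iff:
  assumes f: "f \<in> Hom A X Y" and g: "g \<in> Hom A X Y"
  shows "cl f = cl g \<longleftrightarrow> (\<exists>n \<in> Hom A X Y. null n \<and> f = g \<boxplus> n)"
proof
  assume "cl f = cl g"
  then have "g \<in> cl f" using cls_refl[OF g] by simp
  then show "\<exists>n \<in> Hom A X Y. null n \<and> f = g \<boxplus> n" using mem_cls_iff[OF f] by blast
next
  assume "\<exists>n \<in> Hom A X Y. null n \<and> f = g \<boxplus> n"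
  then obtain n where n: "n \<in> Hom A X Y" "null n" "f = g \<boxplus> n" by blast
  note [THEN Hom_simps, simp] = f g n(1)
  have sub: "cl f' \<subseteq> cl g'"
    if f': "f' \<in> Hom A X Y" and g': "g' \<in> Hom A X Y" and m: "m \<in> Hom A X Y" "null m"
      and g'f': "g' = f' \<boxplus> m" for f' g' m
  proof
    fix k assume "k \<in> cl f'"
    then obtain l where k: "k \<in> Hom A X Y" and l: "l \<in> Hom A X Y" "null l" "f' = k \<boxplus> l"
      using mem_cls_iff[OF f'] by blast
    have "g' = k \<boxplus> (l \<boxplus> m)"
      unfolding g'f' l(3) using k l(1) m(1) by (simp add: Add_assoc Hom_def)
    moreover have "null (l \<boxplus> m)" using factors_through_Add l m by blast
    ultimately show "k \<in> cl g'"
      using mem_cls_iff[OF g'] k Add_in_Hom[OF l(1) m(1)] by blast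
  qed
  have "g = f \<boxplus> Neg A n" unfolding n(3) by (simp add: Add_assoc)
  then show "cl f = cl g"
    using sub[OF f g Neg_in_Hom[OF n(1)] null_Neg[OF n(2)]] sub[OF g f n(1,2) n(3)] by auto
qed

lemma cls_eqI:
  assumes "f \<in> Hom A X Y" "g \<in> Hom A X Y" "W \<in> P" "a \<in> Hom A X W" "b \<in> Hom A W Y"
    and "f = g \<boxplus> (b \<cdot> a)"
  shows "cl f = cl g"
  using cls_eq_iff[OF assms(1,2)] nullI[OF assms(3-5)] Comp_in_Hom[OF assms(4,5)] assms(6) by blast

lemma cls_eqE:
  assumes "cl f = cl g" "f \<in> Hom A X Y" "g \<in> Hom A X Y"
  obtains W a b where "W \<in> P" "a \<in> Hom A X W" "b \<in> Hom A W Y" "f = g \<boxplus> (b \<cdot> a)"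
  using cls_eq_iff[OF assms(2,3)] assms(1) nullE by metis

lemma cls_eq_Zero_iff:
  assumes "f \<in> Hom A X Y"
  shows "cl f = cl (Zero A X Y) \<longleftrightarrow> null f"
proof -
  have "f = Zero A X Y \<boxplus> n \<longleftrightarrow> n = f" if "n \<in> Hom A X Y" for n
    using HomD[OF that] by auto
  then show ?thesis
    using cls_eq_iff[OF assms Zero_in_Hom] HomD[OF assms] assms by auto
qed

lemma mem_cls_eq:
  assumes "f \<in> Hom A X Y"
  shows "g \<in> cl f \<longleftrightarrow> g \<in> Hom A X Y \<and> cl g = cl f"
  using mem_cls_iff[OF assms] cls_eq_iff[OF assms, of g] by metis

lemma quotient_sel [simp]:
  "Ob Q = Ob A" "Idt Q X = cl (Idt A X)" "Zero Q X Y = cl (Zero A X Y)"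
  by (simp_all add: quotient_cat_def)

lemma cls_Arr [simp]:
  assumes "f \<in> Arr A"
  shows "cl f \<in> Arr Q" "Dom Q (cl f) = Dom A f" "Cod Q (cl f) = Cod A f"
proof -
  have f: "f \<in> Hom A (Dom A f) (Cod A f)" using assms by (simp add: Hom_def)
  have "Dom A ` cl f = {Dom A f}" "Cod A ` cl f = {Cod A f}"
    using cls_refl[OF f] mem_cls_eq[OF f] by (auto simp: Hom_def image_iff)
  then show "cl f \<in> Arr Q" "Dom Q (cl f) = Dom A f" "Cod Q (cl f) = Cod A f"
    using assms by (simp_all add: quotient_cat_def)
qed

lemma cls_in_Hom: "f \<in> Hom A X Y \<Longrightarrow> cl f \<in> Hom Q X Y"
  by (simp add: Hom_def)

lemma quotient_HomE:
  assumes "\<phi> \<in> Hom Q X Y"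
  obtains f where "f \<in> Hom A X Y" "\<phi> = cl f"
proof -
  have "\<phi> \<in> cl ` Arr A" using assms by (simp add: Hom_def quotient_cat_def)
  then obtain f where "f \<in> Arr A" "\<phi> = cl f" by blast
  then show thesis using that assms by (simp add: Hom_def)
qed

lemma cls_Comp:
  assumes f: "f \<in> Hom A X Y" and g: "g \<in> Hom A Y Z"
  shows "cl g \<cdot>\<^bsub>Q\<^esub> cl f = cl (g \<cdot> f)"
proof -
  have "cl (g' \<cdot> f') = cl (g \<cdot> f)"
    if f': "f' \<in> cl f" and g': "g' \<in> cl g" for f' g'
  proof -
    obtain n where n: "f' \<in> Hom A X Y" "n \<in> Hom A X Y" "null n" "f = f' \<boxplus> n"
      using f' mem_cls_iff[OF f] by blast
    obtain m where m: "g' \<in> Hom A Y Z" "m \<in> Hom A Y Z" "null m" "g = g' \<boxplus> m"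
      using g' mem_cls_iff[OF g] by blast
    note [THEN Hom_simps, simp] = n(1,2) m(1,2) f
    have "g \<cdot> f = (g' \<cdot> f') \<boxplus> ((g' \<cdot> n) \<boxplus> (m \<cdot> f))"
      by (simp add: m(4) n(4) Add_assoc Add_left_commute Add_commute)
    moreover have "null ((g' \<cdot> n) \<boxplus> (m \<cdot> f))"
      using factors_through_Add[of "g' \<cdot> n" X Z "m \<cdot> f"] null_Comp_left[OF n(3,2) m(1)]
        null_Comp_right[OF m(3,2) f] by (simp add: Hom_def)
    moreover have "(g' \<cdot> n) \<boxplus> (m \<cdot> f) \<in> Hom A X Z" by (simp add: Hom_def)
    ultimately show ?thesis
      using cls_eq_iff[OF Comp_in_Hom[OF f g] Comp_in_Hom[OF n(1) m(1)]] by metis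
  qed
  then have "(\<Union>g' \<in> cl g. \<Union>f' \<in> cl f. cl (g' \<cdot> f')) =
      (\<Union>g' \<in> cl g. \<Union>f' \<in> cl f. cl (g \<cdot> f))"
    by simp
  also have "\<dots> = cl (g \<cdot> f)" using cls_refl[OF f] cls_refl[OF g] by blast
  finally show ?thesis by (simp add: quotient_cat_def)
qed

lemma cls_Add:
  assumes f: "f \<in> Hom A X Y" and g: "g \<in> Hom A X Y"
  shows "cl f \<boxplus>\<^bsub>Q\<^esub> cl g = cl (f \<boxplus> g)"
proof -
  have "cl (f' \<boxplus> g') = cl (f \<boxplus> g)"
    if f': "f' \<in> cl f" and g': "g' \<in> cl g" for f' g'
  proof -
    obtain n where n: "f' \<in> Hom A X Y" "n \<in> Hom A X Y" "null n" "f = f' \<boxplus> n"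
      using f' mem_cls_iff[OF f] by blast
    obtain m where m: "g' \<in> Hom A X Y" "m \<in> Hom A X Y" "null m" "g = g' \<boxplus> m"
      using g' mem_cls_iff[OF g] by blast
    note [THEN Hom_simps, simp] = n(1,2) m(1,2)
    have "f \<boxplus> g = (f' \<boxplus> g') \<boxplus> (n \<boxplus> m)"
      unfolding n(4) m(4) by (simp add: Add_assoc Add_left_commute[of n g' m])
    then show ?thesis
      using cls_eq_iff[OF Add_in_Hom[OF f g] Add_in_Hom[OF n(1) m(1)]]
        factors_through_Add[OF n(2) m(2) n(3) m(3)] Add_in_Hom[OF n(2) m(2)] by metis
  qed
  then have "(\<Union>f' \<in> cl f. \<Union>g' \<in> cl g. cl (f' \<boxplus> g')) =
      (\<Union>f' \<in> cl f. \<Union>g' \<in> cl g. cl (f \<boxplus> g))"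
    by simp
  also have "\<dots> = cl (f \<boxplus> g)" using cls_refl[OF f] cls_refl[OF g] by blast
  finally show ?thesis by (simp add: quotient_cat_def)
qed

lemma cls_Comp_simp [simp]:
  "\<lbrakk>f \<in> Arr A; g \<in> Arr A; Cod A f = Dom A g\<rbrakk>
    \<Longrightarrow> cl g \<cdot>\<^bsub>Q\<^esub> cl f = cl (g \<cdot> f)"
  by (rule cls_Comp[of _ "Dom A f" "Cod A f" _ "Cod A g"]) (simp_all add: Hom_def)

lemma cls_Add_simp [simp]:
  "\<lbrakk>f \<in> Arr A; g \<in> Arr A; Dom A f = Dom A g; Cod A f = Cod A g\<rbrakk>
    \<Longrightarrow> cl f \<boxplus>\<^bsub>Q\<^esub> cl g = cl (f \<boxplus> g)"
  by (rule cls_Add[of _ "Dom A f" "Cod A f"]) (simp_all add: Hom_def)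

lemma quotient_category: "category Q"
proof unfold_locales
  show "Dom Q \<phi> \<in> Ob Q" "Cod Q \<phi> \<in> Ob Q" if "\<phi> \<in> Arr Q" for \<phi>
  proof -
    have "\<phi> \<in> cl ` Arr A" using that by (simp add: quotient_cat_def)
    then show "Dom Q \<phi> \<in> Ob Q" "Cod Q \<phi> \<in> Ob Q" using Dom_in_Ob Cod_in_Ob by auto
  qed
  show "Idt Q X \<in> Hom Q X X" if "X \<in> Ob Q" for X
    using that by (simp add: cls_in_Hom Idt_in_Hom)
  fix \<phi> X Y assume phi: "\<phi> \<in> Hom Q X Y"
  obtain f where f: "f \<in> Hom A X Y" "\<phi> = cl f" using quotient_HomE[OF phi] .
  note [THEN Hom_simps, simp] = f(1)
  show "\<phi> \<cdot>\<^bsub>Q\<^esub> Idt Q X = \<phi>" "Idt Q Y \<cdot>\<^bsub>Q\<^esub> \<phi> = \<phi>" by (simp_all add: f(2))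
  fix \<psi> Z assume psi: "\<psi> \<in> Hom Q Y Z"
  obtain g where g: "g \<in> Hom A Y Z" "\<psi> = cl g" using quotient_HomE[OF psi] .
  note [THEN Hom_simps, simp] = g(1)
  show "\<psi> \<cdot>\<^bsub>Q\<^esub> \<phi> \<in> Hom Q X Z" by (simp add: f(2) g(2) Hom_def)
  fix \<chi> W assume chi: "\<chi> \<in> Hom Q Z W"
  obtain h where h: "h \<in> Hom A Z W" "\<chi> = cl h" using quotient_HomE[OF chi] .
  note [THEN Hom_simps, simp] = h(1)
  show "(\<chi> \<cdot>\<^bsub>Q\<^esub> \<psi>) \<cdot>\<^bsub>Q\<^esub> \<phi> = \<chi> \<cdot>\<^bsub>Q\<^esub> (\<psi> \<cdot>\<^bsub>Q\<^esub> \<phi>)" by (simp add: f(2) g(2) h(2))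
qed

lemma quotient_zero_object:
  assumes Z: "zero_object A Z"
  shows "zero_object Q Z"
proof -
  note [simp] = zero_objectD(1)[OF Z]
  have "\<exists>!\<phi>. \<phi> \<in> Hom Q X Z" "\<exists>!\<phi>. \<phi> \<in> Hom Q Z X" if X: "X \<in> Ob A" for X
  proof -
    note [simp] = X
    show "\<exists>!\<phi>. \<phi> \<in> Hom Q X Z"
    proof (rule ex1I[of _ "cl (Zero A X Z)"])
      fix \<phi> assume "\<phi> \<in> Hom Q X Z"
      then obtain f where f: "f \<in> Hom A X Z" "\<phi> = cl f" by (rule quotient_HomE)
      then show "\<phi> = cl (Zero A X Z)"
        using zero_objectD(2)[OF Z f(1) Zero_in_Hom[of X Z] X] by simp
    qed (simp add: Hom_def)
    show "\<exists>!\<phi>. \<phi> \<in> Hom Q Z X"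
    proof (rule ex1I[of _ "cl (Zero A Z X)"])
      fix \<phi> assume "\<phi> \<in> Hom Q Z X"
      then obtain f where f: "f \<in> Hom A Z X" "\<phi> = cl f" by (rule quotient_HomE)
      then show "\<phi> = cl (Zero A Z X)"
        using zero_objectD(3)[OF Z f(1) Zero_in_Hom[of Z X] X] by simp
    qed (simp add: Hom_def)
  qed
  then show ?thesis by (simp add: zero_object_def)
qed

lemma quotient_biproduct:
  assumes "biproduct A X Z Y i s r p"
  shows "biproduct Q X Z Y (cl i) (cl s) (cl r) (cl p)"
  using assms by (auto simp: biproduct_def Hom_def)

lemma quotient_Hom_comm_group:
  assumes XY: "X \<in> Ob A" "Y \<in> Ob A"
  shows "comm_group (hom_group Q X Y)"
proof (rule comm_groupI)
  note [simp] = XY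
  have rep: "\<exists>f \<in> Hom A X Y. \<phi> = cl f" if "\<phi> \<in> carrier (hom_group Q X Y)" for \<phi>
    using that quotient_HomE by (metis hom_group_def partial_object.select_convs(1))
  show "\<one>\<^bsub>hom_group Q X Y\<^esub> \<in> carrier (hom_group Q X Y)"
    by (simp add: hom_group_def Hom_def)
  fix \<phi> assume "\<phi> \<in> carrier (hom_group Q X Y)"
  then obtain f where f: "f \<in> Hom A X Y" "\<phi> = cl f" using rep by blast
  note [THEN Hom_simps, simp] = f(1)
  show "\<one>\<^bsub>hom_group Q X Y\<^esub> \<otimes>\<^bsub>hom_group Q X Y\<^esub> \<phi> = \<phi>"
    by (simp add: hom_group_def f(2))
  show "\<exists>\<psi>\<in>carrier (hom_group Q X Y). \<psi> \<otimes>\<^bsub>hom_group Q X Y\<^esub> \<phi> = \<one>\<^bsub>hom_group Q X Y\<^esub>"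
    by (rule bexI[of _ "cl (Neg A f)"]) (simp_all add: hom_group_def f(2) Hom_def)
  fix \<psi> assume "\<psi> \<in> carrier (hom_group Q X Y)"
  then obtain g where g: "g \<in> Hom A X Y" "\<psi> = cl g" using rep by blast
  note [THEN Hom_simps, simp] = g(1)
  show "\<phi> \<otimes>\<^bsub>hom_group Q X Y\<^esub> \<psi> \<in> carrier (hom_group Q X Y)"
    by (simp add: hom_group_def f(2) g(2) Hom_def)
  show "\<phi> \<otimes>\<^bsub>hom_group Q X Y\<^esub> \<psi> = \<psi> \<otimes>\<^bsub>hom_group Q X Y\<^esub> \<phi>"
    by (simp add: hom_group_def f(2) g(2) Add_commute[of f g])
  fix \<chi> assume "\<chi> \<in> carrier (hom_group Q X Y)"
  then obtain h where h: "h \<in> Hom A X Y" "\<chi> = cl h" using rep by blast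
  note [THEN Hom_simps, simp] = h(1)
  show "\<phi> \<otimes>\<^bsub>hom_group Q X Y\<^esub> \<psi> \<otimes>\<^bsub>hom_group Q X Y\<^esub> \<chi> =
      \<phi> \<otimes>\<^bsub>hom_group Q X Y\<^esub> (\<psi> \<otimes>\<^bsub>hom_group Q X Y\<^esub> \<chi>)"
    by (simp add: hom_group_def f(2) g(2) h(2) Add_assoc)
qed

theorem quotient_additive: "additive_category Q"
proof (intro additive_category.intro quotient_category additive_category_axioms.intro)
  show "\<exists>Z. zero_object Q Z" using ex_zero_object quotient_zero_object by blast
  show "\<exists>Y i s r p. biproduct Q X Z Y i s r p" if "X \<in> Ob Q" "Z \<in> Ob Q" for X Z
    using that ex_biproduct[of X Z] quotient_biproduct unfolding quotient_sel by blast
  show "comm_group (hom_group Q X Y)" if "X \<in> Ob Q" "Y \<in> Ob Q" for X Y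
    using quotient_Hom_comm_group that by simp
next
  fix \<phi> \<phi>' \<psi> X Y Z
  assume phi: "\<phi> \<in> Hom Q X Y" "\<phi>' \<in> Hom Q X Y" and psi: "\<psi> \<in> Hom Q Y Z"
  obtain f where f: "f \<in> Hom A X Y" "\<phi> = cl f" using quotient_HomE[OF phi(1)] .
  obtain f' where f': "f' \<in> Hom A X Y" "\<phi>' = cl f'" using quotient_HomE[OF phi(2)] .
  obtain g where g: "g \<in> Hom A Y Z" "\<psi> = cl g" using quotient_HomE[OF psi] .
  note [THEN Hom_simps, simp] = f(1) f'(1) g(1)
  show "\<psi> \<cdot>\<^bsub>Q\<^esub> (\<phi> \<boxplus>\<^bsub>Q\<^esub> \<phi>') = (\<psi> \<cdot>\<^bsub>Q\<^esub> \<phi>) \<boxplus>\<^bsub>Q\<^esub> (\<psi> \<cdot>\<^bsub>Q\<^esub> \<phi>')"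
    by (simp add: f(2) f'(2) g(2))
next
  fix \<phi> \<psi> \<psi>' X Y Z
  assume phi: "\<phi> \<in> Hom Q X Y" and psi: "\<psi> \<in> Hom Q Y Z" "\<psi>' \<in> Hom Q Y Z"
  obtain f where f: "f \<in> Hom A X Y" "\<phi> = cl f" using quotient_HomE[OF phi] .
  obtain g where g: "g \<in> Hom A Y Z" "\<psi> = cl g" using quotient_HomE[OF psi(1)] .
  obtain g' where g': "g' \<in> Hom A Y Z" "\<psi>' = cl g'" using quotient_HomE[OF psi(2)] .
  note [THEN Hom_simps, simp] = f(1) g(1) g'(1)
  show "(\<psi> \<boxplus>\<^bsub>Q\<^esub> \<psi>') \<cdot>\<^bsub>Q\<^esub> \<phi> = (\<psi> \<cdot>\<^bsub>Q\<^esub> \<phi>) \<boxplus>\<^bsub>Q\<^esub> (\<psi>' \<cdot>\<^bsub>Q\<^esub> \<phi>)"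
    by (simp add: f(2) g(2) g'(2))
qed

sublocale Q: additive_category Q
  by (rule quotient_additive)

lemma cls_Neg:
  assumes "f \<in> Arr A"
  shows "Neg Q (cl f) = cl (Neg A f)"
proof -
  note [simp] = assms
  show ?thesis
    by (rule Q.Neg_unique[symmetric, of _ "Dom A f" "Cod A f"]) (simp_all add: Hom_def)
qed

lemma cls_is_iso:
  assumes "f \<in> Hom A X Y" "g \<in> Hom A Y X"
    and "cl (g \<cdot> f) = cl (Idt A X)" "cl (f \<cdot> g) = cl (Idt A Y)"
  shows "is_iso Q (cl f)"
  using assms
  by (intro Q.is_isoI[of _ X Y "cl g"]) (simp_all add: cls_in_Hom cls_Comp)

end

section \<open>Kernels and cokernels\<close>

context additive_category
begin

lemma is_cokernelD:
  assumes "is_cokernel C i p"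
  shows "i \<in> Hom C (Dom C i) (Cod C i)" "p \<in> Hom C (Cod C i) (Cod C p)"
    "p \<cdot> i = Zero C (Dom C i) (Cod C p)"
    "\<lbrakk>f \<in> Hom C (Cod C i) W; f \<cdot> i = Zero C (Dom C i) W\<rbrakk> \<Longrightarrow> \<exists>g \<in> Hom C (Cod C p) W. g \<cdot> p = f"
    "\<lbrakk>a \<in> Hom C (Cod C p) W; b \<in> Hom C (Cod C p) W; a \<cdot> p = b \<cdot> p\<rbrakk> \<Longrightarrow> a = b"
proof -
  obtain X Y Z where i: "i \<in> Hom C X Y" and p: "p \<in> Hom C Y Z" and z: "p \<cdot> i = Zero C X Z"
    and u: "\<And>W f. \<lbrakk>f \<in> Hom C Y W; f \<cdot> i = Zero C X W\<rbrakk> \<Longrightarrow> \<exists>!g. g \<in> Hom C Z W \<and> g \<cdot> p = f"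
    using assms unfolding is_cokernel_def by blast
  note [THEN Hom_simps, simp] = i p
  show "i \<in> Hom C (Dom C i) (Cod C i)" "p \<in> Hom C (Cod C i) (Cod C p)"
    "p \<cdot> i = Zero C (Dom C i) (Cod C p)"
    using i p z by simp_all
  show "\<exists>g \<in> Hom C (Cod C p) W. g \<cdot> p = f"
    if "f \<in> Hom C (Cod C i) W" "f \<cdot> i = Zero C (Dom C i) W"
    using u[of f W] that by auto
  show "a = b" if "a \<in> Hom C (Cod C p) W" "b \<in> Hom C (Cod C p) W" "a \<cdot> p = b \<cdot> p"
  proof -
    note ab = that[simplified]
    note [THEN Hom_simps, simp] = ab(1,2)
    have "(b \<cdot> p) \<cdot> i = Zero C X W" by (simp add: z)
    then have "\<exists>!g. g \<in> Hom C Z W \<and> g \<cdot> p = b \<cdot> p" by (intro u) (simp_all add: Hom_def)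
    then show ?thesis using ab by blast
  qed
qed

lemma is_cokernelI:
  assumes i: "i \<in> Hom C X Y" and p: "p \<in> Hom C Y Z" and "p \<cdot> i = Zero C X Z"
    and ex: "\<And>W f. \<lbrakk>f \<in> Hom C Y W; f \<cdot> i = Zero C X W\<rbrakk> \<Longrightarrow> \<exists>g \<in> Hom C Z W. g \<cdot> p = f"
    and epi: "\<And>W a b. \<lbrakk>a \<in> Hom C Z W; b \<in> Hom C Z W; a \<cdot> p = b \<cdot> p\<rbrakk> \<Longrightarrow> a = b"
  shows "is_cokernel C i p"
proof -
  have "\<exists>!g. g \<in> Hom C Z W \<and> g \<cdot> p = f" if f: "f \<in> Hom C Y W" "f \<cdot> i = Zero C X W" for W f
  proof -
    obtain g where g: "g \<in> Hom C Z W" "g \<cdot> p = f" using ex[OF f] by blast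
    show ?thesis
    proof (rule ex1I[of _ g])
      show "g' = g" if "g' \<in> Hom C Z W \<and> g' \<cdot> p = f" for g'
        using epi[of g' W g] that g by simp
    qed (use g in simp)
  qed
  then show ?thesis using assms(1-3) unfolding is_cokernel_def by blast
qed

lemma is_kernelD:
  assumes "is_kernel C i p"
  shows "i \<in> Hom C (Dom C i) (Dom C p)" "p \<in> Hom C (Dom C p) (Cod C p)"
    "p \<cdot> i = Zero C (Dom C i) (Cod C p)"
    "\<lbrakk>f \<in> Hom C W (Dom C p); p \<cdot> f = Zero C W (Cod C p)\<rbrakk> \<Longrightarrow> \<exists>g \<in> Hom C W (Dom C i). i \<cdot> g = f"
    "\<lbrakk>a \<in> Hom C W (Dom C i); b \<in> Hom C W (Dom C i); i \<cdot> a = i \<cdot> b\<rbrakk> \<Longrightarrow> a = b"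
proof -
  obtain X Y Z where i: "i \<in> Hom C X Y" and p: "p \<in> Hom C Y Z" and z: "p \<cdot> i = Zero C X Z"
    and u: "\<And>W f. \<lbrakk>f \<in> Hom C W Y; p \<cdot> f = Zero C W Z\<rbrakk> \<Longrightarrow> \<exists>!g. g \<in> Hom C W X \<and> i \<cdot> g = f"
    using assms unfolding is_kernel_def by blast
  note [THEN Hom_simps, simp] = i p
  show "i \<in> Hom C (Dom C i) (Dom C p)" "p \<in> Hom C (Dom C p) (Cod C p)"
    "p \<cdot> i = Zero C (Dom C i) (Cod C p)"
    using i p z by simp_all
  show "\<exists>g \<in> Hom C W (Dom C i). i \<cdot> g = f"
    if "f \<in> Hom C W (Dom C p)" "p \<cdot> f = Zero C W (Cod C p)"
    using u[of f W] that by auto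
  show "a = b" if "a \<in> Hom C W (Dom C i)" "b \<in> Hom C W (Dom C i)" "i \<cdot> a = i \<cdot> b"
  proof -
    note ab = that[simplified]
    note [THEN Hom_simps, simp] = ab(1,2)
    have "p \<cdot> (i \<cdot> b) = Zero C W Z" by (simp add: Comp_eq[OF z])
    then have "\<exists>!g. g \<in> Hom C W X \<and> i \<cdot> g = i \<cdot> b" by (intro u) (simp_all add: Hom_def)
    then show ?thesis using ab by blast
  qed
qed

text \<open>The universal properties in the form used below: two maps that agree after composition with
  \<open>i\<close> (with \<open>p\<close>) differ by a map that factors through \<open>p\<close> (through \<open>i\<close>).\<close>

lemma cokernel_factor_difference:
  assumes ck: "is_cokernel C i p" and p: "p \<in> Hom C Y Z"
    and a: "a \<in> Hom C Y W" and b: "b \<in> Hom C Y W" and eq: "a \<cdot> i = b \<cdot> i"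
  obtains m where "m \<in> Hom C Z W" "a = b \<boxplus> (m \<cdot> p)"
proof -
  define X where "X = Dom C i"
  have i: "i \<in> Hom C X Y"
    using is_cokernelD(1,2)[OF ck] p by (simp add: X_def Hom_def)
  note [THEN Hom_simps, simp] = i p a b
  obtain d where d: "d \<in> Hom C Y W" "a = b \<boxplus> d" using difference[OF a b] .
  note [THEN Hom_simps, simp] = d(1)
  have "(b \<cdot> i) \<boxplus> (d \<cdot> i) = a \<cdot> i" unfolding d(2) by simp
  then have "d \<cdot> i = Zero C X W"
    unfolding eq by (intro Add_eq_self[of "b \<cdot> i"]) (simp_all add: Hom_def)
  then show thesis using is_cokernelD(4)[OF ck, of d W] d that by auto
qed

lemma kernel_factor_difference:
  assumes k: "is_kernel C i p" and i: "i \<in> Hom C X Y"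
    and a: "a \<in> Hom C W Y" and b: "b \<in> Hom C W Y" and eq: "p \<cdot> a = p \<cdot> b"
  obtains m where "m \<in> Hom C W X" "a = b \<boxplus> (i \<cdot> m)"
proof -
  define Z where "Z = Cod C p"
  have p: "p \<in> Hom C Y Z"
    using is_kernelD(1,2)[OF k] i by (simp add: Z_def Hom_def)
  note [THEN Hom_simps, simp] = i p a b
  obtain d where d: "d \<in> Hom C W Y" "a = b \<boxplus> d" using difference[OF a b] .
  note [THEN Hom_simps, simp] = d(1)
  have "(p \<cdot> b) \<boxplus> (p \<cdot> d) = p \<cdot> a" unfolding d(2) by simp
  then have "p \<cdot> d = Zero C W Z"
    unfolding eq by (intro Add_eq_self[of "p \<cdot> b"]) (simp_all add: Hom_def)
  then show thesis using is_kernelD(4)[OF k, of d W] d that by auto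
qed

end

lemma (in additive_category) biproduct_cokernel:
  assumes "biproduct C X Z Y i s r p"
  shows "is_cokernel C i p"
proof -
  have H: "i \<in> Hom C X Y" "s \<in> Hom C Z Y" "r \<in> Hom C Y X" "p \<in> Hom C Y Z"
    and eqs: "p \<cdot> s = Idt C Z" "p \<cdot> i = Zero C X Z" and sum: "(i \<cdot> r) \<boxplus> (s \<cdot> p) = Idt C Y"
    using assms by (auto simp: biproduct_def)
  note [THEN Hom_simps, simp] = H(1-4)
  show ?thesis
  proof (rule is_cokernelI[OF H(1,4) eqs(2)])
    fix W f assume f: "f \<in> Hom C Y W" and fi: "f \<cdot> i = Zero C X W"
    note [THEN Hom_simps, simp] = f
    have "f \<cdot> ((i \<cdot> r) \<boxplus> (s \<cdot> p)) = f" unfolding sum by simp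
    then have "(f \<cdot> s) \<cdot> p = f" by (simp add: Comp_eq[OF fi])
    then show "\<exists>g \<in> Hom C Z W. g \<cdot> p = f"
      by (intro bexI[of _ "f \<cdot> s"]) (simp_all add: Hom_def)
  next
    fix W a b assume a: "a \<in> Hom C Z W" and b: "b \<in> Hom C Z W" and eq: "a \<cdot> p = b \<cdot> p"
    note [THEN Hom_simps, simp] = a b
    show "a = b" using Comp_eq[OF eq, of s] by (simp add: eqs(1))
  qed
qed

section \<open>Frobenius structures and the shift\<close>

text \<open>A class \<open>E\<close> of kernel-cokernel pairs for which the objects of \<open>P\<close> are both projective and
  injective, with enough of both; \<open>\<iota>\<close> and \<open>\<pi>\<close> choose a pair \<open>X \<rightarrow> I X \<rightarrow> \<Sigma> X\<close> for every object \<open>X\<close>.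
  Of the axioms of an exact structure only those on inflations are assumed. In
  \<open>cokernel_change\<close>, the second map of a pair may be replaced by any cokernel of the first; this
  takes the place of closure under isomorphisms.\<close>

locale frobenius_pairs = additive_category A
  for A :: "('o, 'm, 'x) addcat_scheme" (structure) +
  fixes E :: "('m \<times> 'm) set" and P :: "'o set" and \<iota> \<pi> :: "'o \<Rightarrow> 'm"
  assumes kernel: "(i, p) \<in> E \<Longrightarrow> is_kernel A i p"
    and cokernel: "(i, p) \<in> E \<Longrightarrow> is_cokernel A i p"
    and cokernel_change: "\<lbrakk>(i, p) \<in> E; is_cokernel A i q\<rbrakk> \<Longrightarrow> (i, q) \<in> E"
    and biproduct_pair: "biproduct A X Z Y i s r p \<Longrightarrow> (i, p) \<in> E"
    and inflation_Comp: "\<lbrakk>inflation E i; inflation E j; Cod A i = Dom A j\<rbrakk> \<Longrightarrow> inflation E (j \<cdot> i)"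
    and inflation_pushout: "\<lbrakk>inflation E i; f \<in> Hom A (Dom A i) X'\<rbrakk>
      \<Longrightarrow> \<exists>j h. is_pushout A j h i f \<and> inflation E j"
    and P_Ob: "P \<subseteq> Ob A"
    and injective: "\<lbrakk>(i, p) \<in> E; W \<in> P; f \<in> Hom A (Dom A i) W\<rbrakk> \<Longrightarrow> \<exists>g \<in> Hom A (Cod A i) W. g \<cdot> i = f"
    and projective: "\<lbrakk>(i, p) \<in> E; W \<in> P; f \<in> Hom A W (Cod A p)\<rbrakk> \<Longrightarrow> \<exists>g \<in> Hom A W (Dom A p). p \<cdot> g = f"
    and enough_projectives: "X \<in> Ob A \<Longrightarrow> \<exists>(i, p) \<in> E. Cod A p = X \<and> Dom A p \<in> P"
    and shift_choice: "shift_choice A E P \<iota> \<pi>"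
begin

text \<open>The middle and last object of the pair chosen for \<open>X\<close>.\<close>

definition "I X = Cod A (\<iota> X)"
definition "\<Sigma> X = Cod A (\<pi> X)"

lemma pair_Hom:
  assumes "(i, p) \<in> E"
  shows "i \<in> Hom A (Dom A i) (Cod A i)" "p \<in> Hom A (Cod A i) (Cod A p)"
    "p \<cdot> i = Zero A (Dom A i) (Cod A p)"
  using is_cokernelD(1-3)[OF cokernel[OF assms]] .

lemma iota_pi:
  assumes "X \<in> Ob A"
  shows "(\<iota> X, \<pi> X) \<in> E" "\<iota> X \<in> Hom A X (I X)" "\<pi> X \<in> Hom A (I X) (\<Sigma> X)" "I X \<in> P"
    "\<pi> X \<cdot> \<iota> X = Zero A X (\<Sigma> X)"
  using assms shift_choice pair_Hom[of "\<iota> X" "\<pi> X"] unfolding shift_choice_def I_def \<Sigma>_def by auto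

lemma pair_epi:
  "\<lbrakk>(i, p) \<in> E; a \<in> Hom A (Cod A p) W; b \<in> Hom A (Cod A p) W; a \<cdot> p = b \<cdot> p\<rbrakk> \<Longrightarrow> a = b"
  using is_cokernelD(5) cokernel by blast

lemma pair_mono:
  "\<lbrakk>(i, p) \<in> E; a \<in> Hom A W (Dom A i); b \<in> Hom A W (Dom A i); i \<cdot> a = i \<cdot> b\<rbrakk> \<Longrightarrow> a = b"
  using is_kernelD(5) kernel by blast

text \<open>Since the objects of \<open>P\<close> are injective, a map on \<open>X\<close> factors through \<open>P\<close> if and only if it
  extends to \<open>I X\<close>; hence such maps are closed under addition, and no direct sums of objects of
  \<open>P\<close> are needed.\<close>

lemma factors_through_iff_extends:
  assumes "f \<in> Hom A X Y"
  shows "factors_through A P f \<longleftrightarrow> (\<exists>g \<in> Hom A (I X) Y. f = g \<cdot> \<iota> X)"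
proof
  note [THEN Hom_simps, simp] = assms
  note i = iota_pi[OF HomD(4)[OF assms]]
  note [THEN Hom_simps, simp] = i(2)
  assume "factors_through A P f"
  then obtain W a b where ab: "W \<in> P" "a \<in> Hom A X W" "b \<in> Hom A W Y" "f = b \<cdot> a"
    unfolding factors_through_def by auto
  note [THEN Hom_simps, simp] = ab(2,3)
  obtain c where c: "c \<in> Hom A (I X) W" "c \<cdot> \<iota> X = a" using injective[OF i(1) ab(1)] ab(2) by auto
  note [THEN Hom_simps, simp] = c(1)
  show "\<exists>g \<in> Hom A (I X) Y. f = g \<cdot> \<iota> X"
    by (rule bexI[of _ "b \<cdot> c"]) (simp_all add: ab(4) c(2) Hom_def)
next
  assume "\<exists>g \<in> Hom A (I X) Y. f = g \<cdot> \<iota> X"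
  then show "factors_through A P f"
    using iota_pi(2,4)[OF HomD(4)[OF assms]]
    unfolding factors_through_def HomD(2,3)[OF assms] by blast
qed

sublocale object_ideal A P
proof unfold_locales
  show "P \<subseteq> Ob A" by (rule P_Ob)
  obtain Z where Z: "zero_object A Z" using ex_zero_object by blast
  show "P \<noteq> {}" using iota_pi(4)[OF zero_objectD(1)[OF Z]] by blast
next
  fix f g X Y
  assume f: "f \<in> Hom A X Y" and g: "g \<in> Hom A X Y"
    and "factors_through A P f" "factors_through A P g"
  then obtain a b where ab: "a \<in> Hom A (I X) Y" "f = a \<cdot> \<iota> X" "b \<in> Hom A (I X) Y" "g = b \<cdot> \<iota> X"
    using factors_through_iff_extends by blast
  note [THEN Hom_simps, simp] = iota_pi(2)[OF HomD(4)[OF f]] ab(1,3)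
  have "f \<boxplus> g = (a \<boxplus> b) \<cdot> \<iota> X" by (simp add: ab)
  then show "factors_through A P (f \<boxplus> g)"
    using factors_through_iff_extends[OF Add_in_Hom[OF f g]] Add_in_Hom[OF ab(1,3)] by blast
qed

lemma cls_eq_extend:
  assumes "cl f = cl g" "f \<in> Hom A X Y" "g \<in> Hom A X Y" "(i, p) \<in> E" "i \<in> Hom A X M"
  obtains J l t where "J \<in> P" "l \<in> Hom A M J" "t \<in> Hom A J Y" "f = g \<boxplus> (t \<cdot> (l \<cdot> i))"
proof -
  obtain J a t where at: "J \<in> P" "a \<in> Hom A X J" "t \<in> Hom A J Y" "f = g \<boxplus> (t \<cdot> a)"
    using cls_eqE[OF assms(1-3)] .
  obtain l where "l \<in> Hom A M J" "l \<cdot> i = a"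
    using injective[OF assms(4) at(1), of a] at(2) HomD[OF assms(5)] by auto
  then show thesis using that at by blast
qed

text \<open>The key lemma: for a map \<open>(f, g, h)\<close> of pairs whose target has its middle object in \<open>P\<close>, the
  class of \<open>f\<close> determines the class of \<open>h\<close>. It makes the shift well defined and functorial and
  the class of a connecting map unique and natural.\<close>

lemma pair_map_unique:
  assumes E: "(i, p) \<in> E" "(i', p') \<in> E" and Y': "Y' \<in> P"
    and i: "i \<in> Hom A X Y" and p: "p \<in> Hom A Y Z"
    and i': "i' \<in> Hom A X' Y'" and p': "p' \<in> Hom A Y' Z'"
    and f: "f1 \<in> Hom A X X'" "f2 \<in> Hom A X X'" "cl f1 = cl f2"
    and g: "g1 \<in> Hom A Y Y'" "g2 \<in> Hom A Y Y'"
    and h: "h1 \<in> Hom A Z Z'" "h2 \<in> Hom A Z Z'"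
    and sq1: "g1 \<cdot> i = i' \<cdot> f1" "h1 \<cdot> p = p' \<cdot> g1"
    and sq2: "g2 \<cdot> i = i' \<cdot> f2" "h2 \<cdot> p = p' \<cdot> g2"
  shows "cl h1 = cl h2"
proof -
  note [THEN Hom_simps, simp] = i p i' p' f(1,2) g(1,2) h(1,2)
  obtain J l t where lt: "J \<in> P" "l \<in> Hom A Y J" "t \<in> Hom A J X'" "f1 = f2 \<boxplus> (t \<cdot> (l \<cdot> i))"
    using cls_eq_extend[OF f(3,1,2) E(1) i] .
  note [THEN Hom_simps, simp] = lt(2,3)
  have eq: "g1 \<cdot> i = (g2 \<boxplus> (i' \<cdot> (t \<cdot> l))) \<cdot> i"
    unfolding sq1(1) lt(4) by (simp add: sq2(1))
  have g': "g2 \<boxplus> (i' \<cdot> (t \<cdot> l)) \<in> Hom A Y Y'" by (simp add: Hom_def)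
  obtain m where m: "m \<in> Hom A Z Y'" "g1 = (g2 \<boxplus> (i' \<cdot> (t \<cdot> l))) \<boxplus> (m \<cdot> p)"
    using cokernel_factor_difference[OF cokernel[OF E(1)] p g(1) g' eq] .
  note [THEN Hom_simps, simp] = m(1)
  have z: "p' \<cdot> i' = Zero A X' Z'" using pair_Hom(3)[OF E(2)] by simp
  have hp: "h1 \<cdot> p = (h2 \<boxplus> (p' \<cdot> m)) \<cdot> p"
    unfolding sq1(2) m(2) by (simp add: sq2(2) Comp_eq[OF z])
  have "h1 = h2 \<boxplus> (p' \<cdot> m)"
    by (rule pair_epi[OF E(1) _ _ hp, of Z']) (simp_all add: Hom_def)
  then show ?thesis using cls_eqI[OF h Y' m(1) p'] by blast
qed

lemma pair_map_exists:
  assumes E: "(i, p) \<in> E" "(i', p') \<in> E" and Y': "Y' \<in> P"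
    and i: "i \<in> Hom A X Y" and p: "p \<in> Hom A Y Z"
    and i': "i' \<in> Hom A X' Y'" and p': "p' \<in> Hom A Y' Z'"
    and f: "f \<in> Hom A X X'"
  obtains g h where "g \<in> Hom A Y Y'" "h \<in> Hom A Z Z'" "g \<cdot> i = i' \<cdot> f" "h \<cdot> p = p' \<cdot> g"
proof -
  note [THEN Hom_simps, simp] = i p i' p' f
  obtain g where g: "g \<in> Hom A Y Y'" "g \<cdot> i = i' \<cdot> f"
    using injective[OF E(1) Y', of "i' \<cdot> f"] by (auto simp: Hom_def)
  note [THEN Hom_simps, simp] = g(1)
  have z: "p' \<cdot> i' = Zero A X' Z'" using pair_Hom(3)[OF E(2)] by simp
  have "(p' \<cdot> g) \<cdot> i = Zero A X Z'" by (simp add: g(2) Comp_eq[OF z])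
  then obtain h where "h \<in> Hom A Z Z'" "h \<cdot> p = p' \<cdot> g"
    using is_cokernelD(4)[OF cokernel[OF E(1)], of "p' \<cdot> g" Z'] by (auto simp: Hom_def)
  then show thesis using that g by blast
qed

lemma connecting_iff:
  assumes "i \<in> Hom A X Y" "p \<in> Hom A Y Z"
  shows "connecting A \<iota> \<pi> i p w \<longleftrightarrow> w \<in> Hom A Z (\<Sigma> X) \<and>
    (\<exists>e \<in> Hom A Y (I X). e \<cdot> i = \<iota> X \<and> w \<cdot> p = \<pi> X \<cdot> e)"
  using HomD[OF assms(1)] HomD[OF assms(2)] by (simp add: connecting_def I_def \<Sigma>_def)

abbreviation "conn \<equiv> connecting A \<iota> \<pi>"

lemma connecting_exists:
  assumes E: "(i, p) \<in> E"
  shows "\<exists>w. conn i p w"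
proof -
  note ip = pair_Hom(1,2)[OF E]
  note X = HomD(4)[OF ip(1)]
  obtain e w where ew: "e \<in> Hom A (Cod A i) (I (Dom A i))" "w \<in> Hom A (Cod A p) (\<Sigma> (Dom A i))"
      "e \<cdot> i = \<iota> (Dom A i) \<cdot> Idt A (Dom A i)" "w \<cdot> p = \<pi> (Dom A i) \<cdot> e"
    using pair_map_exists[OF E iota_pi(1)[OF X] iota_pi(4)[OF X] ip iota_pi(2,3)[OF X]
        Idt_in_Hom[OF X]] .
  then show ?thesis
    using connecting_iff[OF ip] HomD[OF iota_pi(2)[OF X]] by auto
qed

lemma connecting_unique:
  assumes E: "(i, p) \<in> E" and w: "conn i p w" "conn i p w'"
  shows "cl w = cl w'"
proof -
  note ip = pair_Hom(1,2)[OF E]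
  note X = HomD(4)[OF ip(1)]
  note I = iota_pi[OF X]
  obtain e where e: "w \<in> Hom A (Cod A p) (\<Sigma> (Dom A i))" "e \<in> Hom A (Cod A i) (I (Dom A i))"
      "e \<cdot> i = \<iota> (Dom A i)" "w \<cdot> p = \<pi> (Dom A i) \<cdot> e"
    using w(1) connecting_iff[OF ip] by blast
  obtain e' where e': "w' \<in> Hom A (Cod A p) (\<Sigma> (Dom A i))" "e' \<in> Hom A (Cod A i) (I (Dom A i))"
      "e' \<cdot> i = \<iota> (Dom A i)" "w' \<cdot> p = \<pi> (Dom A i) \<cdot> e'"
    using w(2) connecting_iff[OF ip] by blast
  have "\<iota> (Dom A i) \<cdot> Idt A (Dom A i) = \<iota> (Dom A i)" using HomD[OF I(2)] by simp
  then show ?thesis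
    using pair_map_unique[OF E I(1,4) ip I(2,3) Idt_in_Hom[OF X] Idt_in_Hom[OF X] refl e(2) e'(2)
        e(1) e'(1)] e(3,4) e'(3,4) by simp
qed

abbreviation "S \<equiv> shift_func A P \<iota> \<pi>"

lemma shift_ob [simp]: "ob S X = \<Sigma> X"
  by (simp add: shift_func_def \<Sigma>_def)

lemma shift_cls:
  assumes f: "f \<in> Hom A X Y" and g: "g \<in> Hom A (I X) (I Y)" and h: "h \<in> Hom A (\<Sigma> X) (\<Sigma> Y)"
    and sq: "g \<cdot> \<iota> X = \<iota> Y \<cdot> f" "h \<cdot> \<pi> X = \<pi> Y \<cdot> g"
  shows "ar S (cl f) = cl h"
proof -
  note X = HomD(4)[OF f] and Y = HomD(5)[OF f]
  have "(THE \<psi>. \<exists>X Y. \<exists>f \<in> cl f \<inter> Hom A X Y.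
      \<exists>g \<in> Hom A (I X) (I Y). \<exists>h \<in> Hom A (\<Sigma> X) (\<Sigma> Y).
         g \<cdot> \<iota> X = \<iota> Y \<cdot> f \<and> h \<cdot> \<pi> X = \<pi> Y \<cdot> g \<and> \<psi> = cl h) = cl h"
  proof (rule the_equality)
    have "f \<in> cl f \<inter> Hom A X Y" using f cls_refl by blast
    then show "\<exists>X Y. \<exists>f \<in> cl f \<inter> Hom A X Y.
      \<exists>g \<in> Hom A (I X) (I Y). \<exists>h' \<in> Hom A (\<Sigma> X) (\<Sigma> Y).
         g \<cdot> \<iota> X = \<iota> Y \<cdot> f \<and> h' \<cdot> \<pi> X = \<pi> Y \<cdot> g \<and> cl h = cl h'"
      using g h sq by blast
  next
    fix \<psi>
    assume "\<exists>X Y. \<exists>f \<in> cl f \<inter> Hom A X Y.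
      \<exists>g \<in> Hom A (I X) (I Y). \<exists>h \<in> Hom A (\<Sigma> X) (\<Sigma> Y).
         g \<cdot> \<iota> X = \<iota> Y \<cdot> f \<and> h \<cdot> \<pi> X = \<pi> Y \<cdot> g \<and> \<psi> = cl h"
    then obtain X' Y' f' g' h' where f': "f' \<in> cl f" "f' \<in> Hom A X' Y'"
      and g': "g' \<in> Hom A (I X') (I Y')" and h': "h' \<in> Hom A (\<Sigma> X') (\<Sigma> Y')"
      and sq': "g' \<cdot> \<iota> X' = \<iota> Y' \<cdot> f'" "h' \<cdot> \<pi> X' = \<pi> Y' \<cdot> g'" and psi: "\<psi> = cl h'"
      by blast
    have ff: "f' \<in> Hom A X Y" "cl f' = cl f" using f'(1) mem_cls_eq[OF f] by blast+
    have XY: "X' = X" "Y' = Y" using f'(2) ff(1) by (auto simp: Hom_def)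
    show "\<psi> = cl h"
      unfolding psi
      by (rule pair_map_unique[OF iota_pi(1)[OF X] iota_pi(1)[OF Y] iota_pi(4)[OF Y]
            iota_pi(2,3)[OF X] iota_pi(2,3)[OF Y] ff(1) f ff(2) g'[unfolded XY] g
            h'[unfolded XY] h sq'[unfolded XY] sq])
  qed
  then show ?thesis by (simp add: shift_func_def I_def \<Sigma>_def)
qed

lemma shift_rep:
  assumes f: "f \<in> Hom A X Y"
  obtains g h where "g \<in> Hom A (I X) (I Y)" "h \<in> Hom A (\<Sigma> X) (\<Sigma> Y)"
    "g \<cdot> \<iota> X = \<iota> Y \<cdot> f" "h \<cdot> \<pi> X = \<pi> Y \<cdot> g" "ar S (cl f) = cl h"
proof -
  note X = HomD(4)[OF f] and Y = HomD(5)[OF f]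
  obtain g h where "g \<in> Hom A (I X) (I Y)" "h \<in> Hom A (\<Sigma> X) (\<Sigma> Y)"
    "g \<cdot> \<iota> X = \<iota> Y \<cdot> f" "h \<cdot> \<pi> X = \<pi> Y \<cdot> g"
    using pair_map_exists[OF iota_pi(1)[OF X] iota_pi(1)[OF Y] iota_pi(4)[OF Y]
            iota_pi(2,3)[OF X] iota_pi(2,3)[OF Y] f] .
  then show thesis using that shift_cls[OF f] by blast
qed

lemma shift_functor: "cat_functor Q Q S"
proof (intro cat_functor.intro cat_functor_axioms.intro quotient_category)
  show "ob S X \<in> Ob Q" if "X \<in> Ob Q" for X
    using that HomD(5)[OF iota_pi(3)] by simp
next
  fix \<phi> X Y assume "\<phi> \<in> Hom Q X Y"
  then obtain f where f: "f \<in> Hom A X Y" "\<phi> = cl f" by (rule quotient_HomE)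
  obtain h where "h \<in> Hom A (\<Sigma> X) (\<Sigma> Y)" "ar S (cl f) = cl h"
    using shift_rep[OF f(1)] by blast
  then show "ar S \<phi> \<in> Hom Q (ob S X) (ob S Y)" using f(2) cls_in_Hom by simp
next
  fix X assume "X \<in> Ob Q"
  then have X: "X \<in> Ob A" by simp
  note [THEN Hom_simps, simp] = iota_pi(2)[OF X] iota_pi(3)[OF X]
  note [simp] = X
  show "ar S (Idt Q X) = Idt Q (ob S X)"
    unfolding quotient_sel shift_ob
    by (rule shift_cls[of _ X X "Idt A (I X)"]) (simp_all add: Hom_def)
next
  fix \<phi> \<psi> X Y Z
  assume phi: "\<phi> \<in> Hom Q X Y" and psi: "\<psi> \<in> Hom Q Y Z"
  obtain f where f: "f \<in> Hom A X Y" "\<phi> = cl f" using quotient_HomE[OF phi] .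
  obtain g where g: "g \<in> Hom A Y Z" "\<psi> = cl g" using quotient_HomE[OF psi] .
  obtain a b where ab: "a \<in> Hom A (I X) (I Y)" "b \<in> Hom A (\<Sigma> X) (\<Sigma> Y)"
    "a \<cdot> \<iota> X = \<iota> Y \<cdot> f" "b \<cdot> \<pi> X = \<pi> Y \<cdot> a" "ar S (cl f) = cl b"
    using shift_rep[OF f(1)] .
  obtain c d where cd: "c \<in> Hom A (I Y) (I Z)" "d \<in> Hom A (\<Sigma> Y) (\<Sigma> Z)"
    "c \<cdot> \<iota> Y = \<iota> Z \<cdot> g" "d \<cdot> \<pi> Y = \<pi> Z \<cdot> c" "ar S (cl g) = cl d"
    using shift_rep[OF g(1)] .
  note [THEN Hom_simps, simp] = f(1) g(1) ab(1,2) cd(1,2)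
  note [THEN Hom_simps, simp] = iota_pi(2)[OF HomD(4)[OF f(1)]] iota_pi(3)[OF HomD(4)[OF f(1)]]
    iota_pi(2)[OF HomD(4)[OF g(1)]] iota_pi(3)[OF HomD(4)[OF g(1)]] iota_pi(2)[OF HomD(5)[OF g(1)]]
    iota_pi(3)[OF HomD(5)[OF g(1)]]
  have "ar S (cl (g \<cdot> f)) = cl (d \<cdot> b)"
    by (rule shift_cls[of _ X Z "c \<cdot> a"])
      (simp_all add: Hom_def ab(3,4) Comp_eq[OF cd(3)] Comp_eq[OF cd(4)])
  then show "ar S (\<psi> \<cdot>\<^bsub>Q\<^esub> \<phi>) = ar S \<psi> \<cdot>\<^bsub>Q\<^esub> ar S \<phi>"
    by (simp add: f(2) g(2) ab(5) cd(5))
qed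

lemma shift_additive: "additive_functor Q Q S"
proof (intro additive_functor.intro shift_functor quotient_additive additive_functor_axioms.intro)
  fix \<phi> \<psi> X Y
  assume phi: "\<phi> \<in> Hom Q X Y" and psi: "\<psi> \<in> Hom Q X Y"
  obtain f where f: "f \<in> Hom A X Y" "\<phi> = cl f" using quotient_HomE[OF phi] .
  obtain g where g: "g \<in> Hom A X Y" "\<psi> = cl g" using quotient_HomE[OF psi] .
  obtain a b where ab: "a \<in> Hom A (I X) (I Y)" "b \<in> Hom A (\<Sigma> X) (\<Sigma> Y)"
    "a \<cdot> \<iota> X = \<iota> Y \<cdot> f" "b \<cdot> \<pi> X = \<pi> Y \<cdot> a" "ar S (cl f) = cl b"
    using shift_rep[OF f(1)] .
  obtain c d where cd: "c \<in> Hom A (I X) (I Y)" "d \<in> Hom A (\<Sigma> X) (\<Sigma> Y)"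
    "c \<cdot> \<iota> X = \<iota> Y \<cdot> g" "d \<cdot> \<pi> X = \<pi> Y \<cdot> c" "ar S (cl g) = cl d"
    using shift_rep[OF g(1)] .
  note [THEN Hom_simps, simp] = f(1) g(1) ab(1,2) cd(1,2)
  note [THEN Hom_simps, simp] = iota_pi(2)[OF HomD(4)[OF f(1)]] iota_pi(3)[OF HomD(4)[OF f(1)]]
    iota_pi(2)[OF HomD(5)[OF g(1)]] iota_pi(3)[OF HomD(5)[OF g(1)]]
  have "ar S (cl (f \<boxplus> g)) = cl (b \<boxplus> d)"
    by (rule shift_cls[of _ X Y "a \<boxplus> c"]) (simp_all add: Hom_def ab(3,4) cd(3,4))
  then show "ar S (\<phi> \<boxplus>\<^bsub>Q\<^esub> \<psi>) = ar S \<phi> \<boxplus>\<^bsub>Q\<^esub> ar S \<psi>"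
    by (simp add: f(2) g(2) ab(5) cd(5))
qed

lemma shift_fully_faithful: "fully_faithful_functor Q Q S"
proof (intro fully_faithful_functor.intro shift_functor fully_faithful_functor_axioms.intro)
  fix X Y \<phi>
  assume "X \<in> Ob Q" "Y \<in> Ob Q" and phi: "\<phi> \<in> Hom Q (ob S X) (ob S Y)"
  then have X: "X \<in> Ob A" and Y: "Y \<in> Ob A" by simp_all
  obtain h where h: "h \<in> Hom A (\<Sigma> X) (\<Sigma> Y)" "\<phi> = cl h"
    using quotient_HomE[OF phi] by auto
  note [THEN Hom_simps, simp] = iota_pi(2)[OF X] iota_pi(3)[OF X] iota_pi(2)[OF Y] iota_pi(3)[OF Y]
    h(1)
  obtain g where g: "g \<in> Hom A (I X) (I Y)" "\<pi> Y \<cdot> g = h \<cdot> \<pi> X"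
    using projective[OF iota_pi(1)[OF Y] iota_pi(4)[OF X], of "h \<cdot> \<pi> X"] by (auto simp: Hom_def)
  note [THEN Hom_simps, simp] = g(1)
  have "\<pi> Y \<cdot> (g \<cdot> \<iota> X) = Zero A X (\<Sigma> Y)"
    by (simp add: Comp_eq[OF g(2)] iota_pi(5)[OF X])
  then obtain f where f: "f \<in> Hom A X Y" "\<iota> Y \<cdot> f = g \<cdot> \<iota> X"
    using is_kernelD(4)[OF kernel[OF iota_pi(1)[OF Y]], of "g \<cdot> \<iota> X" X] by (auto simp: Hom_def)
  then have "ar S (cl f) = \<phi>" using shift_cls[OF f(1) g(1) h(1)] g(2) h(2) by simp
  then show "\<exists>\<psi> \<in> Hom Q X Y. ar S \<psi> = \<phi>" using cls_in_Hom[OF f(1)] by blast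
next
  fix \<phi> \<psi> X Y
  assume phi: "\<phi> \<in> Hom Q X Y" and psi: "\<psi> \<in> Hom Q X Y" and eq: "ar S \<phi> = ar S \<psi>"
  obtain f where f: "f \<in> Hom A X Y" "\<phi> = cl f" using quotient_HomE[OF phi] .
  obtain g where g: "g \<in> Hom A X Y" "\<psi> = cl g" using quotient_HomE[OF psi] .
  obtain a b where ab: "a \<in> Hom A (I X) (I Y)" "b \<in> Hom A (\<Sigma> X) (\<Sigma> Y)"
    "a \<cdot> \<iota> X = \<iota> Y \<cdot> f" "b \<cdot> \<pi> X = \<pi> Y \<cdot> a" "ar S (cl f) = cl b"
    using shift_rep[OF f(1)] .
  obtain c d where cd: "c \<in> Hom A (I X) (I Y)" "d \<in> Hom A (\<Sigma> X) (\<Sigma> Y)"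
    "c \<cdot> \<iota> X = \<iota> Y \<cdot> g" "d \<cdot> \<pi> X = \<pi> Y \<cdot> c" "ar S (cl g) = cl d"
    using shift_rep[OF g(1)] .
  note X = HomD(4)[OF f(1)] and Y = HomD(5)[OF f(1)]
  note IX = iota_pi[OF X] and IY = iota_pi[OF Y]
  note [THEN Hom_simps, simp] = f(1) g(1) ab(1,2) cd(1,2) IX(2,3) IY(2,3)
  have "cl b = cl d" using eq by (simp add: f(2) g(2) ab(5) cd(5))
  then obtain J l t where lt: "J \<in> P" "l \<in> Hom A (\<Sigma> X) J" "t \<in> Hom A J (\<Sigma> Y)" "b = d \<boxplus> (t \<cdot> l)"
    using cls_eqE[OF _ ab(2) cd(2)] by blast
  obtain t' where t': "t' \<in> Hom A J (I Y)" "\<pi> Y \<cdot> t' = t"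
    using projective[OF IY(1) lt(1)] lt(3) by auto
  note [THEN Hom_simps, simp] = lt(2,3) t'(1)
  have eq': "\<pi> Y \<cdot> a = \<pi> Y \<cdot> (c \<boxplus> (t' \<cdot> (l \<cdot> \<pi> X)))"
    unfolding ab(4)[symmetric] lt(4) by (simp add: cd(4) Comp_eq[OF t'(2)])
  have c': "c \<boxplus> (t' \<cdot> (l \<cdot> \<pi> X)) \<in> Hom A (I X) (I Y)" by (simp add: Hom_def)
  obtain n where n: "n \<in> Hom A (I X) Y" "a = (c \<boxplus> (t' \<cdot> (l \<cdot> \<pi> X))) \<boxplus> (\<iota> Y \<cdot> n)"
    using kernel_factor_difference[OF kernel[OF IY(1)] IY(2) ab(1) c' eq'] .
  note [THEN Hom_simps, simp] = n(1)
  have fg: "\<iota> Y \<cdot> f = \<iota> Y \<cdot> (g \<boxplus> (n \<cdot> \<iota> X))"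
    unfolding ab(3)[symmetric] n(2) by (simp add: cd(3) IX(5))
  have "f = g \<boxplus> (n \<cdot> \<iota> X)"
    by (rule pair_mono[OF IY(1) _ _ fg, of X]) (simp_all add: Hom_def)
  then show "\<phi> = \<psi>" unfolding f(2) g(2) using cls_eqI[OF f(1) g(1) IX(4,2) n(1)] by simp
qed

text \<open>For a pair \<open>X \<rightarrow> Y \<rightarrow> Z\<close> with \<open>Y\<close> in \<open>P\<close>, both \<open>Z\<close> and \<open>\<Sigma> X\<close> complete \<open>X\<close> to a pair with
  middle object in \<open>P\<close>, so they are isomorphic in the quotient.\<close>

lemma shift_essentially_surjective:
  assumes Z: "Z \<in> Ob A"
  shows "\<exists>X \<in> Ob A. \<exists>b \<in> Hom Q (\<Sigma> X) Z. is_iso Q b"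
proof -
  obtain i p where E: "(i, p) \<in> E" and pZ: "Cod A p = Z" and Y: "Dom A p \<in> P"
    using enough_projectives[OF Z] by blast
  define X where "X = Dom A i"
  define Y where "Y = Cod A i"
  have i: "i \<in> Hom A X Y" and p: "p \<in> Hom A Y Z"
    using pair_Hom[OF E] by (simp_all add: X_def Y_def pZ)
  note [THEN Hom_simps, simp] = i p
  have Y: "Y \<in> P" using \<open>Dom A p \<in> P\<close> by simp
  have X: "X \<in> Ob A" by simp
  note I = iota_pi[OF X]
  note [THEN Hom_simps, simp] = I(2,3)
  obtain e w where ew: "e \<in> Hom A Y (I X)" "w \<in> Hom A Z (\<Sigma> X)" "e \<cdot> i = \<iota> X \<cdot> Idt A X"
      "w \<cdot> p = \<pi> X \<cdot> e"
    using pair_map_exists[OF E I(1,4) i p I(2,3) Idt_in_Hom[OF X]] .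
  obtain d v where dv: "d \<in> Hom A (I X) Y" "v \<in> Hom A (\<Sigma> X) Z" "d \<cdot> \<iota> X = i \<cdot> Idt A X"
      "v \<cdot> \<pi> X = p \<cdot> d"
    using pair_map_exists[OF I(1) E Y I(2,3) i p Idt_in_Hom[OF X]] .
  note [THEN Hom_simps, simp] = ew(1,2) dv(1,2)
  have "cl (w \<cdot> v) = cl (Idt A (\<Sigma> X))"
    by (rule pair_map_unique[OF I(1,1,4,2,3,2,3) Idt_in_Hom[OF X] Idt_in_Hom[OF X] refl,
          of "e \<cdot> d" "Idt A (I X)"])
      (simp_all add: Hom_def ew(3)[simplified] dv(3)[simplified] dv(4) Comp_eq[OF ew(4)])
  moreover have "cl (v \<cdot> w) = cl (Idt A Z)"
    by (rule pair_map_unique[OF E E Y i p i p Idt_in_Hom[OF X] Idt_in_Hom[OF X] refl,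
          of "d \<cdot> e" "Idt A Y"])
      (simp_all add: Hom_def ew(3)[simplified] dv(3)[simplified] ew(4) Comp_eq[OF dv(4)])
  ultimately have "is_iso Q (cl v)" using cls_is_iso[OF dv(2) ew(2)] by blast
  then show ?thesis using X cls_in_Hom[OF dv(2)] by blast
qed

end

section \<open>The standard triangles of a Frobenius structure\<close>

context frobenius_pairs
begin

text \<open>The pushout of an inflation along any map is again an inflation, with the same cokernel.\<close>

lemma pair_pushout:
  assumes E: "(i, p) \<in> E" and i: "i \<in> Hom A X Y" and p: "p \<in> Hom A Y Z" and f: "f \<in> Hom A X X'"
  obtains W j h q where "j \<in> Hom A X' W" "h \<in> Hom A Y W" "q \<in> Hom A W Z"
    "(j, q) \<in> E" "h \<cdot> i = j \<cdot> f" "q \<cdot> h = p"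
    "\<And>V a b. \<lbrakk>a \<in> Hom A Y V; b \<in> Hom A X' V; a \<cdot> i = b \<cdot> f\<rbrakk>
      \<Longrightarrow> \<exists>c \<in> Hom A W V. c \<cdot> h = a \<and> c \<cdot> j = b"
    "\<And>V c c'. \<lbrakk>c \<in> Hom A W V; c' \<in> Hom A W V; c \<cdot> h = c' \<cdot> h; c \<cdot> j = c' \<cdot> j\<rbrakk> \<Longrightarrow> c = c'"
proof -
  note [THEN Hom_simps, simp] = i p f
  have "inflation E i" using E unfolding inflation_def by blast
  moreover have "f \<in> Hom A (Dom A i) X'" using f by simp
  ultimately obtain j h where po: "is_pushout A j h i f" and j_inf: "inflation E j"
    using inflation_pushout by blast
  obtain W where j: "j \<in> Hom A X' W" and h: "h \<in> Hom A Y W" and sq: "h \<cdot> i = j \<cdot> f"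
    and ex: "\<And>V a b. \<lbrakk>a \<in> Hom A Y V; b \<in> Hom A X' V; a \<cdot> i = b \<cdot> f\<rbrakk>
      \<Longrightarrow> \<exists>c \<in> Hom A W V. c \<cdot> h = a \<and> c \<cdot> j = b"
    and uni: "\<And>V c c'. \<lbrakk>c \<in> Hom A W V; c' \<in> Hom A W V; c \<cdot> h = c' \<cdot> h; c \<cdot> j = c' \<cdot> j\<rbrakk>
      \<Longrightarrow> c = c'"
    by (rule is_pushoutE[OF po i f]) (rule that, assumption+)
  note [THEN Hom_simps, simp] = j h
  have z: "p \<cdot> i = Zero A X Z" using pair_Hom(3)[OF E] by simp
  have "p \<cdot> i = Zero A X' Z \<cdot> f" using z by simp
  then obtain q where q: "q \<in> Hom A W Z" "q \<cdot> h = p" "q \<cdot> j = Zero A X' Z"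
    using ex[OF p Zero_in_Hom[of X' Z]] by auto
  note [THEN Hom_simps, simp] = q(1)
  have "is_cokernel A j q"
  proof (rule is_cokernelI[OF j q(1,3)])
    fix V t assume t: "t \<in> Hom A W V" and tj: "t \<cdot> j = Zero A X' V"
    note [THEN Hom_simps, simp] = t
    have "(t \<cdot> h) \<cdot> i = Zero A X V" by (simp add: sq Comp_eq[OF tj])
    then obtain s where s: "s \<in> Hom A Z V" "s \<cdot> p = t \<cdot> h"
      using is_cokernelD(4)[OF cokernel[OF E], of "t \<cdot> h" V] by (auto simp: Hom_def)
    note [THEN Hom_simps, simp] = s(1)
    have "s \<cdot> q = t"
      by (rule uni[of _ V]) (simp_all add: Hom_def q(2,3) s(2) tj)
    then show "\<exists>g \<in> Hom A Z V. g \<cdot> q = t" using s(1) by blast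
  next
    fix V a b assume ab: "a \<in> Hom A Z V" "b \<in> Hom A Z V" "a \<cdot> q = b \<cdot> q"
    note [THEN Hom_simps, simp] = ab(1,2)
    have "a \<cdot> p = b \<cdot> p"
      unfolding q(2)[symmetric] using Comp_eq[OF ab(3), of h] by simp
    then show "a = b" using pair_epi[OF E, of a V b] ab by simp
  qed
  then have jq: "(j, q) \<in> E" using j_inf cokernel_change unfolding inflation_def by blast
  show thesis by (rule that[OF j h q(1) jq sq q(2)]) (use ex uni in blast)+
qed

abbreviation "T0 \<equiv> standard_triangles A P E \<iota> \<pi>"

lemma standardI:
  "\<lbrakk>(i, p) \<in> E; conn i p w\<rbrakk> \<Longrightarrow> (cl i, cl p, cl w) \<in> T0"
  unfolding standard_triangles_def by blast

lemma standardE: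
  assumes "(u, v, w) \<in> T0"
  obtains i p c X Y Z where "(i, p) \<in> E" "conn i p c"
    "i \<in> Hom A X Y" "p \<in> Hom A Y Z" "c \<in> Hom A Z (\<Sigma> X)"
    "u = cl i" "v = cl p" "w = cl c"
proof -
  obtain i p c where ipc: "(i, p) \<in> E" "conn i p c"
      "u = cl i" "v = cl p" "w = cl c"
    using assms unfolding standard_triangles_def by blast
  note ip = pair_Hom(1,2)[OF ipc(1)]
  show thesis
    using that[OF ipc(1,2) ip _ ipc(3-5)] ipc(2) connecting_iff[OF ip] by blast
qed

text \<open>A map \<open>(f, g, h)\<close> of pairs induces a map of triangles.\<close>

lemma connecting_natural:
  assumes E: "(i, p) \<in> E" "(i', p') \<in> E"
    and i: "i \<in> Hom A X Y" and p: "p \<in> Hom A Y Z"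
    and i': "i' \<in> Hom A X' Y'" and p': "p' \<in> Hom A Y' Z'"
    and w: "conn i p w" and w': "conn i' p' w'"
    and f: "f \<in> Hom A X X'" and g: "g \<in> Hom A Y Y'" and h: "h \<in> Hom A Z Z'"
    and sq: "g \<cdot> i = i' \<cdot> f" "h \<cdot> p = p' \<cdot> g"
  shows "cl w' \<cdot>\<^bsub>Q\<^esub> cl h = ar S (cl f) \<cdot>\<^bsub>Q\<^esub> cl w"
proof -
  note [THEN Hom_simps, simp] = i p i' p' f g h
  have X: "X \<in> Ob A" "X' \<in> Ob A" by simp_all
  note I = iota_pi[OF X(1)] and I' = iota_pi[OF X(2)]
  note [THEN Hom_simps, simp] = I(2,3) I'(2,3)
  obtain e where e: "w \<in> Hom A Z (\<Sigma> X)" "e \<in> Hom A Y (I X)" "e \<cdot> i = \<iota> X" "w \<cdot> p = \<pi> X \<cdot> e"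
    using w connecting_iff[OF i p] by blast
  obtain e' where e': "w' \<in> Hom A Z' (\<Sigma> X')" "e' \<in> Hom A Y' (I X')" "e' \<cdot> i' = \<iota> X'"
      "w' \<cdot> p' = \<pi> X' \<cdot> e'"
    using w' connecting_iff[OF i' p'] by blast
  obtain a b where ab: "a \<in> Hom A (I X) (I X')" "b \<in> Hom A (\<Sigma> X) (\<Sigma> X')"
    "a \<cdot> \<iota> X = \<iota> X' \<cdot> f" "b \<cdot> \<pi> X = \<pi> X' \<cdot> a" "ar S (cl f) = cl b"
    using shift_rep[OF f] .
  note [THEN Hom_simps, simp] = e(1,2) e'(1,2) ab(1,2)
  have "cl (w' \<cdot> h) = cl (b \<cdot> w)"
    by (rule pair_map_unique[OF E(1) I'(1,4) i p I'(2,3) f f refl, of "e' \<cdot> g" "a \<cdot> e"])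
      (simp_all add: Hom_def sq Comp_eq[OF e'(3)] Comp_eq[OF e'(4)] e(3,4) ab(3)
        Comp_eq[OF ab(4)])
  then show ?thesis by (simp add: ab(5))
qed

lemma connecting_iota_pi:
  assumes X: "X \<in> Ob A"
  shows "conn (\<iota> X) (\<pi> X) (Idt A (\<Sigma> X))"
proof -
  note I = iota_pi[OF X]
  note [THEN Hom_simps, simp] = I(2,3)
  show ?thesis
    unfolding connecting_iff[OF I(2,3)]
    by (intro conjI bexI[of _ "Idt A (I X)"]) (simp_all add: Hom_def)
qed

lemma standard_Idt:
  assumes X: "X \<in> Ob A"
  shows "\<exists>Z w. zero_object Q Z \<and> (cl (Idt A X), cl (Zero A X Z), w) \<in> T0"
proof -
  obtain Z where Z: "zero_object A Z" using ex_zero_object by blast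
  from biproduct_pair[OF biproduct_zero[OF X Z]] have E: "(Idt A X, Zero A X Z) \<in> E" .
  then show ?thesis using standardI[OF E] connecting_exists[OF E] quotient_zero_object[OF Z] by blast
qed

text \<open>Every map \<open>u : X \<rightarrow> Y\<close> becomes an inflation after \<open>Y\<close> is replaced by a stably isomorphic
  object, the pushout \<open>W\<close> of \<open>\<iota> X\<close> along \<open>X \<rightarrow> Y \<oplus> X\<close>.\<close>

lemma standard_cone:
  assumes u: "u \<in> Hom A X Y"
  shows "\<exists>Y' s v w. s \<in> Hom Q Y Y' \<and> is_iso Q s \<and> (s \<cdot>\<^bsub>Q\<^esub> cl u, v, w) \<in> T0"
proof -
  note [THEN Hom_simps, simp] = u
  have X: "X \<in> Ob A" by simp
  note I = iota_pi[OF X]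
  note [THEN Hom_simps, simp] = I(2,3)
  obtain M y x rY rX where bip: "biproduct A Y X M y x rY rX"
    using ex_biproduct[of Y X] by auto
  then have M: "y \<in> Hom A Y M" "x \<in> Hom A X M" "rY \<in> Hom A M Y" "rX \<in> Hom A M X"
    and eqs: "rY \<cdot> y = Idt A Y" "rX \<cdot> x = Idt A X" "rY \<cdot> x = Zero A X Y" "rX \<cdot> y = Zero A Y X"
    and sum: "(y \<cdot> rY) \<boxplus> (x \<cdot> rX) = Idt A M"
    by (auto simp: biproduct_def)
  note [THEN Hom_simps, simp] = M(1-4)
  note [simp] = eqs Comp_eq[OF eqs(1)] Comp_eq[OF eqs(2)] Comp_eq[OF eqs(3)]
    Comp_eq[OF eqs(4)]
  \<comment> \<open>\<open>a = (u, 1)\<close> is a split inflation, and \<open>j a\<close> has the class of \<open>s u\<close> for \<open>s = j y\<close>.\<close>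
  define a where "a = (y \<cdot> u) \<boxplus> x"
  have a: "a \<in> Hom A X M" by (simp add: a_def Hom_def)
  note [THEN Hom_simps, simp] = a
  have "biproduct A X Y M a y rX (rY \<boxplus> Neg A (u \<cdot> rX))"
    unfolding biproduct_def
  proof (intro conjI)
    have "(a \<cdot> rX) \<boxplus> (y \<cdot> (rY \<boxplus> Neg A (u \<cdot> rX))) =
        ((y \<cdot> rY) \<boxplus> (x \<cdot> rX)) \<boxplus> ((y \<cdot> (u \<cdot> rX)) \<boxplus> Neg A (y \<cdot> (u \<cdot> rX)))"
      unfolding a_def by (simp del: Add_Neg add: Add_assoc Add_commute Add_left_commute)
    then show "(a \<cdot> rX) \<boxplus> (y \<cdot> (rY \<boxplus> Neg A (u \<cdot> rX))) = Idt A M" by (simp add: sum)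
  qed (simp_all add: a_def Hom_def)
  from biproduct_pair[OF this] have a_inf: "inflation E a" unfolding inflation_def by blast
  obtain W j h q where W: "j \<in> Hom A M W" "h \<in> Hom A (I X) W" "q \<in> Hom A W (\<Sigma> X)"
    and jq: "(j, q) \<in> E" and hj: "h \<cdot> \<iota> X = j \<cdot> x" and "q \<cdot> h = \<pi> X"
    and ex: "\<And>V a b. \<lbrakk>a \<in> Hom A (I X) V; b \<in> Hom A M V; a \<cdot> \<iota> X = b \<cdot> x\<rbrakk>
      \<Longrightarrow> \<exists>c \<in> Hom A W V. c \<cdot> h = a \<and> c \<cdot> j = b"
    and uni: "\<And>V c c'. \<lbrakk>c \<in> Hom A W V; c' \<in> Hom A W V; c \<cdot> h = c' \<cdot> h; c \<cdot> j = c' \<cdot> j\<rbrakk>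
      \<Longrightarrow> c = c'"
    by (rule pair_pushout[OF I(1,2,3) M(2)]) (rule that, assumption+)
  note [THEN Hom_simps, simp] = W(1-3)
  define s where "s = j \<cdot> y"
  have s: "s \<in> Hom A Y W" by (simp add: s_def Hom_def)
  note [THEN Hom_simps, simp] = s
  obtain c where c: "c \<in> Hom A W Y" "c \<cdot> h = Zero A (I X) Y" "c \<cdot> j = rY"
    using ex[of "Zero A (I X) Y" Y rY] by (auto simp: Hom_def)
  obtain r where r: "r \<in> Hom A W (I X)" "r \<cdot> h = Idt A (I X)" "r \<cdot> j = \<iota> X \<cdot> rX"
    using ex[of "Idt A (I X)" "I X" "\<iota> X \<cdot> rX"] by (auto simp: Hom_def)
  note [THEN Hom_simps, simp] = c(1) r(1)
  have cs: "c \<cdot> s = Idt A Y" by (simp add: s_def Comp_eq[OF c(3)])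
  have "Idt A W = (s \<cdot> c) \<boxplus> (h \<cdot> r)"
  proof (rule uni[of _ W])
    have "j \<cdot> ((y \<cdot> rY) \<boxplus> (x \<cdot> rX)) = j" unfolding sum by simp
    then have "(j \<cdot> (y \<cdot> rY)) \<boxplus> (j \<cdot> (x \<cdot> rX)) = j" by simp
    then show "Idt A W \<cdot> j = ((s \<cdot> c) \<boxplus> (h \<cdot> r)) \<cdot> j"
      by (simp add: c(3) r(3) s_def Comp_eq[OF hj])
  qed (simp_all add: c(2) r(2) Hom_def)
  then have "cl (Idt A W) = cl (s \<cdot> c)"
    using cls_eqI[OF _ _ I(4) r(1) W(2), of "Idt A W" "s \<cdot> c"] by (simp add: Hom_def)
  then have s_iso: "is_iso Q (cl s)" using cls_is_iso[OF s c(1)] cs by simp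
  have "inflation E j" using jq unfolding inflation_def by blast
  then have "inflation E (j \<cdot> a)" using inflation_Comp[OF a_inf] by simp
  then obtain p where p: "(j \<cdot> a, p) \<in> E" unfolding inflation_def by blast
  obtain w where w: "conn (j \<cdot> a) p w" using connecting_exists[OF p] by blast
  have "j \<cdot> a = (s \<cdot> u) \<boxplus> (h \<cdot> \<iota> X)" by (simp add: a_def s_def hj)
  then have "cl (j \<cdot> a) = cl (s \<cdot> u)"
    using cls_eqI[OF _ _ I(4,2) W(2), of "j \<cdot> a" "s \<cdot> u"] by (simp add: Hom_def)
  then have "(cl s \<cdot>\<^bsub>Q\<^esub> cl u, cl p, cl w) \<in> T0"
    using standardI[OF p w] by simp
  then show ?thesis using cls_in_Hom[OF s] s_iso by blast
qed

text \<open>If a square commutes only modulo \<open>P\<close>, then \<open>g\<close> is first changed within its class so that the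
  square commutes; this is possible because \<open>P\<close> is injective and \<open>i\<close> an inflation.\<close>

lemma standard_fill:
  assumes E: "(i, p) \<in> E" "(i', p') \<in> E"
    and i: "i \<in> Hom A X Y" and p: "p \<in> Hom A Y Z"
    and i': "i' \<in> Hom A X' Y'" and p': "p' \<in> Hom A Y' Z'"
    and w: "conn i p w" and w': "conn i' p' w'"
    and f: "f \<in> Hom A X X'" and g: "g \<in> Hom A Y Y'"
    and sq: "cl (g \<cdot> i) = cl (i' \<cdot> f)"
  obtains h where "h \<in> Hom A Z Z'" "cl (h \<cdot> p) = cl (p' \<cdot> g)"
    "cl w' \<cdot>\<^bsub>Q\<^esub> cl h = ar S (cl f) \<cdot>\<^bsub>Q\<^esub> cl w"
proof -
  note [THEN Hom_simps, simp] = i p i' p' f g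
  obtain J l t where lt: "J \<in> P" "l \<in> Hom A Y J" "t \<in> Hom A J Y'"
      "i' \<cdot> f = (g \<cdot> i) \<boxplus> (t \<cdot> (l \<cdot> i))"
    using cls_eq_extend[OF sq[symmetric] Comp_in_Hom[OF f i'] Comp_in_Hom[OF i g] E(1) i] .
  note [THEN Hom_simps, simp] = lt(2,3)
  define g1 where "g1 = g \<boxplus> (t \<cdot> l)"
  have g1: "g1 \<in> Hom A Y Y'" by (simp add: g1_def Hom_def)
  note [THEN Hom_simps, simp] = g1
  have sq1: "g1 \<cdot> i = i' \<cdot> f" by (simp add: g1_def lt(4))
  have z: "p' \<cdot> i' = Zero A X' Z'" using pair_Hom(3)[OF E(2)] by simp
  have "(p' \<cdot> g1) \<cdot> i = Zero A X Z'" by (simp add: sq1 Comp_eq[OF z])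
  then obtain h where h: "h \<in> Hom A Z Z'" "h \<cdot> p = p' \<cdot> g1"
    using is_cokernelD(4)[OF cokernel[OF E(1)], of "p' \<cdot> g1" Z'] by (auto simp: Hom_def)
  have "h \<cdot> p = (p' \<cdot> g) \<boxplus> ((p' \<cdot> t) \<cdot> l)" by (simp add: h(2) g1_def)
  then have "cl (h \<cdot> p) = cl (p' \<cdot> g)"
    using cls_eqI[OF Comp_in_Hom[OF p h(1)] Comp_in_Hom[OF g p'] lt(1,2) Comp_in_Hom[OF lt(3) p']]
    by blast
  then show thesis
    using that[OF h(1)] connecting_natural[OF E i p i' p' w w' f g1 h(1) sq1 h(2)] by blast
qed

text \<open>A map \<open>k\<close> on \<open>Z\<close> such that \<open>k p\<close> factors through \<open>P\<close> agrees, modulo \<open>P\<close>, with a map that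
  factors through the connecting map.\<close>

lemma standard_exact:
  assumes E: "(i, p) \<in> E" and i: "i \<in> Hom A X Y" and p: "p \<in> Hom A Y Z"
    and w: "conn i p w" and k: "k \<in> Hom A Z W" and kp: "null (k \<cdot> p)"
  obtains a where "a \<in> Hom A (\<Sigma> X) W" "cl k = cl (a \<cdot> w)"
proof -
  note [THEN Hom_simps, simp] = i p k
  have X: "X \<in> Ob A" by simp
  note I = iota_pi[OF X]
  note [THEN Hom_simps, simp] = I(2,3)
  obtain e where e: "w \<in> Hom A Z (\<Sigma> X)" "e \<in> Hom A Y (I X)" "e \<cdot> i = \<iota> X" "w \<cdot> p = \<pi> X \<cdot> e"
    using w connecting_iff[OF i p] by blast
  note [THEN Hom_simps, simp] = e(1,2)
  obtain J l t where lt: "J \<in> P" "l \<in> Hom A Y J" "t \<in> Hom A J W" "k \<cdot> p = t \<cdot> l"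
    using nullE[OF kp Comp_in_Hom[OF p k]] .
  note [THEN Hom_simps, simp] = lt(2,3)
  obtain n where n: "n \<in> Hom A (I X) J" "n \<cdot> \<iota> X = l \<cdot> i"
    using injective[OF I(1) lt(1), of "l \<cdot> i"] by (auto simp: Hom_def)
  note [THEN Hom_simps, simp] = n(1)
  have "l \<cdot> i = (n \<cdot> e) \<cdot> i" using n(2) by (simp add: e(3))
  then obtain r where r: "r \<in> Hom A Z J" "l = (n \<cdot> e) \<boxplus> (r \<cdot> p)"
    using cokernel_factor_difference[OF cokernel[OF E] p lt(2) Comp_in_Hom[OF e(2) n(1)]] by blast
  note [THEN Hom_simps, simp] = r(1)
  have z: "p \<cdot> i = Zero A X Z" using pair_Hom(3)[OF E] by simp
  have "(t \<cdot> n) \<cdot> \<iota> X = (t \<cdot> l) \<cdot> i" by (simp add: n(2))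
  also have "\<dots> = Zero A X W" unfolding lt(4)[symmetric] by (simp add: z)
  finally obtain a where a: "a \<in> Hom A (\<Sigma> X) W" "a \<cdot> \<pi> X = t \<cdot> n"
    using is_cokernelD(4)[OF cokernel[OF I(1)], of "t \<cdot> n" W] by (auto simp: Hom_def)
  note [THEN Hom_simps, simp] = a(1)
  have "k \<cdot> p = ((a \<cdot> w) \<boxplus> (t \<cdot> r)) \<cdot> p"
    unfolding lt(4) r(2) by (simp add: e(4) Comp_eq[OF a(2)])
  from pair_epi[OF E _ _ this, of W] have "k = (a \<cdot> w) \<boxplus> (t \<cdot> r)" by (simp add: Hom_def)
  then have "cl k = cl (a \<cdot> w)"
    using cls_eqI[OF k Comp_in_Hom[OF e(1) a(1)] lt(1) r(1) lt(3)] by blast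
  then show thesis using that a(1) by blast
qed

text \<open>Noether's isomorphism: the pushout of \<open>j\<close> along \<open>p\<close> yields the pair
  \<open>Z' \<rightarrow> Y' \<rightarrow> X'\<close>, and \<open>Z \<rightarrow> Y'\<close> is a cokernel of the composite \<open>j i\<close>.\<close>

lemma standard_octahedron:
  assumes E: "(i, p) \<in> E" "(j, q) \<in> E"
    and i: "i \<in> Hom A X Y" and p: "p \<in> Hom A Y Z'" and j: "j \<in> Hom A Y Z" and q: "q \<in> Hom A Z X'"
    and w1: "conn i p w1" and w2: "conn j q w2"
  obtains Y' h w3 f g w4 where "h \<in> Hom A Z Y'" "f \<in> Hom A Z' Y'" "g \<in> Hom A Y' X'"
    "(j \<cdot> i, h) \<in> E" "conn (j \<cdot> i) h w3"
    "(f, g) \<in> E" "conn f g w4"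
    "f \<cdot> p = h \<cdot> j" "g \<cdot> h = q"
    "cl w3 \<cdot>\<^bsub>Q\<^esub> cl f = cl w1"
    "cl w2 \<cdot>\<^bsub>Q\<^esub> cl g = ar S (cl i) \<cdot>\<^bsub>Q\<^esub> cl w3"
    "cl w4 = ar S (cl p) \<cdot>\<^bsub>Q\<^esub> cl w2"
proof -
  note [THEN Hom_simps, simp] = i p j q
  obtain Y' f h g where H: "f \<in> Hom A Z' Y'" "h \<in> Hom A Z Y'" "g \<in> Hom A Y' X'"
    and fg: "(f, g) \<in> E" and hj: "h \<cdot> j = f \<cdot> p" and gh: "g \<cdot> h = q"
    and ex: "\<And>V a b. \<lbrakk>a \<in> Hom A Z V; b \<in> Hom A Z' V; a \<cdot> j = b \<cdot> p\<rbrakk>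
      \<Longrightarrow> \<exists>c \<in> Hom A Y' V. c \<cdot> h = a \<and> c \<cdot> f = b"
    and uni: "\<And>V c c'. \<lbrakk>c \<in> Hom A Y' V; c' \<in> Hom A Y' V; c \<cdot> h = c' \<cdot> h; c \<cdot> f = c' \<cdot> f\<rbrakk>
      \<Longrightarrow> c = c'"
    by (rule pair_pushout[OF E(2) j q p]) (rule that, assumption+)
  note [THEN Hom_simps, simp] = H(1-3)
  have ji: "j \<cdot> i \<in> Hom A X Z" by (simp add: Hom_def)
  have z: "p \<cdot> i = Zero A X Z'" using pair_Hom(3)[OF E(1)] by simp
  have "is_cokernel A (j \<cdot> i) h"
  proof (rule is_cokernelI[OF ji H(2)])
    show "h \<cdot> (j \<cdot> i) = Zero A X Y'" by (simp add: Comp_eq[OF hj] z)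
  next
    fix V t assume t: "t \<in> Hom A Z V" and tz: "t \<cdot> (j \<cdot> i) = Zero A X V"
    note [THEN Hom_simps, simp] = t
    obtain s where s: "s \<in> Hom A Z' V" "s \<cdot> p = t \<cdot> j"
      using is_cokernelD(4)[OF cokernel[OF E(1)], of "t \<cdot> j" V] tz by (auto simp: Hom_def)
    show "\<exists>c \<in> Hom A Y' V. c \<cdot> h = t" using ex[OF t s(1)] s(2) by auto
  next
    fix V a b assume ab: "a \<in> Hom A Y' V" "b \<in> Hom A Y' V" "a \<cdot> h = b \<cdot> h"
    note [THEN Hom_simps, simp] = ab(1,2)
    have "(a \<cdot> f) \<cdot> p = (b \<cdot> f) \<cdot> p"
      using Comp_eq[OF ab(3), of j] by (simp add: hj)
    from pair_epi[OF E(1) _ _ this, of V] have "a \<cdot> f = b \<cdot> f" by (simp add: Hom_def)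
    then show "a = b" using uni ab by blast
  qed
  moreover have "inflation E i" "inflation E j" using E unfolding inflation_def by blast+
  then have "inflation E (j \<cdot> i)" using inflation_Comp by simp
  ultimately have jih: "(j \<cdot> i, h) \<in> E" using cokernel_change unfolding inflation_def by blast
  obtain w3 where w3: "conn (j \<cdot> i) h w3" using connecting_exists[OF jih] by blast
  obtain w4 where w4: "conn f g w4" using connecting_exists[OF fg] by blast
  have W: "w1 \<in> Hom A Z' (\<Sigma> X)" "w2 \<in> Hom A X' (\<Sigma> Y)" "w3 \<in> Hom A Y' (\<Sigma> X)" "w4 \<in> Hom A X' (\<Sigma> Z')"
    using w1 w2 w3 w4 connecting_iff[OF i p] connecting_iff[OF j q] connecting_iff[OF ji H(2)]
      connecting_iff[OF H(1,3)] by blast+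
  note [THEN Hom_simps, simp] = W(1-4)
  have SI: "ar S (cl (Idt A X)) = cl (Idt A (\<Sigma> X))"
    using cat_functor.ar_Idt[OF shift_functor, of X] by simp
  have 1: "cl w3 \<cdot>\<^bsub>Q\<^esub> cl f = cl w1"
    using connecting_natural[OF E(1) jih i p ji H(2) w1 w3 Idt_in_Hom[of X] j H(1)]
    by (simp add: hj SI)
  have 2: "cl w2 \<cdot>\<^bsub>Q\<^esub> cl g = ar S (cl i) \<cdot>\<^bsub>Q\<^esub> cl w3"
    using connecting_natural[OF jih E(2) ji H(2) j q w3 w2 i Idt_in_Hom[of Z] H(3)]
    by (simp add: gh)
  have 3: "cl w4 = ar S (cl p) \<cdot>\<^bsub>Q\<^esub> cl w2"
    using connecting_natural[OF E(2) fg j q H(1,3) w2 w4 p H(2) Idt_in_Hom[of X']]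
    by (simp add: gh hj)
  show thesis using that[OF H(2,1,3) jih w3 fg w4 hj[symmetric] gh 1 2 3] .
qed

text \<open>The rotated triangle comes from the pushout \<open>Y \<rightarrow> C \<rightarrow> \<Sigma> X\<close> of the pair chosen for \<open>X\<close> along
  \<open>i\<close>. The extension \<open>e\<close> of \<open>\<iota> X\<close> along \<open>i\<close> splits \<open>h : I X \<rightarrow> C\<close>, with complement \<open>s : Z \<rightarrow> C\<close>;
  so \<open>s\<close> is an isomorphism in the quotient, and \<open>q s = - w\<close> accounts for the sign.\<close>

lemma standard_rotate:
  assumes E: "(i, p) \<in> E" and i: "i \<in> Hom A X Y" and p: "p \<in> Hom A Y Z"
    and w: "conn i p w"
  obtains C j q w' s where "(j, q) \<in> E" "conn j q w'" "j \<in> Hom A Y C"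
    "q \<in> Hom A C (\<Sigma> X)" "w' \<in> Hom A (\<Sigma> X) (\<Sigma> Y)" "s \<in> Hom A Z C" "is_iso Q (cl s)"
    "cl (s \<cdot> p) = cl j" "q \<cdot> s = Neg A w" "ar S (cl i) = cl w'"
proof -
  note [THEN Hom_simps, simp] = i p
  have X: "X \<in> Ob A" by simp
  note I = iota_pi[OF X]
  note [THEN Hom_simps, simp] = I(2,3)
  obtain e where e: "w \<in> Hom A Z (\<Sigma> X)" "e \<in> Hom A Y (I X)" "e \<cdot> i = \<iota> X" "w \<cdot> p = \<pi> X \<cdot> e"
    using w connecting_iff[OF i p] by blast
  note [THEN Hom_simps, simp] = e(1,2)
  obtain C j h q where C: "j \<in> Hom A Y C" "h \<in> Hom A (I X) C" "q \<in> Hom A C (\<Sigma> X)"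
    and jq: "(j, q) \<in> E" and hj: "h \<cdot> \<iota> X = j \<cdot> i" and qh: "q \<cdot> h = \<pi> X"
    and ex: "\<And>V a b. \<lbrakk>a \<in> Hom A (I X) V; b \<in> Hom A Y V; a \<cdot> \<iota> X = b \<cdot> i\<rbrakk>
      \<Longrightarrow> \<exists>c \<in> Hom A C V. c \<cdot> h = a \<and> c \<cdot> j = b"
    and uni: "\<And>V c c'. \<lbrakk>c \<in> Hom A C V; c' \<in> Hom A C V; c \<cdot> h = c' \<cdot> h; c \<cdot> j = c' \<cdot> j\<rbrakk>
      \<Longrightarrow> c = c'"
    by (rule pair_pushout[OF I(1,2,3) i]) (rule that, assumption+)
  note [THEN Hom_simps, simp] = C(1-3)
  have z: "p \<cdot> i = Zero A X Z" using pair_Hom(3)[OF E] by simp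
  have zq: "q \<cdot> j = Zero A Y (\<Sigma> X)" using pair_Hom(3)[OF jq] by simp
  obtain c where c: "c \<in> Hom A C Z" "c \<cdot> h = Zero A (I X) Z" "c \<cdot> j = p"
    using ex[OF Zero_in_Hom[of "I X" Z] p] z by auto
  obtain r where r: "r \<in> Hom A C (I X)" "r \<cdot> h = Idt A (I X)" "r \<cdot> j = e"
    using ex[OF Idt_in_Hom[of "I X"] e(2)] e(3) by auto
  note [THEN Hom_simps, simp] = c(1) r(1)
  have "j \<cdot> i = (h \<cdot> e) \<cdot> i" by (simp add: e(3) hj)
  then obtain s where s: "s \<in> Hom A Z C" "j = (h \<cdot> e) \<boxplus> (s \<cdot> p)"
    using cokernel_factor_difference[OF cokernel[OF E] p C(1) Comp_in_Hom[OF e(2) C(2)]] by blast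
  note [THEN Hom_simps, simp] = s(1)
  have "c \<cdot> j = (c \<cdot> s) \<cdot> p" unfolding s(2) by (simp add: Comp_eq[OF c(2)])
  then have "(c \<cdot> s) \<cdot> p = Idt A Z \<cdot> p" unfolding c(3) by simp
  from pair_epi[OF E _ _ this, of Z] have cs: "c \<cdot> s = Idt A Z" by (simp add: Hom_def)
  have "Idt A C = (s \<cdot> c) \<boxplus> (h \<cdot> r)"
  proof (rule uni[of _ C])
    have "((s \<cdot> c) \<boxplus> (h \<cdot> r)) \<cdot> j = (s \<cdot> p) \<boxplus> (h \<cdot> e)" by (simp add: c(3) r(3))
    also have "\<dots> = (h \<cdot> e) \<boxplus> (s \<cdot> p)" by (rule Add_commute) simp_all
    finally show "Idt A C \<cdot> j = ((s \<cdot> c) \<boxplus> (h \<cdot> r)) \<cdot> j" unfolding s(2)[symmetric] by simp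
  qed (simp_all add: c(2) r(2) Hom_def)
  then have "cl (Idt A C) = cl (s \<cdot> c)"
    using cls_eqI[OF _ _ I(4) r(1) C(2), of "Idt A C" "s \<cdot> c"] by (simp add: Hom_def)
  then have s_iso: "is_iso Q (cl s)" using cls_is_iso[OF s(1) c(1)] cs by simp
  have "j = (s \<cdot> p) \<boxplus> (h \<cdot> e)" by (subst s(2), rule Add_commute) simp_all
  then have sp: "cl (s \<cdot> p) = cl j"
    using cls_eqI[OF C(1) Comp_in_Hom[OF p s(1)] I(4) e(2) C(2)] by simp
  have "q \<cdot> j = ((q \<cdot> s) \<boxplus> w) \<cdot> p"
    unfolding s(2) by (simp add: Comp_eq[OF qh] e(4) Add_commute)
  then have "((q \<cdot> s) \<boxplus> w) \<cdot> p = Zero A Z (\<Sigma> X) \<cdot> p" unfolding zq by simp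
  from pair_epi[OF E _ _ this, of "\<Sigma> X"] have "(q \<cdot> s) \<boxplus> w = Zero A Z (\<Sigma> X)"
    by (simp add: Hom_def)
  then have qs: "q \<cdot> s = Neg A w" by (intro Neg_unique[OF Comp_in_Hom[OF s(1) C(3)] e(1)])
  obtain w' where w': "conn j q w'" using connecting_exists[OF jq] by blast
  have W': "w' \<in> Hom A (\<Sigma> X) (\<Sigma> Y)" using w' connecting_iff[OF C(1,3)] by blast
  note [THEN Hom_simps, simp] = W'
  have Si: "ar S (cl i) \<in> Hom Q (\<Sigma> X) (\<Sigma> Y)"
    using cat_functor.ar_in_Hom[OF shift_functor cls_in_Hom[OF i]] by simp
  have "ar S (cl i) \<cdot>\<^bsub>Q\<^esub> cl (Idt A (\<Sigma> X)) = cl w'"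
    using connecting_natural[OF I(1) jq I(2,3) C(1,3) connecting_iota_pi[OF X] w' i C(2)
        Idt_in_Hom[of "\<Sigma> X"]] by (simp add: hj qh)
  then have "ar S (cl i) = cl w'" using Q.Comp_Idt[OF Si] by simp
  with that[OF jq w' C(1,3) W' s(1) s_iso sp qs] show thesis by blast
qed

sublocale triangles: pretriangulation Q S T0
proof (intro pretriangulation.intro shift_additive shift_fully_faithful quotient_additive
    pretriangulation_axioms.intro)
  show "\<exists>X \<in> Ob Q. \<exists>b \<in> Hom Q (ob S X) Z. is_iso Q b" if "Z \<in> Ob Q" for Z
    using shift_essentially_surjective that by simp
next
  fix t assume t: "t \<in> T0"
  obtain u v w where uvw: "t = (u, v, w)" by (cases t)
  obtain i p c X Y Z where "i \<in> Hom A X Y" "p \<in> Hom A Y Z" "c \<in> Hom A Z (\<Sigma> X)"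
    "u = cl i" "v = cl p" "w = cl c"
    using standardE[OF t[unfolded uvw]] .
  then have "u \<in> Hom Q X Y" "v \<in> Hom Q Y Z" "w \<in> Hom Q Z (ob S X)"
    by (simp_all add: cls_in_Hom)
  then show "is_triangle Q S t" unfolding uvw is_triangle_def prod.case by blast
next
  fix X assume "X \<in> Ob Q"
  then show "\<exists>Z w. zero_object Q Z \<and> (Idt Q X, Zero Q X Z, w) \<in> T0"
    using standard_Idt[of X] by simp
next
  fix u X Y assume "u \<in> Hom Q X Y"
  then obtain f where f: "f \<in> Hom A X Y" "u = cl f" by (rule quotient_HomE)
  then show "\<exists>Y' s v w. s \<in> Hom Q Y Y' \<and> is_iso Q s \<and> (s \<cdot>\<^bsub>Q\<^esub> u, v, w) \<in> T0"
    using standard_cone[OF f(1)] by simp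
next
  fix u v w assume t: "(u, v, w) \<in> T0"
  obtain i p c X Y Z where E: "(i, p) \<in> E" and c: "conn i p c"
    and i: "i \<in> Hom A X Y" and p: "p \<in> Hom A Y Z" and cH: "c \<in> Hom A Z (\<Sigma> X)"
    and uvw: "u = cl i" "v = cl p" "w = cl c"
    using standardE[OF t] .
  obtain C j q w' s where jq: "(j, q) \<in> E" and w': "conn j q w'"
    and C: "j \<in> Hom A Y C" "q \<in> Hom A C (\<Sigma> X)" "w' \<in> Hom A (\<Sigma> X) (\<Sigma> Y)" "s \<in> Hom A Z C"
    and s: "is_iso Q (cl s)" "cl (s \<cdot> p) = cl j" "q \<cdot> s = Neg A c"
      "ar S (cl i) = cl w'"
    using standard_rotate[OF E i p c] .
  interpret shift: additive_functor Q Q S by (rule shift_additive)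
  note [THEN Hom_simps, simp] = i p cH C(1-4)
  have "triangle_iso Q S (v, w, Neg Q (ar S u)) (cl j, cl q, cl w')"
    unfolding triangle_iso_def prod.case
  proof (intro conjI exI)
    have "v \<in> Hom Q Y Z" "w \<in> Hom Q Z (\<Sigma> X)" "Neg Q (ar S u) \<in> Hom Q (\<Sigma> X) (ob S Y)"
      by (simp_all add: uvw s(4) cls_Neg Hom_def)
    then show "is_triangle Q S (v, w, Neg Q (ar S u))" unfolding is_triangle_def prod.case by blast
    have "cl j \<in> Hom Q Y C" "cl q \<in> Hom Q C (\<Sigma> X)" "cl w' \<in> Hom Q (\<Sigma> X) (ob S Y)"
      by (simp_all add: Hom_def)
    then show "is_triangle Q S (cl j, cl q, cl w')"
      unfolding is_triangle_def prod.case by blast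
    show "is_iso Q (cl (Idt A Y))" using Q.is_iso_Idt[of Y] by simp
    show "is_iso Q (cl s)" by (rule s(1))
    show "is_iso Q (Neg Q (cl (Idt A (\<Sigma> X))))"
      using Q.is_iso_Neg[OF Q.is_iso_Idt Q.Idt_in_Hom, of "\<Sigma> X"] by simp
    show "ar S (cl (Idt A Y)) \<cdot>\<^bsub>Q\<^esub> Neg Q (ar S u) =
        cl w' \<cdot>\<^bsub>Q\<^esub> Neg Q (cl (Idt A (\<Sigma> X)))"
      using shift.ar_Idt[of Y] by (simp add: uvw s(4) cls_Neg)
  qed (simp_all add: uvw s(2,3,4) Hom_def cls_Neg)
  then show "\<exists>t \<in> T0. triangle_iso Q S (v, w, Neg Q (ar S u)) t"
    using standardI[OF jq w'] by blast
next
  fix u v w u' v' w' f g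
  assume t: "(u, v, w) \<in> T0" and t': "(u', v', w') \<in> T0"
    and f: "f \<in> Hom Q (Dom Q u) (Dom Q u')" and g: "g \<in> Hom Q (Cod Q u) (Cod Q u')"
    and sq: "g \<cdot>\<^bsub>Q\<^esub> u = u' \<cdot>\<^bsub>Q\<^esub> f"
  obtain i p c X Y Z where E: "(i, p) \<in> E" and c: "conn i p c"
    and i: "i \<in> Hom A X Y" and p: "p \<in> Hom A Y Z" and cH: "c \<in> Hom A Z (\<Sigma> X)"
    and uvw: "u = cl i" "v = cl p" "w = cl c"
    using standardE[OF t] .
  obtain i' p' c' X' Y' Z' where E': "(i', p') \<in> E" and c': "conn i' p' c'"
    and i': "i' \<in> Hom A X' Y'" and p': "p' \<in> Hom A Y' Z'" and cH': "c' \<in> Hom A Z' (\<Sigma> X')"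
    and uvw': "u' = cl i'" "v' = cl p'" "w' = cl c'"
    using standardE[OF t'] .
  note [THEN Hom_simps, simp] = i p cH i' p' cH'
  have "f \<in> Hom Q X X'" "g \<in> Hom Q Y Y'" using f g by (simp_all add: uvw uvw')
  then obtain a b where a: "a \<in> Hom A X X'" "f = cl a" and b: "b \<in> Hom A Y Y'" "g = cl b"
    using quotient_HomE by metis
  note [THEN Hom_simps, simp] = a(1) b(1)
  have "cl (b \<cdot> i) = cl (i' \<cdot> a)" using sq by (simp add: uvw uvw' a(2) b(2))
  from standard_fill[OF E E' i p i' p' c c' a(1) b(1) this]
  obtain h where h: "h \<in> Hom A Z Z'" "cl (h \<cdot> p) = cl (p' \<cdot> b)"
    "cl c' \<cdot>\<^bsub>Q\<^esub> cl h = ar S (cl a) \<cdot>\<^bsub>Q\<^esub> cl c" .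
  note [THEN Hom_simps, simp] = h(1)
  show "\<exists>h \<in> Hom Q (Cod Q v) (Cod Q v'). h \<cdot>\<^bsub>Q\<^esub> v = v' \<cdot>\<^bsub>Q\<^esub> g \<and> w' \<cdot>\<^bsub>Q\<^esub> h = ar S f \<cdot>\<^bsub>Q\<^esub> w"
    using h cls_in_Hom[OF h(1)]
    by (intro bexI[of _ "cl h"]) (simp_all add: uvw uvw' a(2) b(2))
next
  fix u v w k W
  assume t: "(u, v, w) \<in> T0" and k: "k \<in> Hom Q (Cod Q v) W"
    and kv: "k \<cdot>\<^bsub>Q\<^esub> v = Zero Q (Dom Q v) W"
  obtain i p c X Y Z where E: "(i, p) \<in> E" and c: "conn i p c"
    and i: "i \<in> Hom A X Y" and p: "p \<in> Hom A Y Z" and cH: "c \<in> Hom A Z (\<Sigma> X)"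
    and uvw: "u = cl i" "v = cl p" "w = cl c"
    using standardE[OF t] .
  note [THEN Hom_simps, simp] = i p cH
  have "k \<in> Hom Q Z W" using k by (simp add: uvw)
  then obtain l where l: "l \<in> Hom A Z W" "k = cl l" by (rule quotient_HomE)
  note [THEN Hom_simps, simp] = l(1)
  have "null (l \<cdot> p)"
    using kv cls_eq_Zero_iff[OF Comp_in_Hom[OF p l(1)]] by (simp add: uvw l(2))
  from standard_exact[OF E i p c l(1) this]
  obtain a where a: "a \<in> Hom A (\<Sigma> X) W" "cl l = cl (a \<cdot> c)" .
  note [THEN Hom_simps, simp] = a(1)
  show "\<exists>a \<in> Hom Q (Cod Q w) W. k = a \<cdot>\<^bsub>Q\<^esub> w"
    using cls_in_Hom[OF a(1)] a(2)
    by (intro bexI[of _ "cl a"]) (simp_all add: uvw l(2))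
next
  fix u p w1 v q w2
  assume t: "(u, p, w1) \<in> T0" and t': "(v, q, w2) \<in> T0" and uv: "Cod Q u = Dom Q v"
  obtain i a c X Y Z' where E: "(i, a) \<in> E" and c: "conn i a c"
    and i: "i \<in> Hom A X Y" and a: "a \<in> Hom A Y Z'" and cH: "c \<in> Hom A Z' (\<Sigma> X)"
    and upw: "u = cl i" "p = cl a" "w1 = cl c"
    using standardE[OF t] .
  obtain j b d Y1 Z X' where E': "(j, b) \<in> E" and d: "conn j b d"
    and j': "j \<in> Hom A Y1 Z" and b: "b \<in> Hom A Z X'" and dH': "d \<in> Hom A X' (\<Sigma> Y1)"
    and vqw: "v = cl j" "q = cl b" "w2 = cl d"
    using standardE[OF t'] .
  have Y1: "Y1 = Y" using uv HomD[OF i] HomD[OF j'] by (simp add: upw vqw)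
  note j = j'[unfolded Y1] and dH = dH'[unfolded Y1]
  obtain Y' h w3 f g w4 where H: "h \<in> Hom A Z Y'" "f \<in> Hom A Z' Y'" "g \<in> Hom A Y' X'"
    and jih: "(j \<cdot> i, h) \<in> E" and w3: "conn (j \<cdot> i) h w3"
    and fg: "(f, g) \<in> E" and w4: "conn f g w4"
    and eqs: "f \<cdot> a = h \<cdot> j" "g \<cdot> h = b"
    "cl w3 \<cdot>\<^bsub>Q\<^esub> cl f = cl c"
    "cl d \<cdot>\<^bsub>Q\<^esub> cl g = ar S (cl i) \<cdot>\<^bsub>Q\<^esub> cl w3"
    "cl w4 = ar S (cl a) \<cdot>\<^bsub>Q\<^esub> cl d"
    using standard_octahedron[OF E E' i a j b c d] .
  note [THEN Hom_simps, simp] = i a j b H(1-3)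
  have "(v \<cdot>\<^bsub>Q\<^esub> u, cl h, cl w3) \<in> T0"
    using standardI[OF jih w3] by (simp add: upw vqw)
  moreover have "(cl f, cl g, ar S p \<cdot>\<^bsub>Q\<^esub> w2) \<in> T0"
    using standardI[OF fg w4] by (simp add: upw vqw eqs(5))
  moreover have "cl f \<in> Hom Q (Cod Q p) (Cod Q (cl h))"
    "cl g \<in> Hom Q (Cod Q (cl h)) (Cod Q q)"
    by (simp_all add: upw vqw Hom_def)
  moreover have "cl f \<cdot>\<^bsub>Q\<^esub> p = cl h \<cdot>\<^bsub>Q\<^esub> v" "cl g \<cdot>\<^bsub>Q\<^esub> cl h = q"
    by (simp_all add: upw vqw eqs(1,2))
  ultimately show "\<exists>h w3 f g. (v \<cdot>\<^bsub>Q\<^esub> u, h, w3) \<in> T0 \<and> (f, g, ar S p \<cdot>\<^bsub>Q\<^esub> w2) \<in> T0 \<and>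
            f \<in> Hom Q (Cod Q p) (Cod Q h) \<and> g \<in> Hom Q (Cod Q h) (Cod Q q) \<and>
            f \<cdot>\<^bsub>Q\<^esub> p = h \<cdot>\<^bsub>Q\<^esub> v \<and> w3 \<cdot>\<^bsub>Q\<^esub> f = w1 \<and> g \<cdot>\<^bsub>Q\<^esub> h = q \<and> w2 \<cdot>\<^bsub>Q\<^esub> g = ar S u \<cdot>\<^bsub>Q\<^esub> w3"
    using eqs(3,4) upw vqw by blast
qed

theorem triangulated:
  "triangulated_category Q S (distinguished_triangles A P E \<iota> \<pi>)"
  using triangles.triangulated_category_T
  unfolding triangles.T_def distinguished_triangles_def .

theorem connecting_class_unique:
  assumes "(i, p) \<in> E"
  shows "\<exists>!\<omega>. \<exists>w. conn i p w \<and> \<omega> = cl w"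
  using connecting_exists[OF assms] connecting_unique[OF assms] by blast

end

section \<open>Adjunctions and split pairs\<close>

context adjunction
begin

lemma unit_Hom: "Y \<in> Ob D \<Longrightarrow> \<eta> Y \<in> Hom D Y (ob R (ob L Y))"
  using unit.component_in_Hom by (simp add: id_func_def comp_func_def)

lemma counit_Hom: "X \<in> Ob C \<Longrightarrow> \<epsilon> X \<in> Hom C (ob L (ob R X)) X"
  using counit.component_in_Hom by (simp add: id_func_def comp_func_def)

lemma unit_simps [simp]:
  assumes "Y \<in> Ob D"
  shows "\<eta> Y \<in> Arr D" "Dom D (\<eta> Y) = Y" "Cod D (\<eta> Y) = ob R (ob L Y)"
  using unit_Hom[OF assms] by (auto simp: Hom_def)

lemma counit_simps [simp]:
  assumes "X \<in> Ob C"
  shows "\<epsilon> X \<in> Arr C" "Dom C (\<epsilon> X) = ob L (ob R X)" "Cod C (\<epsilon> X) = X"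
  using counit_Hom[OF assms] by (auto simp: Hom_def)

lemma unit_natural: "f \<in> Hom D X Y \<Longrightarrow> \<eta> Y \<cdot>\<^bsub>D\<^esub> f = ar R (ar L f) \<cdot>\<^bsub>D\<^esub> \<eta> X"
  using unit.naturality by (simp add: id_func_def comp_func_def)

lemma counit_natural: "f \<in> Hom C X Y \<Longrightarrow> \<epsilon> Y \<cdot>\<^bsub>C\<^esub> ar L (ar R f) = f \<cdot>\<^bsub>C\<^esub> \<epsilon> X"
  using counit.naturality by (simp add: id_func_def comp_func_def)

lemma transpose_left:
  assumes t: "t \<in> Hom C (ob L Y) Z" and Y: "Y \<in> Ob D"
  shows "\<epsilon> Z \<cdot>\<^bsub>C\<^esub> ar L (ar R t \<cdot>\<^bsub>D\<^esub> \<eta> Y) = t"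
proof -
  note [THEN L.D.Hom_simps, simp] = t
  note [simp] = Y
  have "\<epsilon> Z \<cdot>\<^bsub>C\<^esub> ar L (ar R t \<cdot>\<^bsub>D\<^esub> \<eta> Y) = (\<epsilon> Z \<cdot>\<^bsub>C\<^esub> ar L (ar R t)) \<cdot>\<^bsub>C\<^esub> ar L (\<eta> Y)"
    by (simp add: L.ar_Comp_simp)
  then show ?thesis by (simp add: counit_natural[OF t] counit_unit_L)
qed

lemma transpose_right:
  assumes g: "g \<in> Hom D Y (ob R Z)" and Z: "Z \<in> Ob C"
  shows "ar R (\<epsilon> Z \<cdot>\<^bsub>C\<^esub> ar L g) \<cdot>\<^bsub>D\<^esub> \<eta> Y = g"
proof -
  note [THEN L.C.Hom_simps, simp] = g
  note [simp] = Z
  have "ar R (\<epsilon> Z \<cdot>\<^bsub>C\<^esub> ar L g) \<cdot>\<^bsub>D\<^esub> \<eta> Y = ar R (\<epsilon> Z) \<cdot>\<^bsub>D\<^esub> (ar R (ar L g) \<cdot>\<^bsub>D\<^esub> \<eta> Y)"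
    by (simp add: R.ar_Comp_simp)
  also have "\<dots> = (ar R (\<epsilon> Z) \<cdot>\<^bsub>D\<^esub> \<eta> (ob R Z)) \<cdot>\<^bsub>D\<^esub> g"
    unfolding unit_natural[OF g, symmetric] by simp
  finally show ?thesis by (simp add: counit_unit_R)
qed

text \<open>Objects in the image of the left adjoint are projective relative to maps that the right adjoint
  turns into split epimorphisms. Dually, objects in the image of the right adjoint are injective
  relative to maps that the left adjoint turns into split monomorphisms.\<close>

lemma left_adjoint_projective:
  assumes Y: "Y \<in> Ob D" and p: "p \<in> Hom C M Z" and f: "f \<in> Hom C (ob L Y) Z"
    and s: "s \<in> Hom D (ob R Z) (ob R M)" "ar R p \<cdot>\<^bsub>D\<^esub> s = Idt D (ob R Z)"
  shows "\<exists>g \<in> Hom C (ob L Y) M. p \<cdot>\<^bsub>C\<^esub> g = f"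
proof -
  note [THEN L.D.Hom_simps, simp] = p f
  note [THEN L.C.Hom_simps, simp] = s(1)
  note [simp] = Y
  define g where "g = \<epsilon> M \<cdot>\<^bsub>C\<^esub> ar L (s \<cdot>\<^bsub>D\<^esub> (ar R f \<cdot>\<^bsub>D\<^esub> \<eta> Y))"
  have "p \<cdot>\<^bsub>C\<^esub> g = (\<epsilon> Z \<cdot>\<^bsub>C\<^esub> ar L (ar R p)) \<cdot>\<^bsub>C\<^esub> ar L (s \<cdot>\<^bsub>D\<^esub> (ar R f \<cdot>\<^bsub>D\<^esub> \<eta> Y))"
    unfolding counit_natural[OF p] by (simp add: g_def)
  also have "\<dots> = \<epsilon> Z \<cdot>\<^bsub>C\<^esub> ar L (ar R p \<cdot>\<^bsub>D\<^esub> (s \<cdot>\<^bsub>D\<^esub> (ar R f \<cdot>\<^bsub>D\<^esub> \<eta> Y)))"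
    by (simp add: L.ar_Comp_simp)
  also have "\<dots> = f" using transpose_left[OF f Y] by (simp add: L.C.Comp_eq[OF s(2)])
  finally show ?thesis by (intro bexI[of _ g]) (simp_all add: g_def Hom_def)
qed

lemma right_adjoint_injective:
  assumes Y: "Y \<in> Ob C" and i: "i \<in> Hom D X M" and f: "f \<in> Hom D X (ob R Y)"
    and r: "r \<in> Hom C (ob L M) (ob L X)" "r \<cdot>\<^bsub>C\<^esub> ar L i = Idt C (ob L X)"
  shows "\<exists>g \<in> Hom D M (ob R Y). g \<cdot>\<^bsub>D\<^esub> i = f"
proof -
  note [THEN L.C.Hom_simps, simp] = i f
  note [THEN L.D.Hom_simps, simp] = r(1)
  note [simp] = Y
  define t where "t = \<epsilon> Y \<cdot>\<^bsub>C\<^esub> ar L f"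
  have t: "t \<in> Hom C (ob L X) Y" by (simp add: t_def Hom_def)
  note [THEN L.D.Hom_simps, simp] = t
  define g where "g = ar R (t \<cdot>\<^bsub>C\<^esub> r) \<cdot>\<^bsub>D\<^esub> \<eta> M"
  have "g \<cdot>\<^bsub>D\<^esub> i = ar R (t \<cdot>\<^bsub>C\<^esub> r) \<cdot>\<^bsub>D\<^esub> (ar R (ar L i) \<cdot>\<^bsub>D\<^esub> \<eta> X)"
    unfolding unit_natural[OF i, symmetric] by (simp add: g_def)
  also have "\<dots> = ar R ((t \<cdot>\<^bsub>C\<^esub> r) \<cdot>\<^bsub>C\<^esub> ar L i) \<cdot>\<^bsub>D\<^esub> \<eta> X"
    by (simp add: R.ar_Comp_simp del: L.D.Comp_assoc_simp)
  also have "\<dots> = f" using transpose_right[OF f Y] by (simp add: r(2) t_def)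
  finally show ?thesis by (intro bexI[of _ g]) (simp_all add: g_def Hom_def)
qed

end

text \<open>An adjunction between additive categories with additive right adjoint, and one with additive
  left adjoint. The other functor is then additive as well, but this is not needed.\<close>

locale additive_right_adjoint = adjunction C D L R \<eta> \<epsilon> + R: additive_functor C D R
  for C :: "('o, 'm, 'x) addcat_scheme" and D :: "('p, 'n, 'y) addcat_scheme"
    and L :: "('p, 'n, 'o, 'm) func" and R :: "('o, 'm, 'p, 'n) func"
    and \<eta> :: "'p \<Rightarrow> 'n" and \<epsilon> :: "'o \<Rightarrow> 'm"
begin

text \<open>A right adjoint preserves kernels, so a map \<open>p\<close> together with its kernel is sent to a split pair
  as soon as the image of \<open>p\<close> has a section.\<close>

lemma right_adjoint_split_if_section:
  assumes ker: "is_kernel C i p"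
    and i: "i \<in> Hom C X Y" and p: "p \<in> Hom C Y Z"
    and s: "s \<in> Hom D (ob R Z) (ob R Y)" "ar R p \<cdot>\<^bsub>D\<^esub> s = Idt D (ob R Z)"
  shows "split_exact D (ar R i) (ar R p)"
proof -
  note [THEN L.D.Hom_simps, simp] = i p
  note [THEN L.C.Hom_simps, simp] = s(1)
  note [simp] = s(2)
  have z: "p \<cdot>\<^bsub>C\<^esub> i = Zero C X Z" using R.C.is_kernelD(3)[OF ker] by simp
  have Rz: "ar R p \<cdot>\<^bsub>D\<^esub> ar R i = Zero D (ob R X) (ob R Z)"
    using R.ar_Comp_eq[OF z] by (simp add: R.ar_Zero)
  have mono: "a = b"
    if a: "a \<in> Hom D W (ob R X)" and b: "b \<in> Hom D W (ob R X)"
      and eq: "ar R i \<cdot>\<^bsub>D\<^esub> a = ar R i \<cdot>\<^bsub>D\<^esub> b" for W a b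
  proof -
    note [THEN L.C.Hom_simps, simp] = a b
    have "i \<cdot>\<^bsub>C\<^esub> (\<epsilon> X \<cdot>\<^bsub>C\<^esub> ar L c) = \<epsilon> Y \<cdot>\<^bsub>C\<^esub> ar L (ar R i \<cdot>\<^bsub>D\<^esub> c)"
      if "c \<in> Hom D W (ob R X)" for c
      using L.C.HomD[OF that] L.D.Comp_eq[OF counit_natural[OF i], of "ar L c"]
      by (simp add: L.ar_Comp_simp)
    then have "i \<cdot>\<^bsub>C\<^esub> (\<epsilon> X \<cdot>\<^bsub>C\<^esub> ar L a) = i \<cdot>\<^bsub>C\<^esub> (\<epsilon> X \<cdot>\<^bsub>C\<^esub> ar L b)"
      using a b eq by simp
    from R.C.is_kernelD(5)[OF ker _ _ this, of "ob L W"]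
    have "\<epsilon> X \<cdot>\<^bsub>C\<^esub> ar L a = \<epsilon> X \<cdot>\<^bsub>C\<^esub> ar L b" by (simp add: Hom_def)
    then show ?thesis
      using transpose_right[OF a L.D.HomD(4)[OF i]] transpose_right[OF b L.D.HomD(4)[OF i]] by metis
  qed
  have "s \<cdot>\<^bsub>D\<^esub> ar R p \<in> Hom D (ob R Y) (ob R Y)" by (simp add: Hom_def)
  from R.D.difference[OF L.C.Idt_in_Hom this]
  obtain d where d: "d \<in> Hom D (ob R Y) (ob R Y)"
      "Idt D (ob R Y) = (s \<cdot>\<^bsub>D\<^esub> ar R p) \<boxplus>\<^bsub>D\<^esub> d" by auto
  note [THEN L.C.Hom_simps, simp] = d(1)
  have "ar R p \<cdot>\<^bsub>D\<^esub> ((s \<cdot>\<^bsub>D\<^esub> ar R p) \<boxplus>\<^bsub>D\<^esub> d) = ar R p" unfolding d(2)[symmetric] by simp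
  then have "ar R p \<boxplus>\<^bsub>D\<^esub> (ar R p \<cdot>\<^bsub>D\<^esub> d) = ar R p" by (simp add: L.C.Comp_eq[OF s(2)])
  from R.D.Add_eq_self[OF _ _ this] have pd: "ar R p \<cdot>\<^bsub>D\<^esub> d = Zero D (ob R Y) (ob R Z)"
    by (simp add: Hom_def)
  have "((s \<cdot>\<^bsub>D\<^esub> ar R p) \<boxplus>\<^bsub>D\<^esub> d) \<cdot>\<^bsub>D\<^esub> s = s" unfolding d(2)[symmetric] by simp
  then have "s \<boxplus>\<^bsub>D\<^esub> (d \<cdot>\<^bsub>D\<^esub> s) = s" by simp
  from R.D.Add_eq_self[OF _ _ this] have ds: "d \<cdot>\<^bsub>D\<^esub> s = Zero D (ob R Z) (ob R Y)"
    by (simp add: Hom_def)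
  have "((s \<cdot>\<^bsub>D\<^esub> ar R p) \<boxplus>\<^bsub>D\<^esub> d) \<cdot>\<^bsub>D\<^esub> ar R i = ar R i" unfolding d(2)[symmetric] by simp
  then have di: "d \<cdot>\<^bsub>D\<^esub> ar R i = ar R i" by (simp add: Rz)
  define d' where "d' = \<epsilon> Y \<cdot>\<^bsub>C\<^esub> ar L d"
  have d': "d' \<in> Hom C (ob L (ob R Y)) Y" by (simp add: d'_def Hom_def)
  have "p \<cdot>\<^bsub>C\<^esub> d' = \<epsilon> Z \<cdot>\<^bsub>C\<^esub> ar L (ar R p \<cdot>\<^bsub>D\<^esub> d)"
    using L.D.Comp_eq[OF counit_natural[OF p], of "ar L d"]
    by (simp add: d'_def L.ar_Comp_simp)
  also have "\<dots> = Zero C (ob L (ob R Y)) Z"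
    using transpose_left[OF R.C.Zero_in_Hom, of "ob R Y" Z] by (simp add: pd R.ar_Zero)
  finally obtain c where c: "c \<in> Hom C (ob L (ob R Y)) X" "i \<cdot>\<^bsub>C\<^esub> c = d'"
    using R.C.is_kernelD(4)[OF ker, of d'] d' by auto
  note [THEN L.D.Hom_simps, simp] = c(1)
  define r where "r = ar R c \<cdot>\<^bsub>D\<^esub> \<eta> (ob R Y)"
  have r: "r \<in> Hom D (ob R Y) (ob R X)" by (simp add: r_def Hom_def)
  note [THEN L.C.Hom_simps, simp] = r
  have ir: "ar R i \<cdot>\<^bsub>D\<^esub> r = d"
    using transpose_right[OF d(1)] L.C.Comp_eq[OF R.ar_Comp_eq[OF c(2)], of "\<eta> (ob R Y)"]
    by (simp add: r_def d'_def)
  have "r \<cdot>\<^bsub>D\<^esub> ar R i = Idt D (ob R X)"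
    by (rule mono[of _ "ob R X"]) (simp_all add: Hom_def L.C.Comp_eq[OF ir] di)
  moreover have "r \<cdot>\<^bsub>D\<^esub> s = Zero D (ob R Z) (ob R X)"
    by (rule mono[of _ "ob R Z"]) (simp_all add: Hom_def L.C.Comp_eq[OF ir] ds)
  moreover have "(ar R i \<cdot>\<^bsub>D\<^esub> r) \<boxplus>\<^bsub>D\<^esub> (s \<cdot>\<^bsub>D\<^esub> ar R p) = Idt D (ob R Y)"
    unfolding ir d(2) by (rule R.D.Add_commute) simp_all
  ultimately have "biproduct D (ob R X) (ob R Z) (ob R Y) (ar R i) s r (ar R p)"
    by (simp add: biproduct_def Hom_def Rz)
  then show ?thesis unfolding split_exact_def by blast
qed

end

locale additive_left_adjoint = adjunction C D L R \<eta> \<epsilon> + L: additive_functor D C L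
  for C :: "('o, 'm, 'x) addcat_scheme" and D :: "('p, 'n, 'y) addcat_scheme"
    and L :: "('p, 'n, 'o, 'm) func" and R :: "('o, 'm, 'p, 'n) func"
    and \<eta> :: "'p \<Rightarrow> 'n" and \<epsilon> :: "'o \<Rightarrow> 'm"
begin

text \<open>The dual statement: a left adjoint preserves cokernels.\<close>

lemma left_adjoint_split_if_retraction:
  assumes coker: "is_cokernel D i p"
    and i: "i \<in> Hom D X Y" and p: "p \<in> Hom D Y Z"
    and r: "r \<in> Hom C (ob L Y) (ob L X)" "r \<cdot>\<^bsub>C\<^esub> ar L i = Idt C (ob L X)"
  shows "split_exact C (ar L i) (ar L p)"
proof -
  note [THEN L.C.Hom_simps, simp] = i p
  note [THEN L.D.Hom_simps, simp] = r(1)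
  note [simp] = r(2)
  have z: "p \<cdot>\<^bsub>D\<^esub> i = Zero D X Z" using L.C.is_cokernelD(3)[OF coker] by simp
  have Lz: "ar L p \<cdot>\<^bsub>C\<^esub> ar L i = Zero C (ob L X) (ob L Z)"
    using L.ar_Comp_eq[OF z] by (simp add: L.ar_Zero)
  have epi: "a = b"
    if a: "a \<in> Hom C (ob L Z) W" and b: "b \<in> Hom C (ob L Z) W"
      and eq: "a \<cdot>\<^bsub>C\<^esub> ar L p = b \<cdot>\<^bsub>C\<^esub> ar L p" for W a b
  proof -
    note [THEN L.D.Hom_simps, simp] = a b
    have t: "(ar R c \<cdot>\<^bsub>D\<^esub> \<eta> Z) \<cdot>\<^bsub>D\<^esub> p = ar R (c \<cdot>\<^bsub>C\<^esub> ar L p) \<cdot>\<^bsub>D\<^esub> \<eta> Y"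
      if "c \<in> Hom C (ob L Z) W" for c
      using L.D.HomD[OF that] unit_natural[OF p]
      by (simp add: R.ar_Comp_simp)
    have "(ar R a \<cdot>\<^bsub>D\<^esub> \<eta> Z) \<cdot>\<^bsub>D\<^esub> p = (ar R b \<cdot>\<^bsub>D\<^esub> \<eta> Z) \<cdot>\<^bsub>D\<^esub> p"
      unfolding t[OF a] t[OF b] eq ..
    from L.C.is_cokernelD(5)[OF coker _ _ this, of "ob R W"]
    have "ar R a \<cdot>\<^bsub>D\<^esub> \<eta> Z = ar R b \<cdot>\<^bsub>D\<^esub> \<eta> Z" by (simp add: Hom_def)
    then show ?thesis
      using transpose_left[OF a L.C.HomD(5)[OF p]] transpose_left[OF b L.C.HomD(5)[OF p]] by metis
  qed
  have "ar L i \<cdot>\<^bsub>C\<^esub> r \<in> Hom C (ob L Y) (ob L Y)" by (simp add: Hom_def)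
  from L.D.difference[OF L.D.Idt_in_Hom this]
  obtain d where d: "d \<in> Hom C (ob L Y) (ob L Y)"
      "Idt C (ob L Y) = (ar L i \<cdot>\<^bsub>C\<^esub> r) \<boxplus>\<^bsub>C\<^esub> d" by auto
  note [THEN L.D.Hom_simps, simp] = d(1)
  have "((ar L i \<cdot>\<^bsub>C\<^esub> r) \<boxplus>\<^bsub>C\<^esub> d) \<cdot>\<^bsub>C\<^esub> ar L i = ar L i" unfolding d(2)[symmetric] by simp
  then have "ar L i \<boxplus>\<^bsub>C\<^esub> (d \<cdot>\<^bsub>C\<^esub> ar L i) = ar L i" by simp
  from L.D.Add_eq_self[OF _ _ this] have di: "d \<cdot>\<^bsub>C\<^esub> ar L i = Zero C (ob L X) (ob L Y)"
    by (simp add: Hom_def)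
  have "r \<cdot>\<^bsub>C\<^esub> ((ar L i \<cdot>\<^bsub>C\<^esub> r) \<boxplus>\<^bsub>C\<^esub> d) = r" unfolding d(2)[symmetric] by simp
  then have "r \<boxplus>\<^bsub>C\<^esub> (r \<cdot>\<^bsub>C\<^esub> d) = r" by (simp add: L.D.Comp_eq[OF r(2)])
  from L.D.Add_eq_self[OF _ _ this] have rd: "r \<cdot>\<^bsub>C\<^esub> d = Zero C (ob L Y) (ob L X)"
    by (simp add: Hom_def)
  have "ar L p \<cdot>\<^bsub>C\<^esub> ((ar L i \<cdot>\<^bsub>C\<^esub> r) \<boxplus>\<^bsub>C\<^esub> d) = ar L p" unfolding d(2)[symmetric] by simp
  then have pd: "ar L p \<cdot>\<^bsub>C\<^esub> d = ar L p" by (simp add: L.D.Comp_eq[OF Lz])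
  define d' where "d' = ar R d \<cdot>\<^bsub>D\<^esub> \<eta> Y"
  have d': "d' \<in> Hom D Y (ob R (ob L Y))" by (simp add: d'_def Hom_def)
  have "d' \<cdot>\<^bsub>D\<^esub> i = ar R (d \<cdot>\<^bsub>C\<^esub> ar L i) \<cdot>\<^bsub>D\<^esub> \<eta> X"
    using unit_natural[OF i] by (simp add: d'_def R.ar_Comp_simp)
  also have "\<dots> = Zero D X (ob R (ob L Y))"
    using transpose_right[OF L.C.Zero_in_Hom, of X "ob L Y"] by (simp add: di L.ar_Zero)
  finally obtain c where c: "c \<in> Hom D Z (ob R (ob L Y))" "c \<cdot>\<^bsub>D\<^esub> p = d'"
    using L.C.is_cokernelD(4)[OF coker, of d'] d' by auto
  note [THEN L.C.Hom_simps, simp] = c(1)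
  define s where "s = \<epsilon> (ob L Y) \<cdot>\<^bsub>C\<^esub> ar L c"
  have s: "s \<in> Hom C (ob L Z) (ob L Y)" by (simp add: s_def Hom_def)
  note [THEN L.D.Hom_simps, simp] = s
  have sp: "s \<cdot>\<^bsub>C\<^esub> ar L p = d"
    using transpose_left[OF d(1)] L.ar_Comp_eq[OF c(2)] by (simp add: s_def d'_def)
  have "ar L p \<cdot>\<^bsub>C\<^esub> s = Idt C (ob L Z)"
    by (rule epi[of _ "ob L Z"]) (simp_all add: Hom_def sp pd)
  moreover have "r \<cdot>\<^bsub>C\<^esub> s = Zero C (ob L Z) (ob L X)"
    by (rule epi[of _ "ob L X"]) (simp_all add: Hom_def sp rd)
  moreover have "(ar L i \<cdot>\<^bsub>C\<^esub> r) \<boxplus>\<^bsub>C\<^esub> (s \<cdot>\<^bsub>C\<^esub> ar L p) = Idt C (ob L Y)"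
    unfolding sp d(2) ..
  ultimately have "biproduct C (ob L X) (ob L Z) (ob L Y) (ar L i) s r (ar L p)"
    by (simp add: biproduct_def Hom_def Lz)
  then show ?thesis unfolding split_exact_def by blast
qed

end

section \<open>Split pairs in exact categories\<close>

context exact_category
begin

lemma exact_pair_cokernel_change:
  assumes E: "(i, p) \<in> E" and q: "is_cokernel C i q"
  shows "(i, q) \<in> E"
proof -
  have p: "is_cokernel C i p" using kernel_cokernel_pair[OF E] by blast
  define X Y Z Z' where "X = Dom C i" and "Y = Cod C i" and "Z = Cod C p" and "Z' = Cod C q"
  have H: "i \<in> Hom C X Y" "p \<in> Hom C Y Z" "q \<in> Hom C Y Z'"
    using is_cokernelD(1,2)[OF p] is_cokernelD(2)[OF q] by (simp_all add: X_def Y_def Z_def Z'_def)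
  note [THEN Hom_simps, simp] = H(1-3)
  obtain c where c: "c \<in> Hom C Z Z'" "c \<cdot> p = q"
    using is_cokernelD(4)[OF p, of q Z'] is_cokernelD(3)[OF q] H(3) by auto
  obtain d where d: "d \<in> Hom C Z' Z" "d \<cdot> q = p"
    using is_cokernelD(4)[OF q, of p Z] is_cokernelD(3)[OF p] H(2) by auto
  note [THEN Hom_simps, simp] = c(1) d(1)
  have "d \<cdot> c = Idt C Z"
    by (rule is_cokernelD(5)[OF p, of _ Z]) (simp_all add: Hom_def c(2) d(2))
  moreover have "c \<cdot> d = Idt C Z'"
    by (rule is_cokernelD(5)[OF q, of _ Z']) (simp_all add: Hom_def c(2) d(2))
  ultimately have "is_iso C c" using is_isoI[OF c(1) d(1)] by blast
  then show ?thesis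
    by (intro iso_closed[OF E H(1,3), of "Idt C X" "Idt C Y" c])
      (simp_all add: Hom_def c(2) is_iso_Idt)
qed

text \<open>Pulling back the identity of a zero object along \<open>Z \<rightarrow> 0\<close> gives a deflation onto \<open>Z\<close> that is an
  isomorphism.\<close>

lemma zero_Idt_exact_pair:
  assumes Z: "Z \<in> Ob C"
  obtains K where "zero_object C K" "(Zero C K Z, Idt C Z) \<in> E"
proof -
  obtain Z\<^sub>0 where Z0: "zero_object C Z\<^sub>0" using ex_zero_object by blast
  note [simp] = Z zero_objectD(1)[OF Z0]
  define t where "t = Zero C Z Z\<^sub>0"
  have t: "t \<in> Hom C Z Z\<^sub>0" by (simp add: t_def Hom_def)
  note [THEN Hom_simps, simp] = t
  obtain q h where pb: "is_pullback C q h (Idt C Z\<^sub>0) t" and q_defl: "deflation E q"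
    using deflation_pullback[OF Idt_zero_deflation[OF Z0], of t Z] t by auto
  from pb obtain W M Z1 Z2 where H: "q \<in> Hom C W Z1" "h \<in> Hom C W M" "Idt C Z\<^sub>0 \<in> Hom C M Z2"
      "t \<in> Hom C Z1 Z2"
    and univ: "\<And>V a b. \<lbrakk>a \<in> Hom C V M; b \<in> Hom C V Z1; Idt C Z\<^sub>0 \<cdot> a = t \<cdot> b\<rbrakk>
        \<Longrightarrow> \<exists>!c. c \<in> Hom C V W \<and> h \<cdot> c = a \<and> q \<cdot> c = b"
    unfolding is_pullback_def by blast
  have "M = Z\<^sub>0" "Z1 = Z" using HomD(2)[OF H(3)] HomD(2)[OF H(4)] by simp_all
  note q = H(1)[unfolded this] and h = H(2)[unfolded this] and univ = univ[unfolded this]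
  note [THEN Hom_simps, simp] = q h
  obtain c where c: "c \<in> Hom C Z W" "q \<cdot> c = Idt C Z"
    using univ[of t Z "Idt C Z"] by (auto simp: Hom_def)
  note [THEN Hom_simps, simp] = c(1)
  have "\<exists>!e. e \<in> Hom C W W \<and> h \<cdot> e = h \<and> q \<cdot> e = q"
    using univ[of h W q] zero_objectD(2)[OF Z0, of h W "t \<cdot> q"] by (simp add: Hom_def)
  moreover have "h \<cdot> (c \<cdot> q) = h"
    by (rule zero_objectD(2)[OF Z0, of _ W]) (simp_all add: Hom_def)
  moreover have "q \<cdot> (c \<cdot> q) = q" by (simp add: Comp_eq[OF c(2)])
  ultimately have cq: "c \<cdot> q = Idt C W"
    by (metis Comp_in_Hom[OF q c(1)] Comp_Idt[OF h] Comp_Idt[OF q] Idt_in_Hom[OF HomD(4)[OF q]])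
  obtain k where k: "(k, q) \<in> E" using q_defl unfolding deflation_def by blast
  then have ker: "is_kernel C k q" using kernel_cokernel_pair by blast
  define K where "K = Dom C k"
  have kH: "k \<in> Hom C K W" using is_kernelD(1)[OF ker] by (simp add: K_def)
  note [THEN Hom_simps, simp] = kH
  have qk: "q \<cdot> k = Zero C K Z" using is_kernelD(3)[OF ker] by simp
  have "k = Zero C K W" using Comp_eq[OF cq, of k] by (simp add: qk)
  then have k0: "k \<cdot> Idt C K = k \<cdot> Zero C K K" by simp
  have "Idt C K = Zero C K K"
    by (rule is_kernelD(5)[OF ker _ _ k0, of K]) (simp_all add: Hom_def)
  then have "zero_object C K" by (simp add: zero_object_iff)
  moreover have "(Zero C K Z, Idt C Z) \<in> E"
    by (rule iso_closed[OF k, of _ K Z _ Z "Idt C K" q "Idt C Z"])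
      (simp_all add: Hom_def is_iso_Idt is_isoI[OF q c(1) cq c(2)] qk)
  ultimately show thesis using that by blast
qed

text \<open>\<open>X \<rightarrow> X \<oplus> Z\<close> is the pushout of the inflation \<open>0 \<rightarrow> Z\<close>.\<close>

lemma biproduct_exact_pair:
  assumes bip: "biproduct C X Z Y i s r p"
  shows "(i, p) \<in> E"
proof -
  have H: "i \<in> Hom C X Y" "s \<in> Hom C Z Y" "r \<in> Hom C Y X" "p \<in> Hom C Y Z"
    and eqs: "r \<cdot> i = Idt C X" "p \<cdot> s = Idt C Z" "r \<cdot> s = Zero C Z X" "p \<cdot> i = Zero C X Z"
    and sum: "(i \<cdot> r) \<boxplus> (s \<cdot> p) = Idt C Y"
    using bip by (auto simp: biproduct_def)
  note [THEN Hom_simps, simp] = H(1-4)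
  obtain K where K: "zero_object C K" and E: "(Zero C K Z, Idt C Z) \<in> E"
    using zero_Idt_exact_pair[of Z] by auto
  note [simp] = zero_objectD(1)[OF K]
  have "inflation E (Zero C K Z)" using E unfolding inflation_def by blast
  moreover have "Zero C K X \<in> Hom C (Dom C (Zero C K Z)) X" by (simp add: Hom_def)
  ultimately obtain j h where po: "is_pushout C j h (Zero C K Z) (Zero C K X)"
      and j_inf: "inflation E j"
    using inflation_pushout by blast
  have KH: "Zero C K Z \<in> Hom C K Z" "Zero C K X \<in> Hom C K X" by (simp_all add: Hom_def)
  obtain W where j: "j \<in> Hom C X W" and h: "h \<in> Hom C Z W"
    and ex: "\<And>V a b. \<lbrakk>a \<in> Hom C Z V; b \<in> Hom C X V; a \<cdot> Zero C K Z = b \<cdot> Zero C K X\<rbrakk>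
      \<Longrightarrow> \<exists>c \<in> Hom C W V. c \<cdot> h = a \<and> c \<cdot> j = b"
    and uni: "\<And>V c c'. \<lbrakk>c \<in> Hom C W V; c' \<in> Hom C W V; c \<cdot> h = c' \<cdot> h; c \<cdot> j = c' \<cdot> j\<rbrakk>
      \<Longrightarrow> c = c'"
    by (rule is_pushoutE[OF po KH]) (rule that, assumption+)
  note [THEN Hom_simps, simp] = j h
  obtain b where b: "b \<in> Hom C W Y" "b \<cdot> h = s" "b \<cdot> j = i"
    using ex[OF H(2,1)] by auto
  note [THEN Hom_simps, simp] = b(1)
  define b' where "b' = (j \<cdot> r) \<boxplus> (h \<cdot> p)"
  have b': "b' \<in> Hom C Y W" by (simp add: b'_def Hom_def)
  note [THEN Hom_simps, simp] = b'
  have bb': "b \<cdot> b' = Idt C Y"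
    by (simp add: b'_def Comp_eq[OF b(2)] Comp_eq[OF b(3)] sum)
  have b'b: "b' \<cdot> b = Idt C W"
    by (rule uni[of _ W]) (simp_all add: Hom_def b(2,3), simp_all add: b'_def eqs)
  obtain q where q: "(j, q) \<in> E" using j_inf unfolding inflation_def by blast
  then have qH: "q \<in> Hom C W (Cod C q)"
    using is_cokernelD(2) kernel_cokernel_pair[OF q] by fastforce
  define Q where "Q = Cod C q"
  note qH = qH[folded Q_def]
  note [THEN Hom_simps, simp] = qH
  have "(i, q \<cdot> b') \<in> E"
    by (rule iso_closed[OF q, of _ X Y _ Q "Idt C X" b "Idt C Q"])
      (simp_all add: Hom_def is_iso_Idt is_isoI[OF b(1) b' b'b bb'] b(3) b'b)
  then show ?thesis by (rule exact_pair_cokernel_change) (rule biproduct_cokernel[OF bip])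
qed

end

section \<open>The Frobenius structure of F-split pairs\<close>

text \<open>A functor \<open>F\<close> from an exact category to an additive category, with a left adjoint \<open>L\<close> whose
  counits are deflations, a right adjoint \<open>R\<close> whose units are inflations, and the same summands \<open>P\<close>
  of objects in the images of \<open>L\<close> and \<open>R\<close>.\<close>

locale adjoint_frobenius = A: exact_category A EA +
    LF: additive_right_adjoint A B L F \<eta>\<^sub>L \<epsilon> + FR: additive_left_adjoint B A F R \<eta> \<epsilon>\<^sub>R
  for A :: "('a, 'm, 'x) addcat_scheme" and EA :: "('m \<times> 'm) set"
    and B :: "('b, 'n, 'y) addcat_scheme"
    and F :: "('a, 'm, 'b, 'n) func" and L R :: "('b, 'n, 'a, 'm) func"
    and \<eta>\<^sub>L \<epsilon>\<^sub>R :: "'b \<Rightarrow> 'n" and \<epsilon> \<eta> :: "'a \<Rightarrow> 'm" +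
  fixes P :: "'a set"
  assumes counit_deflation: "X \<in> Ob A \<Longrightarrow> deflation EA (\<epsilon> X)"
    and unit_inflation: "X \<in> Ob A \<Longrightarrow> inflation EA (\<eta> X)"
    and P_left: "P = direct_summands A (ob L ` Ob B)"
    and P_right: "P = direct_summands A (ob R ` Ob B)"
begin

abbreviation "E \<equiv> F_split_pairs B F EA"

lemma exact_pair_Hom:
  assumes "(i, p) \<in> EA"
  shows "i \<in> Hom A (Dom A i) (Cod A i)" "p \<in> Hom A (Cod A i) (Cod A p)"
  using A.is_cokernelD(1,2) A.kernel_cokernel_pair[OF assms] by blast+

lemma F_splitD:
  assumes "(i, p) \<in> E" "i \<in> Hom A X Y" "p \<in> Hom A Y Z"
  obtains r s where "r \<in> Hom B (ob F Y) (ob F X)" "r \<cdot>\<^bsub>B\<^esub> ar F i = Idt B (ob F X)"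
    "s \<in> Hom B (ob F Z) (ob F Y)" "ar F p \<cdot>\<^bsub>B\<^esub> s = Idt B (ob F Z)"
proof -
  have "split_exact B (ar F i) (ar F p)" using assms(1) by (simp add: F_split_pairs_def)
  then obtain X1 Y1 Z1 s r where bip: "biproduct B X1 Z1 Y1 (ar F i) s r (ar F p)"
    unfolding split_exact_def by blast
  have "X1 = ob F X" "Y1 = ob F Y" "Z1 = ob F Z"
    using bip LF.R.ar_in_Hom[OF assms(2)] LF.R.ar_in_Hom[OF assms(3)]
    by (auto simp: biproduct_def Hom_def)
  then show thesis using that[of r s] bip by (simp add: biproduct_def)
qed

lemma F_split_if_section:
  assumes E: "(i, p) \<in> EA" and i: "i \<in> Hom A X Y" and p: "p \<in> Hom A Y Z"
    and s: "s \<in> Hom B (ob F Z) (ob F Y)" "ar F p \<cdot>\<^bsub>B\<^esub> s = Idt B (ob F Z)"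
  shows "(i, p) \<in> E"
  using LF.right_adjoint_split_if_section[OF _ i p s] A.kernel_cokernel_pair[OF E] E
  by (simp add: F_split_pairs_def)

lemma F_split_if_retraction:
  assumes E: "(i, p) \<in> EA" and i: "i \<in> Hom A X Y" and p: "p \<in> Hom A Y Z"
    and r: "r \<in> Hom B (ob F Y) (ob F X)" "r \<cdot>\<^bsub>B\<^esub> ar F i = Idt B (ob F X)"
  shows "(i, p) \<in> E"
  using FR.left_adjoint_split_if_retraction[OF _ i p r] A.kernel_cokernel_pair[OF E] E
  by (simp add: F_split_pairs_def)

lemma F_split_inflation_if_retraction:
  assumes "inflation EA i" and i: "i \<in> Hom A X Y"
    and r: "r \<in> Hom B (ob F Y) (ob F X)" "r \<cdot>\<^bsub>B\<^esub> ar F i = Idt B (ob F X)"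
  obtains p Z where "(i, p) \<in> E" "p \<in> Hom A Y Z"
proof -
  obtain p where p: "(i, p) \<in> EA" using assms(1) unfolding inflation_def by blast
  have pH: "p \<in> Hom A Y (Cod A p)" using exact_pair_Hom(2)[OF p] A.HomD[OF i] by simp
  show thesis using that[OF F_split_if_retraction[OF p i pH r] pH] .
qed

lemma left_image_mem: "Y \<in> Ob B \<Longrightarrow> ob L Y \<in> P"
  unfolding P_left direct_summands_def using A.direct_summand_refl LF.L.ob_in_Ob by blast

lemma right_image_mem: "Y \<in> Ob B \<Longrightarrow> ob R Y \<in> P"
  unfolding P_right direct_summands_def using A.direct_summand_refl FR.R.ob_in_Ob by blast

lemma P_projective:
  assumes E: "(i, p) \<in> E" and W: "W \<in> P" and f: "f \<in> Hom A W (Cod A p)"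
  shows "\<exists>g \<in> Hom A W (Dom A p). p \<cdot>\<^bsub>A\<^esub> g = f"
proof -
  have EA: "(i, p) \<in> EA" using E by (simp add: F_split_pairs_def)
  define X Y Z where "X = Dom A i" and "Y = Cod A i" and "Z = Cod A p"
  have i: "i \<in> Hom A X Y" and p: "p \<in> Hom A Y Z"
    using exact_pair_Hom[OF EA] by (simp_all add: X_def Y_def Z_def)
  note [THEN A.Hom_simps, simp] = i p
  obtain r s where s: "s \<in> Hom B (ob F Z) (ob F Y)" "ar F p \<cdot>\<^bsub>B\<^esub> s = Idt B (ob F Z)"
    using F_splitD[OF E i p] .
  obtain V X' j s' q p' where V: "V \<in> Ob B" and bip: "biproduct A W X' (ob L V) j s' q p'"
    using W unfolding P_left direct_summands_def direct_summand_def by blast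
  have j: "j \<in> Hom A W (ob L V)" and q: "q \<in> Hom A (ob L V) W" and qj: "q \<cdot>\<^bsub>A\<^esub> j = Idt A W"
    using bip by (simp_all add: biproduct_def)
  have f': "f \<in> Hom A W Z" using f by simp
  obtain g where g: "g \<in> Hom A (ob L V) Y" "p \<cdot>\<^bsub>A\<^esub> g = f \<cdot>\<^bsub>A\<^esub> q"
    using LF.left_adjoint_projective[OF V p A.Comp_in_Hom[OF q f'] s] by blast
  note [THEN A.Hom_simps, simp] = j q f' g(1)
  show ?thesis
    by (rule bexI[of _ "g \<cdot>\<^bsub>A\<^esub> j"]) (simp_all add: Hom_def A.Comp_eq[OF g(2)] qj)
qed

lemma P_injective:
  assumes E: "(i, p) \<in> E" and W: "W \<in> P" and f: "f \<in> Hom A (Dom A i) W"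
  shows "\<exists>g \<in> Hom A (Cod A i) W. g \<cdot>\<^bsub>A\<^esub> i = f"
proof -
  have EA: "(i, p) \<in> EA" using E by (simp add: F_split_pairs_def)
  define X Y Z where "X = Dom A i" and "Y = Cod A i" and "Z = Cod A p"
  have i: "i \<in> Hom A X Y" and p: "p \<in> Hom A Y Z"
    using exact_pair_Hom[OF EA] by (simp_all add: X_def Y_def Z_def)
  note [THEN A.Hom_simps, simp] = i p
  obtain r s where r: "r \<in> Hom B (ob F Y) (ob F X)" "r \<cdot>\<^bsub>B\<^esub> ar F i = Idt B (ob F X)"
    using F_splitD[OF E i p] .
  obtain V X' j s' q p' where V: "V \<in> Ob B" and bip: "biproduct A W X' (ob R V) j s' q p'"
    using W unfolding P_right direct_summands_def direct_summand_def by blast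
  have j: "j \<in> Hom A W (ob R V)" and q: "q \<in> Hom A (ob R V) W" and qj: "q \<cdot>\<^bsub>A\<^esub> j = Idt A W"
    using bip by (simp_all add: biproduct_def)
  have f': "f \<in> Hom A X W" using f by simp
  obtain g where g: "g \<in> Hom A Y (ob R V)" "g \<cdot>\<^bsub>A\<^esub> i = j \<cdot>\<^bsub>A\<^esub> f"
    using FR.right_adjoint_injective[OF V i A.Comp_in_Hom[OF f' j] r] by blast
  note [THEN A.Hom_simps, simp] = j q f' g(1)
  show ?thesis
    by (rule bexI[of _ "q \<cdot>\<^bsub>A\<^esub> g"]) (simp_all add: Hom_def g(2) A.Comp_eq[OF qj])
qed

lemma unit_pair:
  assumes X: "X \<in> Ob A"
  obtains p Z where "(\<eta> X, p) \<in> E" "p \<in> Hom A (ob R (ob F X)) Z"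
proof -
  have "\<epsilon>\<^sub>R (ob F X) \<cdot>\<^bsub>B\<^esub> ar F (\<eta> X) = Idt B (ob F X)" by (rule FR.counit_unit_L[OF X])
  then show thesis
    using F_split_inflation_if_retraction[OF unit_inflation[OF X] FR.unit_Hom[OF X]]
      FR.counit_Hom[OF LF.R.ob_in_Ob[OF X]] that by blast
qed

lemma counit_pair:
  assumes X: "X \<in> Ob A"
  shows "\<exists>i. (i, \<epsilon> X) \<in> E"
proof -
  obtain i where i: "(i, \<epsilon> X) \<in> EA" using counit_deflation[OF X] unfolding deflation_def by blast
  have e: "\<epsilon> X \<in> Hom A (ob L (ob F X)) X" by (rule LF.counit_Hom[OF X])
  have "i \<in> Hom A (Dom A i) (ob L (ob F X))"
    using exact_pair_Hom[OF i] A.HomD(2)[OF e] A.HomD(2)[OF exact_pair_Hom(2)[OF i]] by simp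
  from F_split_if_section[OF i this e LF.unit_Hom LF.counit_unit_R[OF X]]
  show ?thesis using LF.R.ob_in_Ob[OF X] by blast
qed

text \<open>For the pushout \<open>j : X' \<rightarrow> W\<close>, the unit of \<open>X'\<close> extends along \<open>j\<close>, because its target
  \<open>R (F X')\<close> is injective; the adjoint of the extension is a retraction of \<open>F j\<close>.\<close>

lemma F_split_pushout:
  assumes inf: "inflation E i" and f: "f \<in> Hom A (Dom A i) X'"
  shows "\<exists>j h. is_pushout A j h i f \<and> inflation E j"
proof -
  obtain p where E: "(i, p) \<in> E" using inf unfolding inflation_def by blast
  then have EA: "(i, p) \<in> EA" by (simp add: F_split_pairs_def)
  then have "inflation EA i" unfolding inflation_def by blast
  from A.inflation_pushout[OF this f] obtain j h
    where po: "is_pushout A j h i f" and j_inf: "inflation EA j" by blast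
  define X Y where "X = Dom A i" and "Y = Cod A i"
  have i: "i \<in> Hom A X Y" using exact_pair_Hom(1)[OF EA] by (simp add: X_def Y_def)
  have f': "f \<in> Hom A X X'" using f by (simp add: X_def)
  note [THEN A.Hom_simps, simp] = i f'
  obtain W where j: "j \<in> Hom A X' W"
    and ex: "\<And>V a b. \<lbrakk>a \<in> Hom A Y V; b \<in> Hom A X' V; a \<cdot>\<^bsub>A\<^esub> i = b \<cdot>\<^bsub>A\<^esub> f\<rbrakk>
      \<Longrightarrow> \<exists>c \<in> Hom A W V. c \<cdot>\<^bsub>A\<^esub> h = a \<and> c \<cdot>\<^bsub>A\<^esub> j = b"
    by (rule A.is_pushoutE[OF po i f']) (rule that, assumption+)
  note [THEN A.Hom_simps, simp] = j
  define V where "V = ob R (ob F X')"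
  have eta: "\<eta> X' \<in> Hom A X' V" using FR.unit_Hom[of X'] by (simp add: V_def)
  note [THEN A.Hom_simps, simp] = eta
  have "V \<in> P" by (simp add: V_def right_image_mem)
  from P_injective[OF E this, of "\<eta> X' \<cdot>\<^bsub>A\<^esub> f"]
  obtain a where a: "a \<in> Hom A Y V" "a \<cdot>\<^bsub>A\<^esub> i = \<eta> X' \<cdot>\<^bsub>A\<^esub> f" by (auto simp: Hom_def)
  obtain c where c: "c \<in> Hom A W V" "c \<cdot>\<^bsub>A\<^esub> j = \<eta> X'" using ex[OF a(1) eta a(2)] by blast
  note [THEN A.Hom_simps, simp] = c(1)
  have "ar F c \<cdot>\<^bsub>B\<^esub> ar F j = ar F (\<eta> X')" by (rule LF.R.ar_Comp_eq[OF c(2)]) simp_all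
  then have "(\<epsilon>\<^sub>R (ob F X') \<cdot>\<^bsub>B\<^esub> ar F c) \<cdot>\<^bsub>B\<^esub> ar F j = Idt B (ob F X')"
    using FR.counit_unit_L[of X'] by (simp add: V_def)
  moreover have "\<epsilon>\<^sub>R (ob F X') \<cdot>\<^bsub>B\<^esub> ar F c \<in> Hom B (ob F W) (ob F X')" by (simp add: Hom_def V_def)
  ultimately obtain p' Z' where "(j, p') \<in> E"
    using F_split_inflation_if_retraction[OF j_inf j] by blast
  then show ?thesis using po unfolding inflation_def by blast
qed

lemma F_split_inflation_Comp:
  assumes inf: "inflation E i" "inflation E j" and ij: "Cod A i = Dom A j"
  shows "inflation E (j \<cdot>\<^bsub>A\<^esub> i)"
proof -
  obtain p q where E: "(i, p) \<in> E" "(j, q) \<in> E" using inf unfolding inflation_def by blast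
  then have EA: "(i, p) \<in> EA" "(j, q) \<in> EA" by (simp_all add: F_split_pairs_def)
  define X Y Z where "X = Dom A i" and "Y = Cod A i" and "Z = Cod A j"
  have i: "i \<in> Hom A X Y" and j: "j \<in> Hom A Y Z"
    and p: "p \<in> Hom A Y (Cod A p)" and q: "q \<in> Hom A Z (Cod A q)"
    using exact_pair_Hom[OF EA(1)] exact_pair_Hom[OF EA(2)] ij by (simp_all add: X_def Y_def Z_def)
  note [THEN A.Hom_simps, simp] = i j
  obtain r s where r: "r \<in> Hom B (ob F Y) (ob F X)" "r \<cdot>\<^bsub>B\<^esub> ar F i = Idt B (ob F X)"
    using F_splitD[OF E(1) i p] .
  obtain t s' where t: "t \<in> Hom B (ob F Z) (ob F Y)" "t \<cdot>\<^bsub>B\<^esub> ar F j = Idt B (ob F Y)"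
    using F_splitD[OF E(2) j q] .
  note [THEN LF.L.C.Hom_simps, simp] = r(1) t(1)
  have ji: "j \<cdot>\<^bsub>A\<^esub> i \<in> Hom A X Z" by (simp add: Hom_def)
  have inf': "inflation EA (j \<cdot>\<^bsub>A\<^esub> i)"
    using A.inflation_Comp[of i j] EA ij unfolding inflation_def by blast
  have rt: "r \<cdot>\<^bsub>B\<^esub> t \<in> Hom B (ob F Z) (ob F X)" by (simp add: Hom_def)
  have "(r \<cdot>\<^bsub>B\<^esub> t) \<cdot>\<^bsub>B\<^esub> ar F (j \<cdot>\<^bsub>A\<^esub> i) = Idt B (ob F X)"
    by (simp add: LF.R.ar_Comp_simp LF.L.C.Comp_eq[OF t(2)] r(2))
  then show ?thesis
    using F_split_inflation_if_retraction[OF inf' ji rt] unfolding inflation_def by blast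
qed

lemma F_split_biproduct:
  assumes bip: "biproduct A X Z Y i s r p"
  shows "(i, p) \<in> E"
proof -
  have H: "i \<in> Hom A X Y" "s \<in> Hom A Z Y" "p \<in> Hom A Y Z" "p \<cdot>\<^bsub>A\<^esub> s = Idt A Z"
    using bip by (simp_all add: biproduct_def)
  note [THEN A.Hom_simps, simp] = H(1-3)
  have "ar F p \<cdot>\<^bsub>B\<^esub> ar F s = Idt B (ob F Z)"
    using LF.R.ar_Comp_eq[OF H(4)] by (simp add: LF.R.ar_Idt)
  then show ?thesis
    using F_split_if_section[OF A.biproduct_exact_pair[OF bip] H(1,3) LF.R.ar_in_Hom[OF H(2)]]
    by blast
qed

lemma F_split_cokernel_change:
  assumes E: "(i, p) \<in> E" and q: "is_cokernel A i q"
  shows "(i, q) \<in> E"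
proof -
  have EA: "(i, p) \<in> EA" using E by (simp add: F_split_pairs_def)
  note ip = exact_pair_Hom[OF EA]
  obtain r where r: "r \<in> Hom B (ob F (Cod A i)) (ob F (Dom A i))"
      "r \<cdot>\<^bsub>B\<^esub> ar F i = Idt B (ob F (Dom A i))"
    using F_splitD[OF E ip] by blast
  show ?thesis
    by (rule F_split_if_retraction[OF A.exact_pair_cokernel_change[OF EA q] ip(1)
          A.is_cokernelD(2)[OF q] r])
qed

lemma shift_choice_exists: "\<exists>\<iota> \<pi>. shift_choice A E P \<iota> \<pi>"
proof -
  have "\<exists>p. X \<in> Ob A \<longrightarrow> (\<eta> X, p) \<in> E" for X
    using unit_pair by blast
  then obtain \<pi> where "\<And>X. X \<in> Ob A \<Longrightarrow> (\<eta> X, \<pi> X) \<in> E" by metis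
  moreover have "Dom A (\<eta> X) = X" "Cod A (\<eta> X) \<in> P" if "X \<in> Ob A" for X
    using that right_image_mem[OF LF.R.ob_in_Ob[OF that]] by simp_all
  ultimately show ?thesis unfolding shift_choice_def by blast
qed

lemma frobenius:
  assumes "shift_choice A E P \<iota> \<pi>"
  shows "frobenius_pairs A E P \<iota> \<pi>"
proof (intro frobenius_pairs.intro A.additive_category_axioms frobenius_pairs_axioms.intro)
  show "is_kernel A i p" "is_cokernel A i p" if "(i, p) \<in> E" for i p
    using that A.kernel_cokernel_pair by (auto simp: F_split_pairs_def)
  show "P \<subseteq> Ob A"
    unfolding P_left direct_summands_def direct_summand_def biproduct_def by blast
  show "\<exists>(i, p) \<in> E. Cod A p = X \<and> Dom A p \<in> P" if X: "X \<in> Ob A" for X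
  proof -
    obtain i where "(i, \<epsilon> X) \<in> E" using counit_pair[OF X] by blast
    moreover have "Cod A (\<epsilon> X) = X" "Dom A (\<epsilon> X) \<in> P"
      using X left_image_mem[OF LF.R.ob_in_Ob[OF X]] by simp_all
    ultimately show ?thesis by blast
  qed
qed (fact assms F_split_cokernel_change F_split_biproduct F_split_inflation_Comp F_split_pushout
    P_injective P_projective)+

end

section \<open>The stable category\<close>

theorem theorem3p3:
  fixes A :: "('a, 'm) addcat" and EA :: "('m \<times> 'm) set"
    and B :: "('b, 'n) addcat" and EB :: "('n \<times> 'n) set"
    and F :: "('a, 'm, 'b, 'n) func" and L R :: "('b, 'n, 'a, 'm) func"
    and \<eta>\<^sub>L \<epsilon>\<^sub>R :: "'b \<Rightarrow> 'n" and \<epsilon> \<eta> :: "'a \<Rightarrow> 'm"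
    and P I :: "'a set"
  assumes "exact_category A EA" and "exact_category B EB"
    and "additive_functor A B F"
    and "adjunction A B L F \<eta>\<^sub>L \<epsilon>"
    and "adjunction B A F R \<eta> \<epsilon>\<^sub>R"
    and "\<And>X. X \<in> Ob A \<Longrightarrow> deflation EA (\<epsilon> X)"
    and "\<And>X. X \<in> Ob A \<Longrightarrow> inflation EA (\<eta> X)"
    and "P = direct_summands A (ob L ` Ob B)"
    and "I = direct_summands A (ob R ` Ob B)"
    and "P = I"
  shows "(\<exists>\<iota> \<pi>. shift_choice A (F_split_pairs B F EA) I \<iota> \<pi>) \<and>
    (\<forall>\<iota> \<pi>. shift_choice A (F_split_pairs B F EA) I \<iota> \<pi> \<longrightarrow>
       triangulated_category (quotient_cat A P) (shift_func A P \<iota> \<pi>)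
         (distinguished_triangles A P (F_split_pairs B F EA) \<iota> \<pi>) \<and>
       (\<forall>(i, p) \<in> F_split_pairs B F EA.
          \<exists>!\<omega>. \<exists>w. connecting A \<iota> \<pi> i p w \<and> \<omega> = cls A P w))"
proof -
  have ax: "adjoint_frobenius_axioms A EA B L R \<epsilon> \<eta> P"
    by (rule adjoint_frobenius_axioms.intro) (fact assms(6,7,8) trans[OF assms(10,9)])+
  interpret adjoint_frobenius A EA B F L R \<eta>\<^sub>L \<epsilon>\<^sub>R \<epsilon> \<eta> P
    by (intro adjoint_frobenius.intro additive_right_adjoint.intro additive_left_adjoint.intro
        ax assms(1,3,4,5))
  show ?thesis
    unfolding \<open>P = I\<close>[symmetric]
  proof (intro conjI allI impI)
    show "\<exists>\<iota> \<pi>. shift_choice A E P \<iota> \<pi>" by (rule shift_choice_exists)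
    fix \<iota> \<pi> assume "shift_choice A E P \<iota> \<pi>"
    then interpret frobenius_pairs A E P \<iota> \<pi> by (rule frobenius)
    show "triangulated_category (quotient_cat A P) (shift_func A P \<iota> \<pi>)
        (distinguished_triangles A P E \<iota> \<pi>)"
      by (rule triangulated)
    show "\<forall>(i, p) \<in> E. \<exists>!\<omega>. \<exists>w. connecting A \<iota> \<pi> i p w \<and> \<omega> = cls A P w"
    proof (rule ballI)
      fix t assume "t \<in> E"
      then show "case t of (i, p) \<Rightarrow> \<exists>!\<omega>. \<exists>w. connecting A \<iota> \<pi> i p w \<and> \<omega> = cls A P w"
        using connecting_class_unique[of "fst t" "snd t"] by (simp add: case_prod_beta)
    qed
  qed
qed

end
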